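(* Suppose a Banach space $X$ contains $\ell_2^n$ uniformly complementably, and $i:X\to Y$ is an isometric embedding into a Banach space $Y$. Then $\overline{i}(\mathrm{FBL}^{(p)}[X])$ is not a regular sublattice of $\mathrm{FBL}^{(p)}[Y]$ if one of the following holds: (1) $Y$ is a $\mathcal L_\infty$ space, and $1\le p<\infty$. (2) $Y$ is a $\mathcal L_1$ space, and $2\le p<\infty$.
   Context: All Banach spaces are real; embeddings are linear. $X$ contains $\ell_2^n$ uniformly complementably if there is a constant $C$ such that for every $n$ there are a subspace $E_n\subset X$ that is $C$-isomorphic to $\ell_2^n$ and a projection of $X$ onto $E_n$ of norm at most $C$. For $r\in\{1,\infty\}$, $Y$ is a $\mathcal L_r$ space if there is a constant $C$ such that every finite dimensional subspace of $Y$ is contained in a finite dimensional subspace $G\subset Y$ that is $C$-isomorphic to $\ell_r^{\dim G}$. Let $1/p+1/p'=1$. For $z_1,\dots,z_n$ in a Banach space, $\|(z_i)_{i=1}^n\|_{p,\mathrm{weak}}=\sup\{\|\sum_i\alpha_i z_i\| : \|(\alpha_i)_i\|_{\ell_{p'}}\le 1\}$. For a Banach space $X$, $H_{w^*}[X]$ is the vector lattice (pointwise operations and order) of positively homogeneous functions $f:X^*\to\mathbb R$ that are weak$^*$-continuous on bounded sets. For $f\in H_{w^*}[X]$, $\|f\|_p$ is the infimum of all $C\ge 0$ such that $(\sum_{i=1}^n|f(x_i^* )|^p)^{1/p}\le C\|(x_i^* )_{i=1}^n\|_{p,\mathrm{weak}}$ for all $n$ and all $x_1^*,\dots,x_n^*\in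 X^*$. $H_{w^*}^p[X]=\{f\in H_{w^*}[X]:\|f\|_p<\infty\}$, normed by $\|\cdot\|_p$. For $x\in X$, $\delta_x(x^* )=\langle x^*,x\rangle$. $\mathrm{FVL}[X]$ is the vector sublattice of $H_{w^*}[X]$ generated by $\{\delta_x:x\in X\}$; $\mathrm{FBL}^{(p)}[X]$ is the closure of $\mathrm{FVL}[X]$ in $H_{w^*}^p[X]$. For a bounded operator $i:X\to Y$, $\overline{i}:H_{w^*}^p[X]\to H_{w^*}^p[Y]$ is the lattice homomorphism $[\overline{i}f](y^* )=f(i^*y^* )$; it maps $\mathrm{FBL}^{(p)}[X]$ into $\mathrm{FBL}^{(p)}[Y]$, and is injective when $i$ is. For an injective lattice homomorphism $j:E\to F$ of vector lattices, $j(E)$ is a regular sublattice of $F$ if for every set $A\subset E$ having a supremum $a$ in $E$, $ja$ is the supremum of $j(A)$ in $F$. *)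

theory Defs
  imports "HOL-Analysis.Analysis" "HOL-Library.Lub_Glb"
begin

section \<open>Finite-dimensional \<open>\<ell>\<^sub>r\<close> spaces and local structure of Banach spaces\<close>

text \<open>
  \<open>\<ell>\<^sub>r\<^sup>n\<close> is realised on the sequences that vanish from index \<open>n\<close> on; \<open>r\<close> ranges over \<open>[1, \<infinity>]\<close>.
  The inserted \<open>0\<close> only matters for \<open>n = 0\<close>.
\<close>

definition lp_carrier :: "nat \<Rightarrow> (nat \<Rightarrow> real) set" where
  "lp_carrier n = {a. \<forall>i\<ge>n. a i = 0}"

definition lp_norm :: "ennreal \<Rightarrow> nat \<Rightarrow> (nat \<Rightarrow> real) \<Rightarrow> real" where
  "lp_norm r n a =
     (if r = \<infinity> then Max (insert 0 ((\<lambda>i. \<bar>a i\<bar>) ` {..<n}))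
      else (\<Sum>i<n. \<bar>a i\<bar> powr enn2real r) powr (1 / enn2real r))"

text \<open>
  There is a linear bijection \<open>T\<close> from \<open>\<ell>\<^sub>r\<^sup>n\<close> onto \<open>G\<close> with \<open>\<parallel>T\<parallel> \<parallel>T\<^sup>-\<^sup>1\<parallel> \<le> C\<close>; here \<open>A\<close> and \<open>B\<close> bound
  \<open>\<parallel>T\<parallel>\<close> and \<open>\<parallel>T\<^sup>-\<^sup>1\<parallel>\<close>, and injectivity follows from the lower estimate.
\<close>

definition isomorphic_to_lp :: "real \<Rightarrow> ennreal \<Rightarrow> nat \<Rightarrow> 'a::real_normed_vector set \<Rightarrow> bool" where
  "isomorphic_to_lp C r n G \<longleftrightarrow>
     (\<exists>(T :: (nat \<Rightarrow> real) \<Rightarrow> 'a) A B.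
        (\<forall>a\<in>lp_carrier n. \<forall>b\<in>lp_carrier n. T (\<lambda>i. a i + b i) = T a + T b) \<and>
        (\<forall>a\<in>lp_carrier n. \<forall>c. T (\<lambda>i. c * a i) = c *\<^sub>R T a) \<and>
        T ` lp_carrier n = G \<and>
        0 \<le> A \<and> 0 \<le> B \<and> A * B \<le> C \<and>
        (\<forall>a\<in>lp_carrier n. norm (T a) \<le> A * lp_norm r n a \<and> lp_norm r n a \<le> B * norm (T a)))"

definition contains_l2n_uniformly_complementably :: "'a::banach itself \<Rightarrow> bool" where
  "contains_l2n_uniformly_complementably _ \<longleftrightarrow>
     (\<exists>C. \<forall>n. \<exists>(E :: 'a set) (P :: 'a \<Rightarrow>\<^sub>L 'a).
        isomorphic_to_lp C 2 n E \<and>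
        P o\<^sub>L P = P \<and> range (blinfun_apply P) = E \<and> norm P \<le> C)"

definition script_L_space :: "ennreal \<Rightarrow> 'a::banach itself \<Rightarrow> bool" where
  "script_L_space r _ \<longleftrightarrow>
     (\<exists>C. \<forall>S :: 'a set. finite S \<longrightarrow>
        (\<exists>G. (\<exists>D. finite D \<and> G = span D) \<and> span S \<subseteq> G \<and> isomorphic_to_lp C r (dim G) G))"


section \<open>Free Banach lattices as function lattices on the dual\<close>

definition conjugate_exponent :: "real \<Rightarrow> ennreal" where
  "conjugate_exponent p = (if p = 1 then \<infinity> else ennreal (p / (p - 1)))"

lemma conjugate_exponent: "1 / ennreal p + 1 / conjugate_exponent p = 1" if "1 \<le> p"
proof (cases "p = 1")
  case False
  with that have "1 / ennreal p + 1 / ennreal (p / (p - 1)) = ennreal (1 / p + 1 / (p / (p - 1)))"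
    by (simp add: divide_ennreal flip: ennreal_1 ennreal_plus)
  also have "1 / p + 1 / (p / (p - 1)) = 1"
    using that False by (simp add: field_simps)
  finally show ?thesis
    using False by (simp add: conjugate_exponent_def)
qed (simp add: conjugate_exponent_def)

definition weak_norm :: "real \<Rightarrow> nat \<Rightarrow> (nat \<Rightarrow> 'z::real_normed_vector) \<Rightarrow> real" where
  "weak_norm p n z =
     Sup {norm (\<Sum>i<n. \<alpha> i *\<^sub>R z i) | \<alpha>. lp_norm (conjugate_exponent p) n \<alpha> \<le> 1}"

text \<open>
  On \<open>'a \<Rightarrow>\<^sub>L real\<close> the strong operator topology is the topology of pointwise convergence,
  i.e. the weak-star topology.
\<close>

definition Hws :: "(('a::banach \<Rightarrow>\<^sub>L real) \<Rightarrow> real) set" where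
  "Hws = {f. (\<forall>t\<ge>0. \<forall>\<phi>. f (t *\<^sub>R \<phi>) = t * f \<phi>) \<and>
             (\<forall>B. bounded B \<longrightarrow>
                continuous_map (subtopology strong_operator_topology B) euclideanreal f)}"

definition Hp_norm :: "real \<Rightarrow> (('a::banach \<Rightarrow>\<^sub>L real) \<Rightarrow> real) \<Rightarrow> ennreal" where
  "Hp_norm p f =
     Inf {ennreal C | C. 0 \<le> C \<and>
       (\<forall>n \<phi>. (\<Sum>i<n. \<bar>f (\<phi> i)\<bar> powr p) powr (1 / p) \<le> C * weak_norm p n \<phi>)}"

definition Hpws :: "real \<Rightarrow> (('a::banach \<Rightarrow>\<^sub>L real) \<Rightarrow> real) set" where
  "Hpws p = {f \<in> Hws. Hp_norm p f < \<infinity>}"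

definition point_eval :: "'a::banach \<Rightarrow> ('a \<Rightarrow>\<^sub>L real) \<Rightarrow> real" where
  "point_eval x = (\<lambda>\<phi>. blinfun_apply \<phi> x)"

definition vector_sublattice :: "('w \<Rightarrow> real) set \<Rightarrow> bool" where
  "vector_sublattice L \<longleftrightarrow>
     (\<lambda>_. 0) \<in> L \<and>
     (\<forall>f\<in>L. \<forall>g\<in>L. (\<lambda>w. f w + g w) \<in> L \<and> sup f g \<in> L \<and> inf f g \<in> L) \<and>
     (\<forall>f\<in>L. \<forall>c. (\<lambda>w. c * f w) \<in> L)"

definition FVL :: "(('a::banach \<Rightarrow>\<^sub>L real) \<Rightarrow> real) set" where
  "FVL = (\<lambda>L. vector_sublattice L \<and> L \<subseteq> Hws) hull (range point_eval)"

text \<open>The hull is nonvacuous: the ambient space is itself a vector lattice containing all \<open>\<delta>\<^sub>x\<close>.\<close>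

lemma vector_sublattice_Hws: "vector_sublattice Hws"
proof -
  have "sup f g \<in> Hws \<and> inf f g \<in> Hws" if "f \<in> Hws" "g \<in> Hws"
    for f g :: "('a \<Rightarrow>\<^sub>L real) \<Rightarrow> real"
    using that unfolding Hws_def sup_fun_def inf_fun_def sup_max inf_min
    by (auto intro!: continuous_map_real_max continuous_map_real_min
        simp: max_mult_distrib_left min_mult_distrib_left)
  then show ?thesis
    unfolding vector_sublattice_def
    by (auto simp: Hws_def algebra_simps intro!: continuous_map_add continuous_map_real_mult)
qed

lemma point_eval_in_Hws: "point_eval x \<in> Hws"
  by (auto simp: Hws_def point_eval_def blinfun.scaleR_left
      intro!: continuous_map_from_subtopology strong_operator_topology_continuous_evaluation)

definition FBL :: "real \<Rightarrow> (('a::banach \<Rightarrow>\<^sub>L real) \<Rightarrow> real) set" where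
  "FBL p = {f \<in> Hpws p. \<forall>\<epsilon>>0. \<exists>g\<in>FVL. Hp_norm p (\<lambda>\<phi>. f \<phi> - g \<phi>) < \<epsilon>}"

definition ibar :: "('a::banach \<Rightarrow>\<^sub>L 'b::banach) \<Rightarrow>
    (('a \<Rightarrow>\<^sub>L real) \<Rightarrow> real) \<Rightarrow> ('b \<Rightarrow>\<^sub>L real) \<Rightarrow> real" where
  "ibar i f = (\<lambda>\<psi>. f (\<psi> o\<^sub>L i))"

text \<open>
  Intended for an injective lattice homomorphism \<open>j\<close> from \<open>E\<close> to \<open>F\<close>; suprema are taken
  inside \<open>E\<close> and inside \<open>F\<close>, with respect to the order of the ambient types.
\<close>

definition regular_image :: "'e::order set \<Rightarrow> 'f::order set \<Rightarrow> ('e \<Rightarrow> 'f) \<Rightarrow> bool" where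
  "regular_image E F j \<longleftrightarrow> (\<forall>A a. A \<subseteq> E \<longrightarrow> isLub E A a \<longrightarrow> isLub F (j ` A) (j a))"

end

theory Submission
  imports Defs
begin

text \<open>
  Let \<open>e\<^sub>1, \<dots>, e\<^sub>n\<close> be an \<open>\<ell>\<^sub>2\<^sup>n\<close> basis of a complemented subspace of \<open>X\<close>, with biorthogonal functionals
  \<open>\<phi>\<^sub>1, \<dots>, \<phi>\<^sub>n\<close>. In \<open>FBL\<^sup>p[Y]\<close> the norm of \<open>\<Sum>\<^sub>j \<bar>\<delta>(e\<^sub>j)\<bar>\<close> is at most a constant times \<open>n\<^sup>3\<^sup>/\<^sup>4\<close>: coordinates in
  \<open>\<ell>\<^sub>\<infinity>\<close> or \<open>\<ell>\<^sub>1\<close> turn this into a truncation argument with fourth moments of sign averages. On the other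
  hand these functions average to about \<open>n\<close> along the random functionals \<open>\<Sum>\<^sub>j \<plusminus>\<phi>\<^sub>j\<close>, whose weak
  \<open>p\<close>-norm, normalised by the number of signs, is bounded independently of \<open>n\<close>.

  Choosing \<open>n = 2\<^sup>1\<^sup>6\<^sup>k\<close> and scaling, one gets \<open>a\<^sub>k\<close> in the free vector lattice that converge to
  \<open>0\<close> geometrically in \<open>FBL\<^sup>p[Y]\<close> although they blow up along random perturbations of every functional on \<open>X\<close>.
  An element of \<open>FBL\<^sup>p[X]\<close> is nearly a Lipschitz function of finitely many coordinates, so it changes
  little, on average, under such a perturbation; hence \<open>0\<close> is the supremum of the functions
  \<open>min (a\<^sub>k - \<bar>\<delta>(x)\<bar>) 0\<close> in \<open>FBL\<^sup>p[X]\<close>. In \<open>FBL\<^sup>p[Y]\<close> they have the upper bound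
  \<open>min (sup\<^sub>k a\<^sub>k - \<bar>\<delta>(x)\<bar>) 0\<close>, which is negative somewhere.
\<close>

section \<open>Sign averages\<close>

text \<open>The trivial bound for the norm of the sum of the \<bar>\<delta>(e_j)\<bar> is of order
  n, the same as its size along the random functionals; any exponent below 1 opens a gap. The gap
  also shows that these functionals, tame on X, have no extensions to Y with comparable weak norms,
  and this is where the two lattices part. Averaging over signs is forced. A single random
  functional may have norm of order sqrt n, so the pointwise estimate by
  \<open>\<epsilon> * norm\<close> is useless there; only the p-average over all sign vectors,
  measured by the weak norm, stays bounded. The choices come in the order: the upper bound v, its
  approximant g with a finite set of points and a Lipschitz constant, the length t of the
  perturbation, and last k. Since t depends on g, the functions must outgrow every 1/t, hence a
  whole sequence of them. With n = 2^(16k) the norm is of order 2^(12k) and the random size 2^(16k);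
  the factor 2^(-14k) lies midway and turns these into 4^(-k) and 4^k.\<close>

lemma sum_powr_le_card_sum_powr:
  fixes x :: "'i \<Rightarrow> real"
  assumes "finite I" "1 \<le> p" and x: "\<And>i. i \<in> I \<Longrightarrow> 0 \<le> x i"
  shows "(\<Sum>i\<in>I. x i) powr p \<le> real (card I) powr (p - 1) * (\<Sum>i\<in>I. x i powr p)"
proof -
  \<comment> \<open>Jensen's inequality is applied on the positive reals, so vanishing terms are
    removed first; this only lowers the cardinality.\<close>
  define J where "J = {i \<in> I. 0 < x i}"
  have J: "finite J" "J \<subseteq> I" using assms(1) by (auto simp: J_def)
  have sumJ: "(\<Sum>i\<in>I. x i) = (\<Sum>i\<in>J. x i)"
    using x by (intro sum.mono_neutral_right) (auto simp: J_def assms(1) order.antisym not_less)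
  show ?thesis
  proof (cases "J = {}")
    case True
    then show ?thesis using sumJ by (simp add: sum_nonneg)
  next
    case False
    define N where "N = real (card J)"
    have N: "N > 0" using False J by (simp add: N_def card_gt_0_iff)
    have "(\<Sum>i\<in>J. (1/N) *\<^sub>R x i) powr p \<le> (\<Sum>i\<in>J. (1/N) * (x i powr p))"
    proof (rule convex_on_sum[OF J(1) False powr_convex[OF assms(2)]])
      show "(\<Sum>i\<in>J. 1 / N) = 1" using N by (simp add: N_def)
    qed (use N in \<open>auto simp: J_def\<close>)
    then have "((\<Sum>i\<in>J. x i) / N) powr p \<le> (\<Sum>i\<in>J. x i powr p) / N"
      by (simp add: sum_divide_distrib)
    then have "(\<Sum>i\<in>J. x i) powr p \<le> N powr p * ((\<Sum>i\<in>J. x i powr p) / N)"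
      using N x J by (simp add: powr_divide sum_nonneg subsetD field_simps)
    also have "\<dots> = N powr (p - 1) * (\<Sum>i\<in>J. x i powr p)"
      using N by (simp add: powr_diff)
    also have "\<dots> \<le> real (card I) powr (p - 1) * (\<Sum>i\<in>I. x i powr p)"
      using J assms(1,2) N by (intro mult_mono powr_mono2 sum_mono2 sum_nonneg) (auto simp: N_def card_mono)
    finally show ?thesis using sumJ by simp
  qed
qed

lemma add_powr_le:
  fixes a b :: real
  assumes "0 \<le> a" "0 \<le> b" "0 \<le> p"
  shows "(a + b) powr p \<le> 2 powr p * (a powr p + b powr p)"
proof -
  have "(a + b) powr p \<le> (2 * max a b) powr p"
    using assms by (intro powr_mono2) auto
  also have "\<dots> = 2 powr p * max a b powr p"
    using assms by (simp add: powr_mult)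
  also have "\<dots> \<le> 2 powr p * (a powr p + b powr p)"
    by (intro mult_left_mono) (auto simp: max_def)
  finally show ?thesis .
qed

lemma sum_abs_le_sqrt_card:
  fixes b :: "'i \<Rightarrow> real"
  shows "(\<Sum>j\<in>I. \<bar>b j\<bar>) \<le> sqrt (card I) * sqrt (\<Sum>j\<in>I. (b j)\<^sup>2)"
proof -
  have "(\<Sum>j\<in>I. 1 * \<bar>b j\<bar>)\<^sup>2 \<le> (\<Sum>j\<in>I. 1\<^sup>2) * (\<Sum>j\<in>I. \<bar>b j\<bar>\<^sup>2)"
    by (rule Cauchy_Schwarz_ineq_sum)
  then have "(\<Sum>j\<in>I. \<bar>b j\<bar>)\<^sup>2 \<le> card I * (\<Sum>j\<in>I. (b j)\<^sup>2)" by simp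
  then have "sqrt ((\<Sum>j\<in>I. \<bar>b j\<bar>)\<^sup>2) \<le> sqrt (card I * (\<Sum>j\<in>I. (b j)\<^sup>2))"
    by (rule real_sqrt_le_mono)
  then show ?thesis by (simp add: real_sqrt_mult sum_nonneg)
qed

text \<open>For \<open>i < 2\<^sup>n\<close> the binary digits of \<open>i\<close> run through all sign vectors of length \<open>n\<close>.\<close>

fun rad :: "nat \<Rightarrow> nat \<Rightarrow> real" where
  "rad i 0 = (if even i then 1 else - 1)"
| "rad i (Suc j) = rad (i div 2) j"

lemma abs_rad [simp]: "\<bar>rad i j\<bar> = 1"
  by (induction i j rule: rad.induct) auto

section \<open>Second and fourth moments of sign sums\<close>

lemma sum_rad_double:
  "(\<Sum>j<Suc n. rad (2 * i) j * b j) = (\<Sum>j<n. rad i j * b (Suc j)) + b 0"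
  "(\<Sum>j<Suc n. rad (Suc (2 * i)) j * b j) = (\<Sum>j<n. rad i j * b (Suc j)) - b 0"
  by (simp_all add: sum.lessThan_Suc_shift del: sum.lessThan_Suc)

lemma sum_lessThan_double:
  fixes F :: "nat \<Rightarrow> real"
  shows "(\<Sum>i<2 * m. F i) = (\<Sum>i<m. F (2 * i) + F (Suc (2 * i)))"
  by (induction m) auto

text \<open>Conditioning on one sign: the lowest binary digit of the index decides the sign of
  \<open>b 0\<close>, the other digits decide the rest. The moments below are inductions along this
  identity, with \<open>b\<close> shifted.\<close>

lemma sum_sign_vectors_Suc:
  fixes F :: "real \<Rightarrow> real"
  shows "(\<Sum>i<2 ^ Suc n. F (\<Sum>j<Suc n. rad i j * b j)) =
    (\<Sum>i<2 ^ n. F ((\<Sum>j<n. rad i j * b (Suc j)) + b 0) + F ((\<Sum>j<n. rad i j * b (Suc j)) - b 0))"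
  unfolding power_Suc sum_lessThan_double sum_rad_double by simp

lemma sum_rad_power2:
  "(\<Sum>i<2 ^ n. (\<Sum>j<n. rad i j * b j)\<^sup>2) = 2 ^ n * (\<Sum>j<n. (b j)\<^sup>2)"
proof (induction n arbitrary: b)
  case (Suc n)
  have "(\<Sum>i<2 ^ Suc n. (\<Sum>j<Suc n. rad i j * b j)\<^sup>2) =
      (\<Sum>i<2 ^ n. 2 * (\<Sum>j<n. rad i j * b (Suc j))\<^sup>2 + 2 * (b 0)\<^sup>2)"
    unfolding sum_sign_vectors_Suc[of "\<lambda>x. x\<^sup>2"]
    by (intro sum.cong refl) (simp add: power2_eq_square algebra_simps)
  also have "\<dots> = 2 * (2 ^ n * (\<Sum>j<n. (b (Suc j))\<^sup>2)) + 2 ^ n * (2 * (b 0)\<^sup>2)"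
    by (simp add: sum.distrib Suc.IH flip: sum_distrib_left)
  also have "\<dots> = 2 ^ Suc n * (\<Sum>j<Suc n. (b j)\<^sup>2)"
    by (simp add: sum.lessThan_Suc_shift algebra_simps del: sum.lessThan_Suc)
  finally show ?case .
qed auto

text \<open>The constant 3, the fourth moment of a standard Gaussian, does not depend on
  \<open>n\<close>.\<close>

lemma sum_rad_power4_le:
  "(\<Sum>i<2 ^ n. (\<Sum>j<n. rad i j * b j) ^ 4) \<le> 3 * 2 ^ n * (\<Sum>j<n. (b j)\<^sup>2)\<^sup>2"
proof (induction n arbitrary: b)
  case (Suc n)
  define B where "B = (\<Sum>j<n. (b (Suc j))\<^sup>2)"
  have "(\<Sum>i<2 ^ Suc n. (\<Sum>j<Suc n. rad i j * b j) ^ 4) =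
      (\<Sum>i<2 ^ n. 2 * (\<Sum>j<n. rad i j * b (Suc j)) ^ 4
        + 12 * (b 0)\<^sup>2 * (\<Sum>j<n. rad i j * b (Suc j))\<^sup>2 + 2 * (b 0) ^ 4)"
    unfolding sum_sign_vectors_Suc[of "\<lambda>x. x ^ 4"]
    by (intro sum.cong refl) (simp add: power2_eq_square power4_eq_xxxx algebra_simps)
  also have "\<dots> = 2 * (\<Sum>i<2 ^ n. (\<Sum>j<n. rad i j * b (Suc j)) ^ 4)
      + 12 * (b 0)\<^sup>2 * (2 ^ n * B) + 2 ^ n * (2 * (b 0) ^ 4)"
    by (simp add: sum.distrib sum_rad_power2 B_def flip: sum_distrib_left)
  \<comment> \<open>Raising the coefficient of \<open>(b 0) ^ 4\<close> from 2 to 6 completes the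
    square.\<close>
  also have "\<dots> \<le> 2 * (3 * 2 ^ n * B\<^sup>2) + 12 * (b 0)\<^sup>2 * (2 ^ n * B) + 2 ^ n * (6 * (b 0) ^ 4)"
    using Suc.IH[of "\<lambda>j. b (Suc j)"] unfolding B_def
    by (intro add_mono mult_left_mono) auto
  also have "\<dots> = 3 * 2 ^ Suc n * ((b 0)\<^sup>2 + B)\<^sup>2"
    by (simp add: power2_eq_square power4_eq_xxxx algebra_simps)
  also have "(b 0)\<^sup>2 + B = (\<Sum>j<Suc n. (b j)\<^sup>2)"
    by (simp add: sum.lessThan_Suc_shift B_def del: sum.lessThan_Suc)
  finally show ?case .
qed auto

text \<open>The lower bound integrates \<open>2 \<bar>y\<bar> \<ge> 3 y\<^sup>2 - y\<^sup>4\<close>, scaled to be sharp at the standard deviation.\<close>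

lemma Khintchine_lower:
  "2 ^ n * sqrt (\<Sum>j<n. (b j)\<^sup>2) \<le> sqrt 3 * (\<Sum>i<2 ^ n. \<bar>\<Sum>j<n. rad i j * b j\<bar>)"
proof -
  define B where "B = (\<Sum>j<n. (b j)\<^sup>2)"
  define S where "S i = (\<Sum>j<n. rad i j * b j)" for i
  have B0: "B \<ge> 0" by (simp add: B_def sum_nonneg)
  show ?thesis
  proof (cases "B = 0")
    case False
    \<comment> \<open>With s = \<open>c\<^sup>2 * B\<close> the moments give the lower bound (3 s -
      3 s^2) / (2 c) for the mean of the absolute values; it is largest at s = 1/3.\<close>
    define c where "c = 1 / sqrt (3 * B)"
    have c: "c > 0" "c\<^sup>2 * B = 1/3" using False B0 by (auto simp: c_def power_divide)
    have poly: "3 * y\<^sup>2 - y ^ 4 \<le> 2 * \<bar>y\<bar>" for y :: real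
    proof -
      have "0 \<le> \<bar>y\<bar> * ((\<bar>y\<bar> - 1)\<^sup>2 * (\<bar>y\<bar> + 2))" by simp
      also have "\<dots> = 2 * \<bar>y\<bar> - 3 * \<bar>y\<bar>\<^sup>2 + \<bar>y\<bar> ^ 4"
        by (simp add: power2_eq_square power4_eq_xxxx algebra_simps)
      finally show ?thesis by simp
    qed
    have "2 ^ n * (2/3) = 3 * c\<^sup>2 * (2 ^ n * B) - c ^ 4 * (3 * 2 ^ n * B\<^sup>2)"
    proof -
      have "3 * c\<^sup>2 * (2 ^ n * B) - c ^ 4 * (3 * 2 ^ n * B\<^sup>2)
         = 2 ^ n * (3 * (c\<^sup>2 * B) - 3 * (c\<^sup>2 * B)\<^sup>2)"
        by (simp add: power2_eq_square power4_eq_xxxx algebra_simps)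
      then show ?thesis unfolding c by (simp add: power2_eq_square)
    qed
    also have "\<dots> \<le> 3 * c\<^sup>2 * (\<Sum>i<2 ^ n. (S i)\<^sup>2) - c ^ 4 * (\<Sum>i<2 ^ n. (S i) ^ 4)"
      using sum_rad_power2[where n = n and b = b] sum_rad_power4_le[where n = n and b = b] c(1)
      by (intro diff_mono mult_left_mono) (auto simp: S_def B_def)
    also have "\<dots> = (\<Sum>i<2 ^ n. 3 * (c * S i)\<^sup>2 - (c * S i) ^ 4)"
      by (simp add: sum_subtractf sum_distrib_left power_mult_distrib mult.assoc)
    also have "\<dots> \<le> (\<Sum>i<2 ^ n. 2 * \<bar>c * S i\<bar>)" by (intro sum_mono poly)
    also have "\<dots> = 2 * c * (\<Sum>i<2 ^ n. \<bar>S i\<bar>)"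
      using c(1) by (simp add: abs_mult sum_distrib_left mult.assoc)
    finally have "2 ^ n / 3 \<le> c * (\<Sum>i<2 ^ n. \<bar>S i\<bar>)" by simp
    then have "2 ^ n * (1/3) / c \<le> (\<Sum>i<2 ^ n. \<bar>S i\<bar>)" using c(1) by (simp add: field_simps)
    moreover have "1 / c = sqrt 3 * sqrt B" by (simp add: c_def real_sqrt_mult)
    ultimately have "2 ^ n * (1/3) * (sqrt 3 * sqrt B) \<le> (\<Sum>i<2 ^ n. \<bar>S i\<bar>)"
      by (metis divide_inverse inverse_eq_divide)
    then have "sqrt 3 * (2 ^ n * (1/3) * (sqrt 3 * sqrt B)) \<le> sqrt 3 * (\<Sum>i<2 ^ n. \<bar>S i\<bar>)"
      by (intro mult_left_mono) auto
    moreover have "sqrt 3 * (2 ^ n * (1/3) * (sqrt 3 * sqrt B)) = 2 ^ n * sqrt B"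
    proof -
      have "sqrt 3 * (2 ^ n * (1/3) * (sqrt 3 * sqrt B)) = (sqrt 3 * sqrt 3) * (2 ^ n * (1/3) * sqrt B)"
        by (simp only: mult_ac)
      then show ?thesis by simp
    qed
    ultimately show ?thesis unfolding S_def B_def by linarith
  qed (auto simp: B_def sum_nonneg)
qed

section \<open>Exponential moments and the upper Khintchine inequality\<close>

lemma exp_plus_exp_minus_le:
  fixes x :: real
  shows "exp x + exp (- x) \<le> 2 * exp (x\<^sup>2)"
proof -
  have *: "exp y + exp (- y) \<le> 2 * exp (y\<^sup>2)" if "0 \<le> y" for y :: real
  proof (cases "y \<le> 1")
    case True
    have "exp y \<le> 1 + y + y\<^sup>2" using exp_bound that True by blast
    moreover have "exp (- y) \<le> 1 - y + y\<^sup>2"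
    proof -
      have "1 \<le> (1 - y + y\<^sup>2) * (1 + y)" 
        using that by (simp add: power2_eq_square algebra_simps)
      also have "\<dots> \<le> (1 - y + y\<^sup>2) * exp y"
        using True that by (intro mult_left_mono) (auto simp: exp_ge_add_one_self)
      finally show ?thesis by (simp add: exp_minus field_simps)
    qed
    ultimately have "exp y + exp (- y) \<le> 2 * (1 + y\<^sup>2)" by simp
    also have "\<dots> \<le> 2 * exp (y\<^sup>2)" by (intro mult_left_mono exp_ge_add_one_self) auto
    finally show ?thesis .
  next
    case False
    then have "y \<le> y\<^sup>2" by (simp add: power2_eq_square)
    then have "exp y \<le> exp (y\<^sup>2)" "exp (- y) \<le> exp (y\<^sup>2)" using that by auto
    then show ?thesis by linarith
  qed
  show ?thesis using *[of "\<bar>x\<bar>"] by (cases "0 \<le> x") auto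
qed

lemma sum_rad_exp_le:
  "(\<Sum>i<2 ^ n. exp (\<Sum>j<n. rad i j * b j)) \<le> 2 ^ n * exp (\<Sum>j<n. (b j)\<^sup>2)"
proof (induction n arbitrary: b)
  case (Suc n)
  have "(\<Sum>i<2 ^ Suc n. exp (\<Sum>j<Suc n. rad i j * b j)) =
      (exp (b 0) + exp (- b 0)) * (\<Sum>i<2 ^ n. exp (\<Sum>j<n. rad i j * b (Suc j)))"
    unfolding sum_sign_vectors_Suc[of exp] sum_distrib_left
    by (intro sum.cong) (auto simp: exp_add exp_diff exp_minus field_simps)
  also have "\<dots> \<le> (2 * exp ((b 0)\<^sup>2)) * (2 ^ n * exp (\<Sum>j<n. (b (Suc j))\<^sup>2))"
    by (intro mult_mono exp_plus_exp_minus_le Suc.IH) (auto simp: sum_nonneg)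
  also have "\<dots> = 2 ^ Suc n * exp (\<Sum>j<Suc n. (b j)\<^sup>2)"
    by (simp add: sum.lessThan_Suc_shift exp_add del: sum.lessThan_Suc)
  finally show ?case .
qed auto

text \<open>The factor p^p comes from \<bar>s\<bar>^p \<le> p^p exp \<bar>s\<bar>, the 2 from the
  two signs of s, and \<open>exp 1\<close> from the exponential moment at variance at most
  1.\<close>

definition Khintchine_const :: "real \<Rightarrow> real" where
  "Khintchine_const p = 2 * p powr p * exp 1"

text \<open>Exponential moments of the normalised sum control every power of it. The number
  \<open>\<sigma>\<close> only has to bound the standard deviation, so that
  \<open>C * norm x\<close> can be inserted for it.\<close>

lemma Khintchine_upper:
  assumes p: "0 < p" and \<sigma>: "0 \<le> \<sigma>" "(\<Sum>j<n. (b j)\<^sup>2) \<le> \<sigma>\<^sup>2"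
  shows "(\<Sum>i<2 ^ n. \<bar>\<Sum>j<n. rad i j * b j\<bar> powr p) \<le> 2 ^ n * Khintchine_const p * \<sigma> powr p"
proof (cases "\<sigma> = 0")
  case True
  have "b j = 0" if "j < n" for j
  proof -
    have "(b j)\<^sup>2 \<le> (\<Sum>j<n. (b j)\<^sup>2)" using that by (intro member_le_sum) auto
    also have "\<dots> \<le> 0" using True \<sigma> by simp
    finally show ?thesis by simp
  qed
  then show ?thesis using True p by simp
next
  case False
  then have s: "\<sigma> > 0" using \<sigma> by simp
  have pw: "\<bar>s\<bar> powr p \<le> p powr p * (exp s + exp (- s))" for s :: real
  proof -
    have "\<bar>s\<bar> / p \<le> exp (\<bar>s\<bar> / p)" using exp_ge_add_one_self[of "\<bar>s\<bar> / p"] by linarith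
    then have "\<bar>s\<bar> \<le> p * exp (\<bar>s\<bar> / p)" using p by (simp add: field_simps)
    then have "\<bar>s\<bar> powr p \<le> (p * exp (\<bar>s\<bar> / p)) powr p" using p by (intro powr_mono2) auto
    also have "\<dots> = p powr p * exp \<bar>s\<bar>" using p by (simp add: powr_mult exp_powr_real)
    also have "\<dots> \<le> p powr p * (exp s + exp (- s))"
      by (intro mult_left_mono) (auto simp: abs_if)
    finally show ?thesis .
  qed
  define S where "S i = (\<Sum>j<n. rad i j * (b j / \<sigma>))" for i
  have S: "(\<Sum>j<n. rad i j * b j) = \<sigma> * S i" for i
    using s by (simp add: S_def sum_distrib_left)
  have var: "(\<Sum>j<n. (c * (b j / \<sigma>))\<^sup>2) \<le> 1" if "\<bar>c\<bar> = 1" for c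
  proof -
    have "(\<Sum>j<n. (c * (b j / \<sigma>))\<^sup>2) = (\<Sum>j<n. (b j)\<^sup>2) / \<sigma>\<^sup>2"
    proof -
      have "c\<^sup>2 = 1" using that by (simp add: abs_square_eq_1)
      then show ?thesis by (simp add: sum_divide_distrib power_divide power_mult_distrib)
    qed
    also have "\<dots> \<le> 1" using \<sigma> s by simp
    finally show ?thesis .
  qed
  have E: "(\<Sum>i<2 ^ n. exp (c * S i)) \<le> 2 ^ n * exp 1" if "\<bar>c\<bar> = 1" for c
  proof -
    have "(\<Sum>i<2 ^ n. exp (c * S i)) = (\<Sum>i<2 ^ n. exp (\<Sum>j<n. rad i j * (c * (b j / \<sigma>))))"
      by (simp add: S_def sum_distrib_left mult_ac)
    also have "\<dots> \<le> 2 ^ n * exp (\<Sum>j<n. (c * (b j / \<sigma>))\<^sup>2)" by (rule sum_rad_exp_le)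
    also have "\<dots> \<le> 2 ^ n * exp 1" using var[OF that] by simp
    finally show ?thesis .
  qed
  have "(\<Sum>i<2 ^ n. \<bar>\<sigma> * S i\<bar> powr p) = \<sigma> powr p * (\<Sum>i<2 ^ n. \<bar>S i\<bar> powr p)"
    using s by (simp add: abs_mult powr_mult sum_distrib_left)
  also have "\<dots> \<le> \<sigma> powr p * (\<Sum>i<2 ^ n. p powr p * (exp (S i) + exp (- S i)))"
    by (intro mult_left_mono sum_mono pw) auto
  also have "\<dots> = \<sigma> powr p * (p powr p * ((\<Sum>i<2 ^ n. exp (1 * S i)) + (\<Sum>i<2 ^ n. exp ((-1) * S i))))"
    by (simp add: sum.distrib flip: sum_distrib_left)
  also have "\<dots> \<le> \<sigma> powr p * (p powr p * (2 ^ n * exp 1 + 2 ^ n * exp 1))"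
    by (intro mult_left_mono add_mono E) auto
  finally show ?thesis unfolding S by (simp add: Khintchine_const_def mult_ac)
qed

section \<open>Coordinate estimates in \<open>\<ell>\<^sub>\<infinity>\<close> and \<open>\<ell>\<^sub>1\<close>\<close>

text \<open>The coordinates of the \<open>e j\<close> are cut at the level \<open>R / m\<close>: the small part is estimated termwise,
  the large part is summable in \<open>j\<close>, so that sign sums of it stay bounded in \<open>\<ell>\<^sub>\<infinity>\<close>.\<close>

lemma sum_coordinate_powr_le_Linf:
  fixes e u :: "nat \<Rightarrow> nat \<Rightarrow> real"
  assumes p: "1 \<le> p" and m: "0 < m" and R: "0 \<le> R" and Q: "0 \<le> Q"
    and sq: "\<And>t. t < M \<Longrightarrow> (\<Sum>j<m^4. (e j t)\<^sup>2) \<le> R\<^sup>2"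
    and u: "\<And>x h. 0 \<le> h \<Longrightarrow> (\<And>t. t < M \<Longrightarrow> \<bar>x t\<bar> \<le> h) \<Longrightarrow>
      (\<Sum>l<N. \<bar>\<Sum>t<M. u l t * x t\<bar> powr p) \<le> (Q * h) powr p"
  shows "(\<Sum>l<N. (\<Sum>j<m^4. \<bar>\<Sum>t<M. u l t * e j t\<bar>) powr p) \<le> (8 * real m ^ 3 * Q * R) powr p"
proof -
  define n where "n = m ^ 4"
  \<comment> \<open>The level balances two costs. The m^4 small terms add up to m^4 * (R / m). For
    the large part the sum over \<open>j\<close> is at most m * R by a Chebyshev estimate, and
    Cauchy-Schwarz over m^4 indices costs a further m^2. Both give m^3 * R.\<close>
  define s where "s j t = (if \<bar>e j t\<bar> \<le> R / m then e j t else 0)" for j t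
  define w where "w j t = e j t - s j t" for j t
  have n0: "n > 0" using m by (simp add: n_def)
  have small: "(\<Sum>l<N. (\<Sum>j<n. \<bar>\<Sum>t<M. u l t * s j t\<bar>) powr p) \<le> (m ^ 3 * Q * R) powr p"
  proof -
    have "(\<Sum>l<N. (\<Sum>j<n. \<bar>\<Sum>t<M. u l t * s j t\<bar>) powr p)
        \<le> (\<Sum>l<N. n powr (p - 1) * (\<Sum>j<n. \<bar>\<Sum>t<M. u l t * s j t\<bar> powr p))"
      using sum_powr_le_card_sum_powr[of "{..<n}" p] p by (intro sum_mono) simp
    also have "\<dots> = n powr (p - 1) * (\<Sum>j<n. \<Sum>l<N. \<bar>\<Sum>t<M. u l t * s j t\<bar> powr p)"
      unfolding sum_distrib_left[symmetric] by (subst sum.swap) (rule refl)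
    also have "\<dots> \<le> n powr (p - 1) * (\<Sum>j<n. (Q * (R / m)) powr p)"
      using R m by (intro mult_left_mono sum_mono u) (auto simp: s_def)
    also have "\<dots> = (n * (Q * (R / m))) powr p"
      unfolding powr_mult[of "real n" "Q * (R / m)"] using n0 by (simp add: powr_diff)
    also have "n * (Q * (R / m)) = m ^ 3 * Q * R"
      using m by (simp add: n_def power4_eq_xxxx power3_eq_cube)
    finally show ?thesis .
  qed
  have l1: "(\<Sum>j<n. \<bar>w j t\<bar>) \<le> m * R" if "t < M" for t
  proof (cases "R = 0")
    case True
    have "e j t = 0" if "j < n" for j
    proof -
      have "(e j t)\<^sup>2 \<le> (\<Sum>j<n. (e j t)\<^sup>2)" using that by (intro member_le_sum) auto
      also have "\<dots> \<le> 0" using sq[OF \<open>t < M\<close>] True by (simp add: n_def)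
      finally show ?thesis by simp
    qed
    then show ?thesis using True by (simp add: w_def s_def)
  next
    case False
    have "R * (\<Sum>j<n. \<bar>w j t\<bar>) \<le> m * (\<Sum>j<n. (e j t)\<^sup>2)"
      unfolding sum_distrib_left
    proof (intro sum_mono)
      fix j
      show "R * \<bar>w j t\<bar> \<le> m * (e j t)\<^sup>2"
      proof (cases "\<bar>e j t\<bar> \<le> R / m")
        case False
        then have "R \<le> m * \<bar>e j t\<bar>" using m by (simp add: field_simps)
        then have "R * \<bar>e j t\<bar> \<le> m * \<bar>e j t\<bar> * \<bar>e j t\<bar>" by (intro mult_right_mono) auto
        with False show ?thesis by (simp add: w_def s_def power2_eq_square mult.assoc)
      qed (simp add: w_def s_def)
    qed
    also have "\<dots> \<le> m * R\<^sup>2" using sq[OF that] by (intro mult_left_mono) (auto simp: n_def)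
    also have "\<dots> = R * (m * R)" by (simp add: power2_eq_square)
    finally show ?thesis using False R by simp
  qed
  have large: "(\<Sum>l<N. (\<Sum>j<n. \<bar>\<Sum>t<M. u l t * w j t\<bar>) powr p) \<le> (2 * (m ^ 3 * Q * R)) powr p"
  proof -
    define S where "S l i = (\<Sum>j<n. rad i j * (\<Sum>t<M. u l t * w j t))" for l i
    \<comment> \<open>Cauchy-Schwarz and the lower Khintchine inequality replace the sum over
      \<open>j\<close> by an average over signs, so that \<open>u\<close> can be applied to one
      bounded vector for each sign pattern.\<close>
    have "(\<Sum>j<n. \<bar>\<Sum>t<M. u l t * w j t\<bar>) powr p
        \<le> (m\<^sup>2 * sqrt 3) powr p * (1 / 2 ^ n * (\<Sum>i<2^n. \<bar>S l i\<bar> powr p))" for l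
    proof -
      define b where "b j = (\<Sum>t<M. u l t * w j t)" for j
      have "(\<Sum>j<n. \<bar>b j\<bar>) \<le> m\<^sup>2 * sqrt (\<Sum>j<n. (b j)\<^sup>2)"
      proof -
        have "sqrt (real n) = m\<^sup>2"
          by (rule real_sqrt_unique) (auto simp: n_def power2_eq_square power4_eq_xxxx)
        then show ?thesis using sum_abs_le_sqrt_card[of b "{..<n}"] by simp
      qed
      also have "\<dots> \<le> m\<^sup>2 * (sqrt 3 * (1 / 2 ^ n * (\<Sum>i<2 ^ n. \<bar>S l i\<bar>)))"
        using Khintchine_lower[where n = n and b = b] by (intro mult_left_mono) (auto simp: S_def b_def field_simps)
      finally have "(\<Sum>j<n. \<bar>b j\<bar>) powr p \<le> (m\<^sup>2 * sqrt 3 * (1 / 2 ^ n) * (\<Sum>i<2 ^ n. \<bar>S l i\<bar>)) powr p"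
        using p by (intro powr_mono2) (auto simp: sum_nonneg mult.assoc)
      also have "\<dots> = (m\<^sup>2 * sqrt 3) powr p * ((1 / 2 ^ n) powr p * (\<Sum>i<2 ^ n. \<bar>S l i\<bar>) powr p)"
        by (simp add: powr_mult powr_divide sum_nonneg)
      also have "\<dots> \<le> (m\<^sup>2 * sqrt 3) powr p * ((1 / 2 ^ n) powr p *
          ((2 ^ n) powr (p - 1) * (\<Sum>i<2 ^ n. \<bar>S l i\<bar> powr p)))"
        using sum_powr_le_card_sum_powr[of "{..<2^n::nat}" p "\<lambda>i. \<bar>S l i\<bar>"] p
        by (intro mult_left_mono) auto
      also have "(1 / 2 ^ n) powr p * ((2 ^ n) powr (p - 1) * (\<Sum>i<2 ^ n. \<bar>S l i\<bar> powr p))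
          = 1 / 2 ^ n * (\<Sum>i<2 ^ n. \<bar>S l i\<bar> powr p)"
        by (simp add: powr_divide powr_diff)
      finally show ?thesis unfolding b_def .
    qed
    then have "(\<Sum>l<N. (\<Sum>j<n. \<bar>\<Sum>t<M. u l t * w j t\<bar>) powr p)
        \<le> (\<Sum>l<N. (m\<^sup>2 * sqrt 3) powr p * (1 / 2 ^ n * (\<Sum>i<2^n. \<bar>S l i\<bar> powr p)))"
      by (intro sum_mono)
    also have "\<dots> = (m\<^sup>2 * sqrt 3) powr p * (1 / 2 ^ n * (\<Sum>i<2^n. \<Sum>l<N. \<bar>S l i\<bar> powr p))"
      unfolding sum_distrib_left[symmetric] by (subst sum.swap) (rule refl)
    also have "\<dots> \<le> (m\<^sup>2 * sqrt 3) powr p * (1 / 2 ^ n * (\<Sum>i<2^n::nat. (Q * (m * R)) powr p))"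
    proof (intro mult_left_mono sum_mono)
      fix i
      have "S l i = (\<Sum>t<M. u l t * (\<Sum>j<n. rad i j * w j t))" for l
        unfolding S_def sum_distrib_left by (subst sum.swap) (simp add: mult_ac)
      moreover have "(\<Sum>l<N. \<bar>\<Sum>t<M. u l t * (\<Sum>j<n. rad i j * w j t)\<bar> powr p) \<le> (Q * (m * R)) powr p"
      proof (rule u)
        fix t assume "t < M"
        have "\<bar>\<Sum>j<n. rad i j * w j t\<bar> \<le> (\<Sum>j<n. \<bar>rad i j * w j t\<bar>)" by (rule sum_abs)
        also have "\<dots> = (\<Sum>j<n. \<bar>w j t\<bar>)" by (simp add: abs_mult)
        finally show "\<bar>\<Sum>j<n. rad i j * w j t\<bar> \<le> m * R" using l1[OF \<open>t < M\<close>] by simp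
      qed (use R in auto)
      ultimately show "(\<Sum>l<N. \<bar>S l i\<bar> powr p) \<le> (Q * (m * R)) powr p" by simp
    qed auto
    also have "\<dots> = (m\<^sup>2 * sqrt 3 * (Q * (m * R))) powr p"
      using Q R by (simp add: powr_mult)
    also have "\<dots> \<le> (2 * (m ^ 3 * Q * R)) powr p"
    proof (intro powr_mono2)
      have "sqrt 3 \<le> 2" by (simp add: real_le_lsqrt)
      then have "sqrt 3 * (m ^ 3 * Q * R) \<le> 2 * (m ^ 3 * Q * R)"
        using Q R by (intro mult_right_mono) auto
      then show "m\<^sup>2 * sqrt 3 * (Q * (m * R)) \<le> 2 * (m ^ 3 * Q * R)"
        by (simp add: power2_eq_square power3_eq_cube mult_ac)
    qed (use p Q R in auto)
    finally show ?thesis .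
  qed
  have "(\<Sum>l<N. (\<Sum>j<n. \<bar>\<Sum>t<M. u l t * e j t\<bar>) powr p)
      \<le> (\<Sum>l<N. 2 powr p * ((\<Sum>j<n. \<bar>\<Sum>t<M. u l t * s j t\<bar>) powr p + (\<Sum>j<n. \<bar>\<Sum>t<M. u l t * w j t\<bar>) powr p))"
  proof (intro sum_mono)
    fix l
    have "(\<Sum>j<n. \<bar>\<Sum>t<M. u l t * e j t\<bar>) \<le> (\<Sum>j<n. \<bar>\<Sum>t<M. u l t * s j t\<bar> + \<bar>\<Sum>t<M. u l t * w j t\<bar>)"
    proof (intro sum_mono)
      fix j
      have "(\<Sum>t<M. u l t * e j t) = (\<Sum>t<M. u l t * s j t) + (\<Sum>t<M. u l t * w j t)"
        by (simp add: w_def algebra_simps sum_subtractf)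
      then show "\<bar>\<Sum>t<M. u l t * e j t\<bar> \<le> \<bar>\<Sum>t<M. u l t * s j t\<bar> + \<bar>\<Sum>t<M. u l t * w j t\<bar>" by simp
    qed
    also have "\<dots> = (\<Sum>j<n. \<bar>\<Sum>t<M. u l t * s j t\<bar>) + (\<Sum>j<n. \<bar>\<Sum>t<M. u l t * w j t\<bar>)"
      by (rule sum.distrib)
    finally have "(\<Sum>j<n. \<bar>\<Sum>t<M. u l t * e j t\<bar>) powr p
      \<le> ((\<Sum>j<n. \<bar>\<Sum>t<M. u l t * s j t\<bar>) + (\<Sum>j<n. \<bar>\<Sum>t<M. u l t * w j t\<bar>)) powr p"
      using p by (intro powr_mono2) (auto simp: sum_nonneg)
    also have "\<dots> \<le> 2 powr p * ((\<Sum>j<n. \<bar>\<Sum>t<M. u l t * s j t\<bar>) powr p + (\<Sum>j<n. \<bar>\<Sum>t<M. u l t * w j t\<bar>) powr p)"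
      using p by (intro add_powr_le) (auto simp: sum_nonneg)
    finally show "(\<Sum>j<n. \<bar>\<Sum>t<M. u l t * e j t\<bar>) powr p \<le> \<dots>" .
  qed
  also have "\<dots> \<le> 2 powr p * ((m ^ 3 * Q * R) powr p + (2 * (m ^ 3 * Q * R)) powr p)"
    unfolding sum_distrib_left[symmetric] sum.distrib
    by (intro mult_left_mono add_mono small large) auto
  also have "\<dots> \<le> 2 powr p * (2 * (2 * (m ^ 3 * Q * R)) powr p)"
    using Q R p by (intro mult_left_mono) (auto intro!: powr_mono2 mult_nonneg_nonneg)
  also have "\<dots> \<le> 2 powr p * (2 powr p * (2 * (m ^ 3 * Q * R)) powr p)"
    using p powr_mono[of 1 p 2] by (intro mult_left_mono mult_right_mono) auto
  also have "\<dots> = (2 * (2 * (2 * (m ^ 3 * Q * R)))) powr p"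
    using Q R by (simp only: powr_mult)
  also have "2 * (2 * (2 * (m ^ 3 * Q * R))) = 8 * real m ^ 3 * Q * R" by simp
  finally show ?thesis unfolding n_def .
qed

text \<open>A weak form of Grothendieck's inequality. Cutting \<open>X i t = (\<Sum>l<N. rad i l * v l t)\<close>
  at the level \<open>m * D\<close>, the bounded part is handled by \<open>e2\<close> and the rest by the fourth moment.\<close>

lemma little_Grothendieck_weak:
  fixes e v :: "nat \<Rightarrow> nat \<Rightarrow> real"
  assumes m: "0 < m" and D: "0 \<le> D" and R: "0 \<le> R"
    and e1: "\<And>j. j < m^4 \<Longrightarrow> (\<Sum>t<M. \<bar>e j t\<bar>) \<le> R"
    and e2: "\<And>x h. 0 \<le> h \<Longrightarrow> (\<And>t. t < M \<Longrightarrow> \<bar>x t\<bar> \<le> h) \<Longrightarrow>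
      (\<Sum>j<m^4. (\<Sum>t<M. e j t * x t)\<^sup>2) \<le> (R * h)\<^sup>2"
    and v: "\<And>t. t < M \<Longrightarrow> (\<Sum>l<N. (v l t)\<^sup>2) \<le> D\<^sup>2"
  shows "(\<Sum>l<N. \<Sum>j<m^4. (\<Sum>t<M. e j t * v l t)\<^sup>2) \<le> 8 * (real m * R * D)\<^sup>2"
proof -
  define X where "X i t = (\<Sum>l<N. rad i l * v l t)" for i t
  define s where "s i t = (if \<bar>X i t\<bar> \<le> m * D then X i t else 0)" for i t
  define w where "w i t = X i t - s i t" for i t
  \<comment> \<open>Where \<open>w\<close> is nonzero it equals \<open>X\<close> and exceeds the
    cut, so its square is at most \<open>X\<close> to the fourth divided by the square of the
    cut.\<close>
  have w2: "(\<Sum>i<2^N. (w i t)\<^sup>2) \<le> 3 * 2 ^ N * D\<^sup>2 / (real m)\<^sup>2" if "t < M" for t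
  proof (cases "D = 0")
    case True
    have "v l t = 0" if "l < N" for l
    proof -
      have "(v l t)\<^sup>2 \<le> (\<Sum>l<N. (v l t)\<^sup>2)" using that by (intro member_le_sum) auto
      also have "\<dots> \<le> 0" using v[OF \<open>t < M\<close>] True by simp
      finally show ?thesis by simp
    qed
    then show ?thesis using True by (simp add: X_def w_def s_def)
  next
    case False
    have "(m * D)\<^sup>2 * (\<Sum>i<2^N. (w i t)\<^sup>2) \<le> (\<Sum>i<2^N. X i t ^ 4)"
      unfolding sum_distrib_left
    proof (intro sum_mono)
      fix i
      show "(m * D)\<^sup>2 * (w i t)\<^sup>2 \<le> X i t ^ 4"
      proof (cases "\<bar>X i t\<bar> \<le> m * D")
        case False
        then have "(m * D)\<^sup>2 \<le> (X i t)\<^sup>2" using D by (intro abs_le_square_iff[THEN iffD1]) auto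
        then have "(m * D)\<^sup>2 * (X i t)\<^sup>2 \<le> (X i t)\<^sup>2 * (X i t)\<^sup>2" by (intro mult_right_mono) auto
        with False show ?thesis by (simp add: w_def s_def power2_eq_square power4_eq_xxxx mult_ac)
      qed (simp add: w_def s_def)
    qed
    also have "\<dots> \<le> 3 * 2 ^ N * (\<Sum>l<N. (v l t)\<^sup>2)\<^sup>2"
      unfolding X_def by (rule sum_rad_power4_le)
    also have "\<dots> \<le> 3 * 2 ^ N * (D\<^sup>2)\<^sup>2"
      using v[OF that] by (intro mult_left_mono power_mono) (auto simp: sum_nonneg)
    finally have *: "(m * D)\<^sup>2 * (\<Sum>i<2^N. (w i t)\<^sup>2) \<le> 3 * 2 ^ N * (D\<^sup>2)\<^sup>2" .
    have "D\<^sup>2 * ((real m)\<^sup>2 * (\<Sum>i<2^N. (w i t)\<^sup>2)) \<le> D\<^sup>2 * (3 * 2 ^ N * D\<^sup>2)"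
      using * by (simp add: power_mult_distrib power2_eq_square mult_ac)
    then have "(real m)\<^sup>2 * (\<Sum>i<2^N. (w i t)\<^sup>2) \<le> 3 * 2 ^ N * D\<^sup>2" 
      using False by (subst (asm) mult_le_cancel_left_pos) auto
    then show ?thesis using m by (simp add: field_simps)
  qed
  \<comment> \<open>Orthogonality of the sign sums: the sum over \<open>l\<close> becomes an average
    over \<open>i\<close>, with \<open>v l\<close> replaced by the random vector \<open>X i\<close>,
    which can be truncated.\<close>
  have "2 ^ N * (\<Sum>l<N. (\<Sum>t<M. e j t * v l t)\<^sup>2) = (\<Sum>i<2^N. (\<Sum>t<M. e j t * X i t)\<^sup>2)" for j
  proof -
    have "(\<Sum>t<M. e j t * X i t) = (\<Sum>l<N. rad i l * (\<Sum>t<M. e j t * v l t))" for i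
      unfolding X_def sum_distrib_left by (subst sum.swap) (simp add: mult_ac)
    then show ?thesis using sum_rad_power2[where n = N and b = "\<lambda>l. \<Sum>t<M. e j t * v l t"] by simp
  qed
  then have "2 ^ N * (\<Sum>l<N. \<Sum>j<m^4. (\<Sum>t<M. e j t * v l t)\<^sup>2)
      = (\<Sum>j<m^4. \<Sum>i<2^N. (\<Sum>t<M. e j t * X i t)\<^sup>2)"
    by (subst sum.swap) (simp add: sum_distrib_left)
  also have "\<dots> \<le> (\<Sum>j<m^4. \<Sum>i<2^N. 2 * (\<Sum>t<M. e j t * s i t)\<^sup>2 + 2 * (\<Sum>t<M. e j t * w i t)\<^sup>2)"
  proof (intro sum_mono)
    fix i j
    have "(\<Sum>t<M. e j t * X i t) = (\<Sum>t<M. e j t * s i t) + (\<Sum>t<M. e j t * w i t)"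
      by (simp add: w_def algebra_simps sum_subtractf)
    then show "(\<Sum>t<M. e j t * X i t)\<^sup>2 \<le> 2 * (\<Sum>t<M. e j t * s i t)\<^sup>2 + 2 * (\<Sum>t<M. e j t * w i t)\<^sup>2"
      using sum_squares_bound[of "\<Sum>t<M. e j t * s i t" "\<Sum>t<M. e j t * w i t"]
      by (simp add: power2_sum)
  qed
  also have "\<dots> = 2 * (\<Sum>i<2^N. \<Sum>j<m^4. (\<Sum>t<M. e j t * s i t)\<^sup>2)
      + 2 * (\<Sum>j<m^4. \<Sum>i<2^N. (\<Sum>t<M. e j t * w i t)\<^sup>2)"
    by (subst (2) sum.swap) (simp add: sum.distrib sum_distrib_left)
  \<comment> \<open>Per sign vector the bounded part contributes 2 (m R D)^2. The rest is estimated
    for each of the m^4 indices \<open>j\<close> separately, but its second moment carries 1 / m^2,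
    giving 6 (m R D)^2.\<close>
  also have "\<dots> \<le> 2 * (\<Sum>i<2^N::nat. (R * (m * D))\<^sup>2) + 2 * (\<Sum>j<m^4. R * (R * (3 * 2 ^ N * D\<^sup>2 / (real m)\<^sup>2)))"
  proof (intro add_mono mult_left_mono sum_mono)
    fix i
    show "(\<Sum>j<m^4. (\<Sum>t<M. e j t * s i t)\<^sup>2) \<le> (R * (m * D))\<^sup>2"
      using D by (intro e2) (auto simp: s_def)
  next
    fix j assume j: "j \<in> {..<m^4}"
    have "(\<Sum>i<2^N. (\<Sum>t<M. e j t * w i t)\<^sup>2) \<le> (\<Sum>i<2^N. R * (\<Sum>t<M. \<bar>e j t\<bar> * (w i t)\<^sup>2))"
    proof (intro sum_mono)
      fix i
      \<comment> \<open>Splitting the weight into two square roots lets Cauchy-Schwarz use only the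
        l1 bound \<open>e1\<close>, keeping the other factor linear in \<bar>e j t\<bar>, hence
        summable over \<open>i\<close> by \<open>w2\<close>.\<close>
      have "(\<Sum>t<M. e j t * w i t)\<^sup>2 = (\<Sum>t<M. sqrt \<bar>e j t\<bar> * (sgn (e j t) * sqrt \<bar>e j t\<bar> * w i t))\<^sup>2"
      proof -
        have "e j t = sqrt \<bar>e j t\<bar> * (sgn (e j t) * sqrt \<bar>e j t\<bar>)" for t
          by (cases "e j t" "0::real" rule: linorder_cases) auto
        then have "e j t * w i t = sqrt \<bar>e j t\<bar> * (sgn (e j t) * sqrt \<bar>e j t\<bar> * w i t)" for t
          by (metis mult.assoc)
        then show ?thesis by presburger
      qed
      also have "\<dots> \<le> (\<Sum>t<M. (sqrt \<bar>e j t\<bar>)\<^sup>2) * (\<Sum>t<M. (sgn (e j t) * sqrt \<bar>e j t\<bar> * w i t)\<^sup>2)"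
        by (rule Cauchy_Schwarz_ineq_sum)
      also have "\<dots> = (\<Sum>t<M. \<bar>e j t\<bar>) * (\<Sum>t<M. \<bar>e j t\<bar> * (w i t)\<^sup>2)"
      proof -
        have "(sgn (e j t) * sqrt \<bar>e j t\<bar> * w i t)\<^sup>2 = \<bar>e j t\<bar> * (w i t)\<^sup>2" for t
          by (cases "e j t = 0") (auto simp: power_mult_distrib sgn_if)
        then show ?thesis by simp
      qed
      also have "\<dots> \<le> R * (\<Sum>t<M. \<bar>e j t\<bar> * (w i t)\<^sup>2)"
        using j by (intro mult_right_mono e1) (auto simp: sum_nonneg)
      finally show "(\<Sum>t<M. e j t * w i t)\<^sup>2 \<le> R * (\<Sum>t<M. \<bar>e j t\<bar> * (w i t)\<^sup>2)" .
    qed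
    also have "\<dots> = R * (\<Sum>t<M. \<bar>e j t\<bar> * (\<Sum>i<2^N. (w i t)\<^sup>2))"
      unfolding sum_distrib_left by (subst sum.swap) (rule refl)
    also have "\<dots> \<le> R * (\<Sum>t<M. \<bar>e j t\<bar> * (3 * 2 ^ N * D\<^sup>2 / (real m)\<^sup>2))"
      using R by (intro mult_left_mono sum_mono w2) auto
    also have "\<dots> = R * ((\<Sum>t<M. \<bar>e j t\<bar>) * (3 * 2 ^ N * D\<^sup>2 / (real m)\<^sup>2))"
      unfolding sum_distrib_right ..
    also have "\<dots> \<le> R * (R * (3 * 2 ^ N * D\<^sup>2 / (real m)\<^sup>2))"
      using R j by (intro mult_left_mono mult_right_mono e1) auto
    finally show "(\<Sum>i<2^N. (\<Sum>t<M. e j t * w i t)\<^sup>2) \<le> R * (R * (3 * 2 ^ N * D\<^sup>2 / (real m)\<^sup>2))" .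
  qed auto
  also have "\<dots> = 2 ^ N * (8 * (m * R * D)\<^sup>2)"
    using m by (simp add: power2_eq_square power4_eq_xxxx field_simps)
  finally show ?thesis by simp
qed

text \<open>The case \<open>p > 2\<close> is reduced to \<open>p = 2\<close> by the weights \<open>\<beta> l powr ((p - 2) / 2)\<close>;
  the value of \<open>s\<close> lets half of \<open>Z\<close> be absorbed.\<close>

lemma sum_coordinate_powr_le_L1:
  fixes e u :: "nat \<Rightarrow> nat \<Rightarrow> real"
  assumes p: "2 \<le> p" and m: "0 < m" and R: "0 < R" and Q: "0 \<le> Q"
    and e1: "\<And>j. j < m^4 \<Longrightarrow> (\<Sum>t<M. \<bar>e j t\<bar>) \<le> R"
    and e2: "\<And>x h. 0 \<le> h \<Longrightarrow> (\<And>t. t < M \<Longrightarrow> \<bar>x t\<bar> \<le> h) \<Longrightarrow>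
      (\<Sum>j<m^4. (\<Sum>t<M. e j t * x t)\<^sup>2) \<le> (R * h)\<^sup>2"
    and u: "\<And>t. t < M \<Longrightarrow> (\<Sum>l<N. \<bar>u l t\<bar> powr p) \<le> Q powr p"
  shows "(\<Sum>l<N. (\<Sum>j<m^4. \<bar>\<Sum>t<M. u l t * e j t\<bar>) powr p) \<le> (8 * real m ^ 3 * Q * R) powr p"
proof -
  \<comment> \<open>The sums over \<open>j\<close> are controlled by their l2 norms
    \<open>\<beta> l\<close>, at the cost m^2 of Cauchy-Schwarz; the task is to bound
    \<open>Z\<close>.\<close>
  define \<beta> where "\<beta> l = sqrt (\<Sum>j<m^4. (\<Sum>t<M. e j t * u l t)\<^sup>2)" for l
  define Z where "Z = (\<Sum>l<N. \<beta> l powr p)"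
  define s where "s = 1 / (4 * m * R)"
  define v where "v l t = \<beta> l powr ((p - 2) / 2) * u l t" for l t
  define D where "D = sqrt (s\<^sup>2 * Z + s powr (2 - p) * Q powr p)"
  have b0: "\<beta> l \<ge> 0" for l by (simp add: \<beta>_def sum_nonneg)
  have Z0: "Z \<ge> 0" by (simp add: Z_def sum_nonneg)
  have s0: "s > 0" using m R by (simp add: s_def)
  have D2: "D\<^sup>2 = s\<^sup>2 * Z + s powr (2 - p) * Q powr p"
    unfolding D_def using Z0 by simp
  have v2: "(v l t)\<^sup>2 = \<beta> l powr (p - 2) * (u l t)\<^sup>2" for l t
    by (simp add: v_def power_mult_distrib power2_eq_square flip: powr_add)
  \<comment> \<open>Interpolation between the exponents 2 and p: the smaller of \<bar>b\<bar> and s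
    * a is replaced by the larger.\<close>
  have split: "a powr (p - 2) * b\<^sup>2 \<le> s\<^sup>2 * a powr p + s powr (2 - p) * \<bar>b\<bar> powr p"
    if "a \<ge> 0" for a b :: real
  proof (cases "\<bar>b\<bar> \<le> s * a")
    case True
    have "a powr (p - 2) * b\<^sup>2 \<le> a powr (p - 2) * (s * a)\<^sup>2"
      using True that s0 by (intro mult_left_mono power2_le_iff_abs_le[THEN iffD2]) auto
    also have "\<dots> = s\<^sup>2 * a powr p"
      using that by (cases "a = 0") (auto simp: power_mult_distrib powr_diff powr_numeral)
    finally show ?thesis by (simp add: add_increasing2)
  next
    case False
    then have ab: "a \<le> \<bar>b\<bar> / s" "b \<noteq> 0" using s0 that by (auto simp: field_simps)
    have "a powr (p - 2) * b\<^sup>2 \<le> (\<bar>b\<bar> / s) powr (p - 2) * b\<^sup>2"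
      using ab that p by (intro mult_right_mono powr_mono2) auto
    also have "\<dots> = s powr (2 - p) * \<bar>b\<bar> powr p"
      using ab s0 by (simp add: powr_divide powr_diff powr_numeral field_simps)
    finally show ?thesis by (simp add: add_increasing)
  qed
  have "(\<Sum>l<N. (v l t)\<^sup>2) \<le> D\<^sup>2" if "t < M" for t
  proof -
    have "(\<Sum>l<N. (v l t)\<^sup>2) \<le> (\<Sum>l<N. s\<^sup>2 * \<beta> l powr p + s powr (2 - p) * \<bar>u l t\<bar> powr p)"
      unfolding v2 by (intro sum_mono split b0)
    also have "\<dots> = s\<^sup>2 * Z + s powr (2 - p) * (\<Sum>l<N. \<bar>u l t\<bar> powr p)"
      by (simp add: sum.distrib Z_def sum_distrib_left)
    also have "\<dots> \<le> D\<^sup>2" unfolding D2 by (intro add_left_mono mult_left_mono u that) auto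
    finally show ?thesis .
  qed
  then have "(\<Sum>l<N. \<Sum>j<m^4. (\<Sum>t<M. e j t * v l t)\<^sup>2) \<le> 8 * (m * R * D)\<^sup>2"
    using m R e1 e2 Z0 by (intro little_Grothendieck_weak) (auto simp: D_def)
  \<comment> \<open>The weight in \<open>v\<close> has exponent (p - 2) / 2 so that, once squared,
    it supplies the missing p - 2 powers of \<open>\<beta> l\<close>; the left side thus becomes
    \<open>Z\<close>, which also occurs in the bound through \<open>D\<close>.\<close>
  moreover have "(\<Sum>j<m^4. (\<Sum>t<M. e j t * v l t)\<^sup>2) = \<beta> l powr p" for l
  proof -
    have "(\<Sum>j<m^4. (\<Sum>t<M. e j t * v l t)\<^sup>2)
        = (\<beta> l powr ((p - 2) / 2))\<^sup>2 * (\<Sum>j<m^4. (\<Sum>t<M. e j t * u l t)\<^sup>2)"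
    proof -
      have eq: "(\<Sum>t<M. e j t * v l t) = \<beta> l powr ((p - 2) / 2) * (\<Sum>t<M. e j t * u l t)" for j
        unfolding v_def sum_distrib_left by (simp add: mult_ac)
      show ?thesis unfolding eq power_mult_distrib by (rule sum_distrib_left[symmetric])
    qed
    also have "\<dots> = \<beta> l powr (p - 2) * (\<beta> l)\<^sup>2"
      by (simp add: \<beta>_def sum_nonneg power2_eq_square flip: powr_add)
    also have "\<dots> = \<beta> l powr p" using b0[of l] p
      by (cases "\<beta> l = 0") (auto simp: powr_diff powr_numeral)
    finally show ?thesis .
  qed
  ultimately have "Z \<le> 8 * (m * R)\<^sup>2 * (s\<^sup>2 * Z + s powr (2 - p) * Q powr p)"
    by (simp add: Z_def D2 power_mult_distrib)
  also have "\<dots> = Z / 2 + 8 * (m * R)\<^sup>2 * (s powr (2 - p) * Q powr p)"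
    using m R by (simp add: s_def power2_eq_square field_simps)
  finally have "Z \<le> 16 * (m * R)\<^sup>2 * (s powr (2 - p) * Q powr p)" by simp
  also have "16 * (m * R)\<^sup>2 = s powr (-2)"
    using m R by (simp add: s_def powr_minus powr_numeral power2_eq_square field_simps)
  also have "s powr (-2) * (s powr (2 - p) * Q powr p) = s powr (- p) * Q powr p"
    by (simp flip: powr_add mult.assoc)
  also have "\<dots> = (4 * m * R * Q) powr p"
    using m R Q by (simp add: s_def powr_minus powr_divide powr_mult field_simps)
  finally have Z: "Z \<le> (4 * m * R * Q) powr p" .
  have "(\<Sum>l<N. (\<Sum>j<m^4. \<bar>\<Sum>t<M. u l t * e j t\<bar>) powr p) \<le> (\<Sum>l<N. (m\<^sup>2 * \<beta> l) powr p)"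
  proof (intro sum_mono powr_mono2)
    fix l
    have "sqrt (real (m ^ 4)) = m\<^sup>2"
      by (rule real_sqrt_unique) (auto simp: power2_eq_square power4_eq_xxxx)
    then show "(\<Sum>j<m^4. \<bar>\<Sum>t<M. u l t * e j t\<bar>) \<le> m\<^sup>2 * \<beta> l"
      using sum_abs_le_sqrt_card[of "\<lambda>j. \<Sum>t<M. e j t * u l t" "{..<m^4}"]
      by (simp add: \<beta>_def mult.commute)
  qed (use p in \<open>auto simp: sum_nonneg\<close>)
  also have "\<dots> = (m\<^sup>2) powr p * Z"
    using b0 by (simp add: Z_def powr_mult sum_distrib_left)
  also have "\<dots> \<le> (m\<^sup>2) powr p * (4 * m * R * Q) powr p"
    using Z by (intro mult_left_mono) auto
  also have "\<dots> = (m\<^sup>2 * (4 * m * R * Q)) powr p" using R Q by (simp add: powr_mult)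
  also have "\<dots> \<le> (8 * real m ^ 3 * Q * R) powr p"
    using p R Q by (intro powr_mono2) (auto simp: power2_eq_square power3_eq_cube mult_ac intro!: mult_left_mono)
  finally show ?thesis .
qed

section \<open>Weak norms and domination\<close>

lemma lp_norm_conjugate_le_1:
  assumes "lp_norm (conjugate_exponent p) n \<alpha> \<le> 1"
  shows "p = 1 \<Longrightarrow> i < n \<Longrightarrow> \<bar>\<alpha> i\<bar> \<le> 1"
    and "1 < p \<Longrightarrow> (\<Sum>i<n. \<bar>\<alpha> i\<bar> powr (p / (p - 1))) \<le> 1"
proof -
  show "\<bar>\<alpha> i\<bar> \<le> 1" if "p = 1" "i < n"
    using assms that by (auto simp: lp_norm_def conjugate_exponent_def)
  show "(\<Sum>i<n. \<bar>\<alpha> i\<bar> powr (p / (p - 1))) \<le> 1" if p: "1 < p"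
  proof -
    define s where "s = (\<Sum>i<n. \<bar>\<alpha> i\<bar> powr (p / (p - 1)))"
    have "s powr (1 / (p / (p - 1))) \<le> 1"
      using assms p by (simp add: lp_norm_def conjugate_exponent_def s_def)
    then have "(s powr (1 / (p / (p - 1)))) powr (p / (p - 1)) \<le> 1"
      using p powr_mono2[of "p / (p - 1)" "s powr (1 / (p / (p - 1)))" 1] by simp
    then show ?thesis using p by (simp add: powr_powr s_def sum_nonneg)
  qed
qed

lemma lp_norm_conjugate_abs_le_1:
  assumes "1 \<le> p" "lp_norm (conjugate_exponent p) n \<alpha> \<le> 1" "i < n"
  shows "\<bar>\<alpha> i\<bar> \<le> 1"
proof (cases "p = 1")
  case False
  then have p: "1 < p" using assms by simp
  have "\<bar>\<alpha> i\<bar> powr (p / (p - 1)) \<le> (\<Sum>i<n. \<bar>\<alpha> i\<bar> powr (p / (p - 1)))"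
    using assms by (intro member_le_sum) auto
  also have "\<dots> \<le> 1" using lp_norm_conjugate_le_1(2)[OF assms(2) p] .
  finally have le: "\<bar>\<alpha> i\<bar> powr (p / (p - 1)) \<le> 1" .
  show ?thesis
  proof (rule ccontr)
    assume "\<not> \<bar>\<alpha> i\<bar> \<le> 1"
    then have "1 < \<bar>\<alpha> i\<bar> powr (p / (p - 1))" using p by (intro gr_one_powr) auto
    with le show False by simp
  qed
qed (use lp_norm_conjugate_le_1(1)[OF assms(2)] assms in auto)

text \<open>Hoelder's inequality in normalised form; for p > 1 it is Young's inequality applied
  termwise to c / K and \<open>\<alpha>\<close>.\<close>

lemma abs_sum_mult_le_of_conjugate:
  assumes p: "1 \<le> p" and \<alpha>: "lp_norm (conjugate_exponent p) n \<alpha> \<le> 1" and K: "0 \<le> K"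
    and c: "(\<Sum>i<n. \<bar>c i\<bar> powr p) \<le> K powr p"
  shows "\<bar>\<Sum>i<n. \<alpha> i * c i\<bar> \<le> K"
proof (cases "p = 1")
  case True
  have "\<bar>\<Sum>i<n. \<alpha> i * c i\<bar> \<le> (\<Sum>i<n. \<bar>\<alpha> i * c i\<bar>)" by (rule sum_abs)
  also have "\<dots> \<le> (\<Sum>i<n. \<bar>c i\<bar>)"
    using lp_norm_conjugate_le_1(1)[OF \<alpha> True] by (intro sum_mono) (simp add: abs_mult mult_left_le_one_le)
  also have "\<dots> \<le> K" using c K True by simp
  finally show ?thesis .
next
  case False
  then have p1: "1 < p" using p by simp
  define q where "q = p / (p - 1)"
  have q: "1 < q" "1 / p + 1 / q = 1" using p1 by (auto simp: q_def field_simps)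
  show ?thesis
  proof (cases "K = 0")
    case True
    have "c i = 0" if "i < n" for i
    proof -
      have "\<bar>c i\<bar> powr p \<le> (\<Sum>i<n. \<bar>c i\<bar> powr p)" using that by (intro member_le_sum) auto
      also have "\<dots> \<le> 0" using c True by simp
      finally show ?thesis by simp
    qed
    then show ?thesis using K by simp
  next
    case False
    then have K0: "K > 0" using K by simp
    have "\<bar>\<Sum>i<n. \<alpha> i * c i\<bar> \<le> (\<Sum>i<n. \<bar>\<alpha> i * c i\<bar>)" by (rule sum_abs)
    also have "\<dots> = K * (\<Sum>i<n. \<bar>c i\<bar> / K * \<bar>\<alpha> i\<bar>)"
      using K0 by (simp add: sum_distrib_left abs_mult mult.commute)
    also have "\<dots> \<le> K * (\<Sum>i<n. (\<bar>c i\<bar> / K) powr p / p + \<bar>\<alpha> i\<bar> powr q / q)"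
      using K0 by (intro mult_left_mono sum_mono Youngs_inequality p1 q) auto
    also have "\<dots> = K * ((\<Sum>i<n. \<bar>c i\<bar> powr p) / K powr p / p + (\<Sum>i<n. \<bar>\<alpha> i\<bar> powr q) / q)"
      using K0 by (simp add: sum.distrib powr_divide sum_divide_distrib)
    also have "\<dots> \<le> K * (1 / p + 1 / q)"
    proof (intro mult_left_mono add_mono divide_right_mono)
      show "(\<Sum>i<n. \<bar>c i\<bar> powr p) / K powr p \<le> 1" using c K0 by simp
      show "(\<Sum>i<n. \<bar>\<alpha> i\<bar> powr q) \<le> 1"
        using lp_norm_conjugate_le_1(2)[OF \<alpha> p1] by (simp add: q_def)
    qed (use p1 q K in auto)
    finally show ?thesis using q by simp
  qed
qed

text \<open>The equality case of Hoelder: \<open>\<alpha> i\<close> is proportional to the sign of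
  \<open>c i\<close> times \<bar>c i\<bar>^(p-1), which for p = 1 leaves the signs.\<close>

lemma exists_conjugate_norming:
  assumes p: "1 \<le> p"
  shows "\<exists>\<alpha>. lp_norm (conjugate_exponent p) n \<alpha> \<le> 1 \<and> (\<Sum>i<n. \<alpha> i * c i) = (\<Sum>i<n. \<bar>c i\<bar> powr p) powr (1 / p)"
proof (cases "p = 1")
  case True
  have "sgn (c i) * c i = \<bar>c i\<bar>" for i by (simp add: abs_sgn mult.commute)
  moreover have "lp_norm (conjugate_exponent p) n (\<lambda>i. sgn (c i)) \<le> 1"
    using True by (simp add: lp_norm_def conjugate_exponent_def abs_sgn_eq)
  ultimately show ?thesis
    using True by (intro exI[of _ "\<lambda>i. sgn (c i)"]) (simp add: sum_nonneg)
next
  case False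
  then have p1: "1 < p" using p by simp
  define S where "S = (\<Sum>i<n. \<bar>c i\<bar> powr p)"
  have S0: "S \<ge> 0" by (simp add: S_def sum_nonneg)
  show ?thesis
  proof (cases "S = 0")
    case True
    have "c i = 0" if "i < n" for i
    proof -
      have "\<bar>c i\<bar> powr p \<le> S" unfolding S_def using that by (intro member_le_sum) auto
      then show ?thesis using True by simp
    qed
    then show ?thesis using p1
      by (intro exI[of _ "\<lambda>_. 0"]) (auto simp: lp_norm_def conjugate_exponent_def)
  next
    case False
    then have S: "S > 0" using S0 by simp
    define \<alpha> where "\<alpha> i = sgn (c i) * \<bar>c i\<bar> powr (p - 1) / S powr (1 - 1 / p)" for i
    have "\<bar>\<alpha> i\<bar> powr (p / (p - 1)) = \<bar>c i\<bar> powr p / S" for i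
    proof (cases "c i = 0")
      case False
      have "(1 - 1 / p) * (p / (p - 1)) = 1" using p1 by (simp add: field_simps)
      then show ?thesis
        using S p1 False by (simp add: \<alpha>_def abs_mult abs_sgn_eq powr_divide powr_powr)
    qed (use p1 in \<open>simp add: \<alpha>_def\<close>)
    then have "(\<Sum>i<n. \<bar>\<alpha> i\<bar> powr (p / (p - 1))) = 1"
      using S by (simp add: S_def flip: sum_divide_distrib)
    then have "lp_norm (conjugate_exponent p) n \<alpha> \<le> 1"
      using p1 by (simp add: lp_norm_def conjugate_exponent_def)
    moreover have "(\<Sum>i<n. \<alpha> i * c i) = S powr (1 / p)"
    proof -
      have "\<alpha> i * c i = \<bar>c i\<bar> powr p / S powr (1 - 1 / p)" for i
      proof (cases "c i = 0")
        case False
        have "sgn (c i) * c i = \<bar>c i\<bar>" by (simp add: abs_sgn mult.commute)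
        then have "\<alpha> i * c i = (\<bar>c i\<bar> powr (p - 1) * \<bar>c i\<bar>) / S powr (1 - 1 / p)"
          by (simp add: \<alpha>_def mult_ac)
        also have "\<bar>c i\<bar> powr (p - 1) * \<bar>c i\<bar> = \<bar>c i\<bar> powr p" using False by (simp add: powr_diff)
        finally show ?thesis .
      qed (use p1 in \<open>simp add: \<alpha>_def\<close>)
      then have "(\<Sum>i<n. \<alpha> i * c i) = S / S powr (1 - 1 / p)"
        by (simp add: S_def flip: sum_divide_distrib)
      also have "\<dots> = S powr (1 / p)" using S by (simp add: powr_diff)
      finally show ?thesis .
    qed
    ultimately show ?thesis unfolding S_def by blast
  qed
qed

text \<open>The inequality behind \<open>Hp_norm\<close>, for nonnegative \<open>C\<close>, with
  p-th powers in place of roots: both sides can then be summed and sums interchanged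
  directly.\<close>

definition p_dominated :: "real \<Rightarrow> real \<Rightarrow> (('a::banach \<Rightarrow>\<^sub>L real) \<Rightarrow> real) \<Rightarrow> bool" where
  "p_dominated p C f \<longleftrightarrow> (\<forall>n \<phi>. (\<Sum>i<n. \<bar>f (\<phi> i)\<bar> powr p) \<le> (C * weak_norm p n \<phi>) powr p)"

context
  fixes p :: real
  assumes p: "1 \<le> p"
begin

lemma weak_norm_set:
  fixes z :: "nat \<Rightarrow> 'z::real_normed_vector"
  shows "bdd_above {norm (\<Sum>i<n. \<alpha> i *\<^sub>R z i) | \<alpha>. lp_norm (conjugate_exponent p) n \<alpha> \<le> 1}"
    and "0 \<in> {norm (\<Sum>i<n. \<alpha> i *\<^sub>R z i) | \<alpha>. lp_norm (conjugate_exponent p) n \<alpha> \<le> 1}"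
proof -
  show "bdd_above {norm (\<Sum>i<n. \<alpha> i *\<^sub>R z i) | \<alpha>. lp_norm (conjugate_exponent p) n \<alpha> \<le> 1}"
  proof (rule bdd_aboveI, clarify)
    fix \<alpha> assume "lp_norm (conjugate_exponent p) n \<alpha> \<le> 1"
    then show "norm (\<Sum>i<n. \<alpha> i *\<^sub>R z i) \<le> (\<Sum>i<n. norm (z i))"
      using lp_norm_conjugate_abs_le_1[OF p]
      by (intro sum_norm_le) (simp add: mult_left_le_one_le)
  qed
  show "0 \<in> {norm (\<Sum>i<n. \<alpha> i *\<^sub>R z i) | \<alpha>. lp_norm (conjugate_exponent p) n \<alpha> \<le> 1}"
    using p
    by (auto intro!: exI[of _ "\<lambda>_. 0"] simp: lp_norm_def conjugate_exponent_def)
qed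

lemma norm_sum_le_weak_norm:
  fixes z :: "nat \<Rightarrow> 'z::real_normed_vector"
  assumes "lp_norm (conjugate_exponent p) n \<alpha> \<le> 1"
  shows "norm (\<Sum>i<n. \<alpha> i *\<^sub>R z i) \<le> weak_norm p n z"
  unfolding weak_norm_def by (rule cSup_upper) (use assms weak_norm_set in auto)

lemma weak_norm_nonneg: "0 \<le> weak_norm p n (z :: nat \<Rightarrow> 'z::real_normed_vector)"
  unfolding weak_norm_def by (rule cSup_upper[OF weak_norm_set(2) weak_norm_set(1)])

text \<open>Together with \<open>weak_norm_le\<close> this computes the weak norm of a family of
  functionals from its values at points x, by exchanging the supremum over coefficients with the one
  in the operator norm.\<close>

lemma sum_powr_le_weak_norm:
  fixes \<psi> :: "nat \<Rightarrow> 'z::real_normed_vector \<Rightarrow>\<^sub>L real"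
  shows "(\<Sum>i<n. \<bar>\<psi> i x\<bar> powr p) \<le> (weak_norm p n \<psi> * norm x) powr p"
proof -
  obtain \<alpha> where \<alpha>: "lp_norm (conjugate_exponent p) n \<alpha> \<le> 1"
    "(\<Sum>i<n. \<alpha> i * \<psi> i x) = (\<Sum>i<n. \<bar>\<psi> i x\<bar> powr p) powr (1 / p)"
    using exists_conjugate_norming[OF p, of n "\<lambda>i. \<psi> i x"] by auto
  have "(\<Sum>i<n. \<alpha> i * \<psi> i x) = (\<Sum>i<n. \<alpha> i *\<^sub>R \<psi> i) x"
    by (simp add: blinfun.sum_left blinfun.scaleR_left)
  also have "\<dots> \<le> norm (\<Sum>i<n. \<alpha> i *\<^sub>R \<psi> i) * norm x"
    using norm_blinfun[of "\<Sum>i<n. \<alpha> i *\<^sub>R \<psi> i" x] by simp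
  also have "\<dots> \<le> weak_norm p n \<psi> * norm x"
    by (intro mult_right_mono norm_sum_le_weak_norm \<alpha>) auto
  finally have "((\<Sum>i<n. \<bar>\<psi> i x\<bar> powr p) powr (1 / p)) powr p \<le> (weak_norm p n \<psi> * norm x) powr p"
    unfolding \<alpha> using p by (intro powr_mono2) auto
  then show ?thesis using p by (simp add: powr_powr sum_nonneg)
qed

lemma weak_norm_le:
  fixes \<psi> :: "nat \<Rightarrow> 'z::real_normed_vector \<Rightarrow>\<^sub>L real"
  assumes K: "0 \<le> K" and le: "\<And>x. (\<Sum>i<n. \<bar>\<psi> i x\<bar> powr p) \<le> (K * norm x) powr p"
  shows "weak_norm p n \<psi> \<le> K"
  unfolding weak_norm_def
proof (rule cSup_least)
  fix y assume "y \<in> {norm (\<Sum>i<n. \<alpha> i *\<^sub>R \<psi> i) | \<alpha>. lp_norm (conjugate_exponent p) n \<alpha> \<le> 1}"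
  then obtain \<alpha> where \<alpha>: "lp_norm (conjugate_exponent p) n \<alpha> \<le> 1" "y = norm (\<Sum>i<n. \<alpha> i *\<^sub>R \<psi> i)"
    by blast
  show "y \<le> K" unfolding \<alpha>(2)
  proof (rule norm_blinfun_bound[OF K])
    fix x
    show "norm (blinfun_apply (\<Sum>i<n. \<alpha> i *\<^sub>R \<psi> i) x) \<le> K * norm x"
      using abs_sum_mult_le_of_conjugate[OF p \<alpha>(1) _ le[of x]] K
      by (simp add: blinfun.sum_left blinfun.scaleR_left)
  qed
qed (use weak_norm_set(2) in blast)

lemma p_dominated_iff:
  assumes "0 \<le> C"
  shows "p_dominated p C f \<longleftrightarrow> (\<forall>n \<phi>. (\<Sum>i<n. \<bar>f (\<phi> i)\<bar> powr p) powr (1 / p) \<le> C * weak_norm p n \<phi>)"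
proof -
  have "s \<le> c powr p \<longleftrightarrow> s powr (1 / p) \<le> c" if "s \<ge> 0" "c \<ge> 0" for s c :: real
  proof
    assume "s \<le> c powr p"
    then have "s powr (1 / p) \<le> (c powr p) powr (1 / p)" using p that by (intro powr_mono2) auto
    then show "s powr (1 / p) \<le> c" using p that by (simp add: powr_powr)
  next
    assume "s powr (1 / p) \<le> c"
    then have "(s powr (1 / p)) powr p \<le> c powr p" using p that by (intro powr_mono2) auto
    then show "s \<le> c powr p" using p that by (simp add: powr_powr)
  qed
  then show ?thesis
    using assms unfolding p_dominated_def by (simp add: sum_nonneg weak_norm_nonneg)
qed

lemma Hp_norm_le:
  assumes "0 \<le> C" "p_dominated p C f"
  shows "Hp_norm p f \<le> ennreal C"
  unfolding Hp_norm_def using assms by (intro Inf_lower) (auto simp: p_dominated_iff)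

lemma Hp_norm_less_obtain:
  assumes "Hp_norm p f < b"
  obtains C where "0 \<le> C" "ennreal C < b" "p_dominated p C f"
  using assms unfolding Hp_norm_def Inf_less_iff by (auto simp: p_dominated_iff)

lemma p_dominated_mono:
  assumes "p_dominated p C f" "0 \<le> C" "C \<le> C'" "\<And>\<phi>. \<bar>g \<phi>\<bar> \<le> \<bar>f \<phi>\<bar>"
  shows "p_dominated p C' g"
  unfolding p_dominated_def
proof (intro allI)
  fix n and \<phi> :: "nat \<Rightarrow> 'a \<Rightarrow>\<^sub>L real"
  have "(\<Sum>i<n. \<bar>g (\<phi> i)\<bar> powr p) \<le> (\<Sum>i<n. \<bar>f (\<phi> i)\<bar> powr p)"
    using assms(4) p by (intro sum_mono powr_mono2) auto
  also have "\<dots> \<le> (C * weak_norm p n \<phi>) powr p" using assms(1) by (simp add: p_dominated_def)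
  also have "\<dots> \<le> (C' * weak_norm p n \<phi>) powr p"
    using assms(2,3) p weak_norm_nonneg[of n \<phi>] by (intro powr_mono2 mult_right_mono) auto
  finally show "(\<Sum>i<n. \<bar>g (\<phi> i)\<bar> powr p) \<le> (C' * weak_norm p n \<phi>) powr p" .
qed

text \<open>A family with one member has weak norm at most its norm. Domination therefore implies
  uniform closeness on bounded sets.\<close>

lemma p_dominated_abs_le_norm:
  assumes "p_dominated p C f" "0 \<le> C"
  shows "\<bar>f \<phi>\<bar> \<le> C * norm \<phi>"
proof -
  have "weak_norm p 1 (\<lambda>_. \<phi>) \<le> norm \<phi>"
    using norm_blinfun[of \<phi>] p by (intro weak_norm_le) (auto intro!: powr_mono2)
  then have "C * weak_norm p 1 (\<lambda>_. \<phi>) \<le> C * norm \<phi>"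
    using assms by (intro mult_left_mono)
  moreover have "(\<Sum>i<1::nat. \<bar>f ((\<lambda>_. \<phi>) i)\<bar> powr p) powr (1 / p) \<le> C * weak_norm p 1 (\<lambda>_. \<phi>)"
    using assms(1) unfolding p_dominated_iff[OF assms(2)] by (elim allE)
  ultimately show ?thesis using p by (simp add: powr_powr)
qed

end

section \<open>The free vector lattice and its completion\<close>

lemma vector_sublattice_Inter:
  assumes "\<And>L. L \<in> \<F> \<Longrightarrow> vector_sublattice L"
  shows "vector_sublattice (\<Inter>\<F>)"
  using assms unfolding vector_sublattice_def by blast

lemma vector_sublattice_FVL: "vector_sublattice FVL"
  unfolding FVL_def hull_def by (rule vector_sublattice_Inter) simp

lemma point_eval_in_FVL: "point_eval x \<in> FVL"
  unfolding FVL_def by (rule hull_inc) simp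

lemma FVL_subset_Hws: "FVL \<subseteq> Hws"
  unfolding FVL_def using vector_sublattice_Hws by (intro hull_minimal) (auto simp: point_eval_in_Hws)

lemma FVL_zero: "(\<lambda>_. 0) \<in> FVL"
  and FVL_add: "f \<in> FVL \<Longrightarrow> g \<in> FVL \<Longrightarrow> (\<lambda>w. f w + g w) \<in> FVL"
  and FVL_scale: "f \<in> FVL \<Longrightarrow> (\<lambda>w. c * f w) \<in> FVL"
  using vector_sublattice_FVL unfolding vector_sublattice_def by blast+

lemma FVL_sup: "f \<in> FVL \<Longrightarrow> g \<in> FVL \<Longrightarrow> sup f g \<in> FVL"
  and FVL_inf: "f \<in> FVL \<Longrightarrow> g \<in> FVL \<Longrightarrow> inf f g \<in> FVL"
  using vector_sublattice_FVL unfolding vector_sublattice_def by blast+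

lemma FVL_max: "f \<in> FVL \<Longrightarrow> g \<in> FVL \<Longrightarrow> (\<lambda>w. max (f w) (g w)) \<in> FVL"
  and FVL_min: "f \<in> FVL \<Longrightarrow> g \<in> FVL \<Longrightarrow> (\<lambda>w. min (f w) (g w)) \<in> FVL"
  using FVL_sup[of f g] FVL_inf[of f g] by (simp_all add: sup_fun_def inf_fun_def sup_max inf_min)

lemma FVL_abs: "f \<in> FVL \<Longrightarrow> (\<lambda>w. \<bar>f w\<bar>) \<in> FVL"
proof -
  assume "f \<in> FVL"
  then have "(\<lambda>w. max (f w) (- 1 * f w)) \<in> FVL" by (intro FVL_max FVL_scale)
  also have "(\<lambda>w. max (f w) (- 1 * f w)) = (\<lambda>w. \<bar>f w\<bar>)" by (auto simp: fun_eq_iff)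
  finally show ?thesis .
qed

lemma FVL_diff: "f \<in> FVL \<Longrightarrow> g \<in> FVL \<Longrightarrow> (\<lambda>w. f w - g w) \<in> FVL"
  using FVL_add[OF _ FVL_scale[of g "- 1"], of f] by simp

lemma FVL_sum: "(\<And>j. j \<in> I \<Longrightarrow> f j \<in> FVL) \<Longrightarrow> (\<lambda>w. \<Sum>j\<in>I. f j w) \<in> FVL"
  by (induction I rule: infinite_finite_induct) (auto simp: FVL_zero FVL_add)

lemma FVL_Max: "(\<And>k. a k \<in> FVL) \<Longrightarrow> (\<lambda>w. Max ((\<lambda>k. a k w) ` {..n::nat})) \<in> FVL"
  by (induction n) (auto simp: atMost_Suc intro: FVL_max)

text \<open>The functions in \<open>Hws\<close> with such a bound form a vector sublattice
  containing all evaluations, hence contain the generated one. The finite set matters later: a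
  random perturbation is small on average at each of its points.\<close>

lemma FVL_Lipschitz:
  assumes "f \<in> FVL"
  shows "\<exists>Z L. finite Z \<and> 0 \<le> L \<and> (\<forall>\<phi> \<psi>. \<bar>f \<phi> - f \<psi>\<bar> \<le> L * (\<Sum>z\<in>Z. \<bar>blinfun_apply \<phi> z - blinfun_apply \<psi> z\<bar>))"
proof -
  define Lip :: "(('a \<Rightarrow>\<^sub>L real) \<Rightarrow> real) \<Rightarrow> bool" where
    "Lip f \<longleftrightarrow> (\<exists>Z L. finite Z \<and> 0 \<le> L \<and>
      (\<forall>\<phi> \<psi>. \<bar>f \<phi> - f \<psi>\<bar> \<le> L * (\<Sum>z\<in>Z. \<bar>blinfun_apply \<phi> z - blinfun_apply \<psi> z\<bar>)))" for f
  have comb: "Lip h" if f: "Lip f" and g: "Lip g"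
    and h: "\<And>\<phi> \<psi>. \<bar>h \<phi> - h \<psi>\<bar> \<le> \<bar>f \<phi> - f \<psi>\<bar> + \<bar>g \<phi> - g \<psi>\<bar>"
    for f g h :: "('a \<Rightarrow>\<^sub>L real) \<Rightarrow> real"
  proof -
    obtain Z L Z' L' where 1: "finite Z" "0 \<le> L" "finite Z'" "0 \<le> L'"
      "\<And>\<phi> \<psi>. \<bar>f \<phi> - f \<psi>\<bar> \<le> L * (\<Sum>z\<in>Z. \<bar>blinfun_apply \<phi> z - blinfun_apply \<psi> z\<bar>)"
      "\<And>\<phi> \<psi>. \<bar>g \<phi> - g \<psi>\<bar> \<le> L' * (\<Sum>z\<in>Z'. \<bar>blinfun_apply \<phi> z - blinfun_apply \<psi> z\<bar>)"
      using f g unfolding Lip_def by blast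
    have "\<bar>h \<phi> - h \<psi>\<bar> \<le> (L + L') * (\<Sum>z\<in>Z \<union> Z'. \<bar>blinfun_apply \<phi> z - blinfun_apply \<psi> z\<bar>)" for \<phi> \<psi>
    proof -
      define d where "d z = \<bar>blinfun_apply \<phi> z - blinfun_apply \<psi> z\<bar>" for z
      have "L * sum d Z \<le> L * sum d (Z \<union> Z')" "L' * sum d Z' \<le> L' * sum d (Z \<union> Z')"
        using 1 by (auto intro!: mult_left_mono sum_mono2 simp: d_def)
      then show ?thesis using h[of \<phi> \<psi>] 1(5,6)[of \<phi> \<psi>] by (simp add: d_def distrib_right)
    qed
    then show ?thesis unfolding Lip_def using 1 by (intro exI[of _ "Z \<union> Z'"] exI[of _ "L + L'"]) auto
  qed
  have "FVL \<subseteq> {f \<in> Hws. Lip f}"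
    unfolding FVL_def
  proof (rule hull_minimal)
    have "Lip (point_eval x)" for x :: 'a
      unfolding Lip_def by (intro exI[of _ "{x}"] exI[of _ 1]) (simp add: point_eval_def)
    then show "range point_eval \<subseteq> {f \<in> Hws. Lip f}"
      using point_eval_in_Hws by blast
    have "Lip (\<lambda>_. 0)" unfolding Lip_def by (intro exI[of _ "{}"] exI[of _ 0]) simp
    moreover have "Lip (\<lambda>w. f w + g w)" "Lip (sup f g)" "Lip (inf f g)" if "Lip f" "Lip g" for f g
      using that by (rule comb; auto simp: sup_max inf_min)+
    moreover have "Lip (\<lambda>w. c * f w)" if f: "Lip f" for f c
    proof -
      obtain Z L where 1: "finite Z" "0 \<le> L"
        "\<And>\<phi> \<psi>. \<bar>f \<phi> - f \<psi>\<bar> \<le> L * (\<Sum>z\<in>Z. \<bar>blinfun_apply \<phi> z - blinfun_apply \<psi> z\<bar>)"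
        using f unfolding Lip_def by blast
      have "\<bar>c * f \<phi> - c * f \<psi>\<bar> \<le> (\<bar>c\<bar> * L) * (\<Sum>z\<in>Z. \<bar>blinfun_apply \<phi> z - blinfun_apply \<psi> z\<bar>)" for \<phi> \<psi>
        using mult_left_mono[OF 1(3)[of \<phi> \<psi>], of "\<bar>c\<bar>"]
        by (simp add: mult.assoc flip: abs_mult right_diff_distrib)
      then show ?thesis unfolding Lip_def using 1 by (intro exI[of _ Z] exI[of _ "\<bar>c\<bar> * L"]) auto
    qed
    ultimately have "vector_sublattice {f \<in> Hws. Lip f}"
      using vector_sublattice_Hws unfolding vector_sublattice_def mem_Collect_eq
      by (metis (mono_tags, lifting) mem_Collect_eq)
    then show "vector_sublattice {f \<in> Hws. Lip f} \<and> {f \<in> Hws. Lip f} \<subseteq> Hws" by blast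
  qed
  with assms show ?thesis unfolding Lip_def by blast
qed

section \<open>Approximation and membership in \<open>FBL\<close>\<close>

lemma Hws_zero: "f \<in> Hws \<Longrightarrow> f 0 = 0"
proof -
  assume "f \<in> Hws"
  then have "f (0 *\<^sub>R 0) = 0 * f 0" unfolding Hws_def by blast
  then show ?thesis by simp
qed

text \<open>The error scales with the norm, so it is uniformly small on bounded sets, which
  preserves continuity there; at any two given functionals it can be made arbitrarily small, which
  preserves homogeneity.\<close>

lemma Hws_uniform_limit:
  assumes "\<And>\<epsilon>. 0 < \<epsilon> \<Longrightarrow> \<exists>g\<in>Hws. \<forall>\<phi>. \<bar>f \<phi> - g \<phi>\<bar> \<le> \<epsilon> * norm \<phi>"
  shows "f \<in> Hws"
proof -
  have hom: "f (t *\<^sub>R \<phi>) = t * f \<phi>" if "t \<ge> 0" for t \<phi>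
  proof -
    have "\<bar>f (t *\<^sub>R \<phi>) - t * f \<phi>\<bar> \<le> 0 + e" if "e > 0" for e
    proof -
      define \<epsilon> where "\<epsilon> = e / (2 * t * norm \<phi> + 1)"
      have pos: "2 * t * norm \<phi> + 1 > 0" using \<open>t \<ge> 0\<close> by (simp add: add_nonneg_pos)
      have \<epsilon>: "\<epsilon> > 0" using that pos by (simp add: \<epsilon>_def)
      then obtain g where g: "g \<in> Hws" "\<And>\<phi>. \<bar>f \<phi> - g \<phi>\<bar> \<le> \<epsilon> * norm \<phi>"
        using assms by blast
      have "g (t *\<^sub>R \<phi>) = t * g \<phi>" using g(1) \<open>t \<ge> 0\<close> unfolding Hws_def by blast
      then have "\<bar>f (t *\<^sub>R \<phi>) - t * f \<phi>\<bar> = \<bar>(f (t *\<^sub>R \<phi>) - g (t *\<^sub>R \<phi>)) - t * (f \<phi> - g \<phi>)\<bar>"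
        by (simp add: algebra_simps)
      also have "\<dots> \<le> \<bar>f (t *\<^sub>R \<phi>) - g (t *\<^sub>R \<phi>)\<bar> + t * \<bar>f \<phi> - g \<phi>\<bar>"
        using abs_triangle_ineq4[of "f (t *\<^sub>R \<phi>) - g (t *\<^sub>R \<phi>)" "t * (f \<phi> - g \<phi>)"] \<open>t \<ge> 0\<close>
        by (simp add: abs_mult)
      also have "\<dots> \<le> \<epsilon> * norm (t *\<^sub>R \<phi>) + t * (\<epsilon> * norm \<phi>)"
        using \<open>t \<ge> 0\<close> by (intro add_mono mult_left_mono g(2))
      also have "\<dots> = \<epsilon> * (2 * t * norm \<phi>)" using \<open>t \<ge> 0\<close> by simp
      also have "\<dots> \<le> \<epsilon> * (2 * t * norm \<phi> + 1)" using \<epsilon> by (intro mult_left_mono) auto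
      also have "\<dots> = e" using pos by (simp add: \<epsilon>_def)
      finally show ?thesis by simp
    qed
    then have "\<bar>f (t *\<^sub>R \<phi>) - t * f \<phi>\<bar> \<le> 0" by (rule field_le_epsilon)
    then show ?thesis by simp
  qed
  have "continuous_map (subtopology strong_operator_topology B) euclideanreal f" if "bounded B" for B
  proof -
    obtain r where r: "r > 0" "\<And>\<phi>. \<phi> \<in> B \<Longrightarrow> norm \<phi> \<le> r"
      using \<open>bounded B\<close> bounded_pos by blast
    have "\<exists>g\<in>Hws. \<forall>\<phi>. \<bar>f \<phi> - g \<phi>\<bar> \<le> (1 / Suc n) * norm \<phi>" for n
      by (rule assms) simp
    then obtain g where g: "\<And>n. g n \<in> Hws" "\<And>n \<phi>. \<bar>f \<phi> - g n \<phi>\<bar> \<le> (1 / Suc n) * norm \<phi>"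
      by metis
    have "continuous_map (subtopology strong_operator_topology B) (Met_TC.mtopology) f"
    proof (rule Met_TC.continuous_map_uniform_limit[where F = sequentially and f = g])
      show "\<forall>\<^sub>F n in sequentially. continuous_map (subtopology strong_operator_topology B) Met_TC.mtopology (g n)"
        using g(1) that by (simp add: Hws_def)
      fix \<epsilon> :: real assume "\<epsilon> > 0"
      then obtain n0 where n0: "r / \<epsilon> < real n0" using reals_Archimedean2 by blast
      show "\<forall>\<^sub>F n in sequentially. \<forall>x\<in>topspace (subtopology strong_operator_topology B).
          f x \<in> UNIV \<and> dist (g n x) (f x) < \<epsilon>"
      proof (rule eventually_sequentiallyI[of n0], intro ballI conjI UNIV_I)
        fix n x assume n: "n0 \<le> n" and x: "x \<in> topspace (subtopology strong_operator_topology B)"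
        have "dist (g n x) (f x) \<le> (1 / Suc n) * norm x"
          using g(2)[of x n] by (simp add: dist_real_def abs_minus_commute)
        also have "\<dots> \<le> (1 / Suc n) * r" using r x by (intro mult_left_mono) auto
        also have "\<dots> < \<epsilon>"
        proof -
          have "r < \<epsilon> * real n0" using n0 \<open>\<epsilon> > 0\<close> by (simp add: field_simps)
          also have "\<dots> \<le> \<epsilon> * real (Suc n)" using n \<open>\<epsilon> > 0\<close> by (intro mult_left_mono) auto
          finally show ?thesis by (simp add: field_simps del: of_nat_Suc)
        qed
        finally show "dist (g n x) (f x) < \<epsilon>" .
      qed
    qed simp
    then show ?thesis by simp
  qed
  with hom show ?thesis by (auto simp: Hws_def)
qed

context
  fixes p :: real
  assumes p: "1 \<le> p"
begin

text \<open>Compared with the functional 0, where \<open>f\<close> vanishes, the Lipschitz bound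
  leaves finitely many evaluations, each dominated through
  \<open>sum_powr_le_weak_norm\<close>.\<close>

lemma FVL_p_dominated:
  fixes f :: "('a::banach \<Rightarrow>\<^sub>L real) \<Rightarrow> real"
  assumes "f \<in> FVL"
  shows "\<exists>C\<ge>0. p_dominated p C f"
proof -
  obtain Z L where Z: "finite Z" "0 \<le> L"
    "\<And>\<phi> \<psi>. \<bar>f \<phi> - f \<psi>\<bar> \<le> L * (\<Sum>z\<in>Z. \<bar>blinfun_apply \<phi> z - blinfun_apply \<psi> z\<bar>)"
    using FVL_Lipschitz[OF assms] by blast
  have f0: "f 0 = 0" using assms FVL_subset_Hws Hws_zero by blast
  define B where "B = (\<Sum>z\<in>Z. norm z)"
  have B: "B \<ge> 0" "\<And>z. z \<in> Z \<Longrightarrow> norm z \<le> B"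
    unfolding B_def using Z(1) by (auto intro!: sum_nonneg member_le_sum)
  define c where "c = real (card Z)"
  have "p_dominated p (L * (c * B)) f"
    unfolding p_dominated_def
  proof (intro allI)
    fix n and \<phi> :: "nat \<Rightarrow> 'a \<Rightarrow>\<^sub>L real"
    have "(\<Sum>i<n. \<bar>f (\<phi> i)\<bar> powr p) \<le> (\<Sum>i<n. L powr p * (c powr (p - 1) * (\<Sum>z\<in>Z. \<bar>\<phi> i z\<bar> powr p)))"
    proof (intro sum_mono)
      fix i
      have "\<bar>f (\<phi> i)\<bar> powr p \<le> (L * (\<Sum>z\<in>Z. \<bar>\<phi> i z\<bar>)) powr p"
        using Z(3)[of "\<phi> i" 0] f0 p by (intro powr_mono2) auto
      also have "\<dots> = L powr p * (\<Sum>z\<in>Z. \<bar>\<phi> i z\<bar>) powr p"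
        by (rule powr_mult)
      also have "\<dots> \<le> L powr p * (c powr (p - 1) * (\<Sum>z\<in>Z. \<bar>\<phi> i z\<bar> powr p))"
        unfolding c_def using p Z(1) by (intro mult_left_mono sum_powr_le_card_sum_powr) auto
      finally show "\<bar>f (\<phi> i)\<bar> powr p \<le> \<dots>" .
    qed
    also have "\<dots> = L powr p * (c powr (p - 1) * (\<Sum>z\<in>Z. \<Sum>i<n. \<bar>\<phi> i z\<bar> powr p))"
      unfolding sum_distrib_left[symmetric] by (subst sum.swap) (rule refl)
    also have "\<dots> \<le> L powr p * (c powr (p - 1) * (\<Sum>z\<in>Z. (weak_norm p n \<phi> * B) powr p))"
    proof (intro mult_left_mono sum_mono)
      fix z assume "z \<in> Z"
      have "(\<Sum>i<n. \<bar>\<phi> i z\<bar> powr p) \<le> (weak_norm p n \<phi> * norm z) powr p"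
        by (rule sum_powr_le_weak_norm[OF p])
      also have "\<dots> \<le> (weak_norm p n \<phi> * B) powr p"
        using p B(2)[OF \<open>z \<in> Z\<close>] weak_norm_nonneg[OF p, of n \<phi>]
        by (intro powr_mono2 mult_left_mono) auto
      finally show "(\<Sum>i<n. \<bar>\<phi> i z\<bar> powr p) \<le> \<dots>" .
    qed auto
    also have "\<dots> = L powr p * (c powr p * (weak_norm p n \<phi> * B) powr p)"
    proof (cases "c = 0")
      case False
      then have "c > 0" by (simp add: c_def)
      moreover have "(\<Sum>z\<in>Z. (weak_norm p n \<phi> * B) powr p) = c * (weak_norm p n \<phi> * B) powr p"
        unfolding c_def by (rule sum_constant)
      ultimately show ?thesis by (simp add: powr_diff del: sum_constant)
    qed simp
    also have "\<dots> = (L * (c * B) * weak_norm p n \<phi>) powr p"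
      by (simp only: powr_mult mult_ac)
    finally show "(\<Sum>i<n. \<bar>f (\<phi> i)\<bar> powr p) \<le> (L * (c * B) * weak_norm p n \<phi>) powr p" .
  qed
  then show ?thesis using Z(2) B(1) by (intro exI[of _ "L * (c * B)"]) (auto simp: c_def)
qed

text \<open>Minkowski's inequality with the constant 4, which serves to see that a norm is
  finite.\<close>

lemma p_dominated_approx:
  assumes "p_dominated p C g" "0 \<le> C" "p_dominated p D (\<lambda>\<phi>. f \<phi> - g \<phi>)" "0 \<le> D"
  shows "p_dominated p (4 * (C + D)) f"
  unfolding p_dominated_def
proof (intro allI)
  fix n and \<phi> :: "nat \<Rightarrow> 'a \<Rightarrow>\<^sub>L real"
  define w where "w = weak_norm p n \<phi>"
  have w: "w \<ge> 0" unfolding w_def by (rule weak_norm_nonneg[OF p])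
  have "(\<Sum>i<n. \<bar>f (\<phi> i)\<bar> powr p) \<le> (\<Sum>i<n. 2 powr p * (\<bar>g (\<phi> i)\<bar> powr p + \<bar>f (\<phi> i) - g (\<phi> i)\<bar> powr p))"
  proof (intro sum_mono)
    fix i
    have "\<bar>f (\<phi> i)\<bar> powr p \<le> (\<bar>g (\<phi> i)\<bar> + \<bar>f (\<phi> i) - g (\<phi> i)\<bar>) powr p"
      using p by (intro powr_mono2) auto
    also have "\<dots> \<le> 2 powr p * (\<bar>g (\<phi> i)\<bar> powr p + \<bar>f (\<phi> i) - g (\<phi> i)\<bar> powr p)"
      using p by (intro add_powr_le) auto
    finally show "\<bar>f (\<phi> i)\<bar> powr p \<le> \<dots>" .
  qed
  also have "\<dots> \<le> 2 powr p * ((C * w) powr p + (D * w) powr p)"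
    using assms(1,3) unfolding p_dominated_def sum_distrib_left[symmetric] sum.distrib w_def
    by (intro mult_left_mono add_mono) auto
  also have "\<dots> \<le> 2 powr p * (((C + D) * w) powr p + ((C + D) * w) powr p)"
    using assms(2,4) w p by (intro mult_left_mono add_mono powr_mono2 mult_right_mono) auto
  also have "\<dots> = 2 powr p * (2 * ((C + D) * w) powr p)" by simp
  also have "\<dots> \<le> 2 powr p * (2 powr p * ((C + D) * w) powr p)"
    using p powr_mono[of 1 p 2] by (intro mult_left_mono mult_right_mono) auto
  also have "\<dots> = (2 * (2 * ((C + D) * w))) powr p"
    by (simp only: powr_mult)
  also have "2 * (2 * ((C + D) * w)) = 4 * (C + D) * w" by simp
  finally show "(\<Sum>i<n. \<bar>f (\<phi> i)\<bar> powr p) \<le> (4 * (C + D) * weak_norm p n \<phi>) powr p"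
    unfolding w_def .
qed

lemma FBL_D:
  assumes "f \<in> FBL p" "0 < \<epsilon>"
  obtains g where "g \<in> FVL" "p_dominated p \<epsilon> (\<lambda>\<phi>. f \<phi> - g \<phi>)"
proof -
  have "ennreal \<epsilon> > 0" using assms(2) by simp
  then obtain g where g: "g \<in> FVL" "Hp_norm p (\<lambda>\<phi>. f \<phi> - g \<phi>) < ennreal \<epsilon>"
    using assms(1) unfolding FBL_def by blast
  then obtain C where "0 \<le> C" "ennreal C < ennreal \<epsilon>" "p_dominated p C (\<lambda>\<phi>. f \<phi> - g \<phi>)"
    using Hp_norm_less_obtain[OF p] by blast
  then have "p_dominated p \<epsilon> (\<lambda>\<phi>. f \<phi> - g \<phi>)"
    using assms(2) by (elim p_dominated_mono[OF p]) (auto simp: ennreal_less_iff)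
  with g show ?thesis using that by blast
qed

text \<open>Approximability is the whole condition: continuity follows by uniform limits on bounded
  sets, and finiteness of the norm from the approximant at distance 1.\<close>

lemma FBL_I:
  fixes f :: "('a::banach \<Rightarrow>\<^sub>L real) \<Rightarrow> real"
  assumes approx: "\<And>\<epsilon>. 0 < \<epsilon> \<Longrightarrow> \<exists>g\<in>FVL. p_dominated p \<epsilon> (\<lambda>\<phi>. f \<phi> - g \<phi>)"
  shows "f \<in> FBL p"
proof -
  have "f \<in> Hws"
  proof (rule Hws_uniform_limit)
    fix \<epsilon> :: real assume "0 < \<epsilon>"
    with approx show "\<exists>g\<in>Hws. \<forall>\<phi>. \<bar>f \<phi> - g \<phi>\<bar> \<le> \<epsilon> * norm \<phi>"
      using p_dominated_abs_le_norm[OF p] FVL_subset_Hws by (meson less_imp_le subsetD)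
  qed
  moreover have "Hp_norm p f < \<infinity>"
  proof -
    obtain g where g: "g \<in> FVL" "p_dominated p 1 (\<lambda>\<phi>. f \<phi> - g \<phi>)" using approx[of 1] by auto
    obtain C where C: "C \<ge> 0" "p_dominated p C g" using FVL_p_dominated[OF g(1)] by blast
    have "Hp_norm p f \<le> ennreal (4 * (C + 1))"
      using C g by (intro Hp_norm_le[OF p] p_dominated_approx) auto
    then show ?thesis using le_less_trans by fastforce
  qed
  moreover have "\<exists>g\<in>FVL. Hp_norm p (\<lambda>\<phi>. f \<phi> - g \<phi>) < \<epsilon>" if "\<epsilon> > 0" for \<epsilon>
  proof -
    obtain r where r: "0 < r" "ennreal r < \<epsilon>"
      using \<open>\<epsilon> > 0\<close> dense[of 0 \<epsilon>] by (metis ennreal_cases ennreal_eq_0_iff leI not_less_iff_gr_or_eq top.not_eq_extremum)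
    obtain g where g: "g \<in> FVL" "p_dominated p r (\<lambda>\<phi>. f \<phi> - g \<phi>)" using approx[OF r(1)] by blast
    have "Hp_norm p (\<lambda>\<phi>. f \<phi> - g \<phi>) \<le> ennreal r" using r g by (intro Hp_norm_le[OF p]) auto
    also have "\<dots> < \<epsilon>" by (rule r)
    finally show ?thesis using g by blast
  qed
  ultimately show ?thesis by (auto simp: FBL_def Hpws_def)
qed

lemma FVL_subset_FBL: "FVL \<subseteq> FBL p"
proof
  fix f :: "('a \<Rightarrow>\<^sub>L real) \<Rightarrow> real" assume "f \<in> FVL"
  then show "f \<in> FBL p"
    using p by (intro FBL_I bexI[of _ f]) (auto simp: p_dominated_def)
qed

end

section \<open>Norming functionals\<close>

text \<open>Homogeneity is stated as an inequality for positive factors, a form that passes to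
  infima; rescaling by \<open>1 / t\<close> recovers equality.\<close>

definition sublinear :: "('a::real_vector \<Rightarrow> real) \<Rightarrow> bool" where
  "sublinear q \<longleftrightarrow> (\<forall>x y. q (x + y) \<le> q x + q y) \<and> (\<forall>t>0. \<forall>x. q (t *\<^sub>R x) \<le> t * q x)"

lemma sublinear_add: "sublinear q \<Longrightarrow> q (x + y) \<le> q x + q y"
  and sublinear_scaleR_le: "sublinear q \<Longrightarrow> 0 < t \<Longrightarrow> q (t *\<^sub>R x) \<le> t * q x"
  by (simp_all add: sublinear_def)

lemma sublinear_zero: "sublinear q \<Longrightarrow> q 0 = 0"
  using sublinear_scaleR_le[of q 2 0] sublinear_scaleR_le[of q "1/2" 0] by simp

lemma sublinear_scaleR:
  assumes "sublinear q" "0 \<le> t"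
  shows "q (t *\<^sub>R x) = t * q x"
proof (cases "t = 0")
  case False
  then have t: "t > 0" using assms by simp
  have "q ((1 / t) *\<^sub>R (t *\<^sub>R x)) \<le> (1 / t) * q (t *\<^sub>R x)"
    using assms t by (intro sublinear_scaleR_le) auto
  then have "t * q x \<le> q (t *\<^sub>R x)" using t by (simp add: field_simps)
  then show ?thesis using sublinear_scaleR_le[OF assms(1) t, of x] by simp
qed (simp add: sublinear_zero[OF assms(1)])

lemma sublinear_minus: "sublinear q \<Longrightarrow> - q (- x) \<le> q x"
  using sublinear_add[of q x "- x"] sublinear_zero[of q] by simp

text \<open>The witness is the infimum over t \<ge> 0 of q (x + t y) - t q y. Taking t = 0 gives r
  \<le> q, and t = 1 at - y gives the last claim; subadditivity bounds the infimum below by - q (-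
  x).\<close>

lemma sublinear_tilt:
  assumes q: "sublinear q"
  obtains r where "sublinear r" "\<And>x. r x \<le> q x" "r (- y) \<le> - q y"
proof -
  define h where "h x t = q (x + t *\<^sub>R y) - t * q y" for x and t :: real
  define r where "r x = (INF t\<in>{0..}. h x t)" for x
  have bd: "bdd_below (h x ` {0..})" for x
  proof (rule bdd_belowI2)
    fix t :: real assume "t \<in> {0..}"
    then have "t * q y = q ((x + t *\<^sub>R y) + (- x))" by (simp add: sublinear_scaleR[OF q])
    also have "\<dots> \<le> q (x + t *\<^sub>R y) + q (- x)" by (rule sublinear_add[OF q])
    finally show "- q (- x) \<le> h x t" by (simp add: h_def)
  qed
  have low: "r x \<le> h x t" if "t \<ge> 0" for x t
    unfolding r_def using that by (intro cINF_lower bd) auto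
  have great: "c \<le> r x" if "\<And>t. t \<ge> 0 \<Longrightarrow> c \<le> h x t" for c x
    unfolding r_def using that by (intro cINF_greatest) auto
  have "r (x + z) \<le> r x + r z" for x z
  proof -
    have "r (x + z) - h x s \<le> r z" if "s \<ge> 0" for s
    proof (rule great)
      fix t :: real assume "t \<ge> 0"
      have "r (x + z) \<le> h (x + z) (s + t)" using \<open>s \<ge> 0\<close> \<open>t \<ge> 0\<close> by (intro low) auto
      also have "\<dots> = q ((x + s *\<^sub>R y) + (z + t *\<^sub>R y)) - s * q y - t * q y"
        by (simp add: h_def algebra_simps)
      also have "\<dots> \<le> h x s + h z t"
        using sublinear_add[OF q, of "x + s *\<^sub>R y" "z + t *\<^sub>R y"] by (simp add: h_def)
      finally show "r (x + z) - h x s \<le> h z t" by simp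
    qed
    then have "r (x + z) - r z \<le> r x" by (intro great) (simp add: algebra_simps)
    then show ?thesis by simp
  qed
  moreover have "r (c *\<^sub>R x) \<le> c * r x" if c: "c > 0" for c x
  proof -
    have "r (c *\<^sub>R x) / c \<le> r x"
    proof (rule great)
      fix t :: real assume t: "t \<ge> 0"
      have "r (c *\<^sub>R x) \<le> h (c *\<^sub>R x) (c * t)" using c t by (intro low) auto
      also have "\<dots> = q (c *\<^sub>R (x + t *\<^sub>R y)) - c * t * q y" by (simp add: h_def algebra_simps)
      also have "\<dots> = c * h x t"
        using c unfolding h_def sublinear_scaleR[OF q less_imp_le[OF c]] by (simp add: right_diff_distrib)
      finally show "r (c *\<^sub>R x) / c \<le> h x t" using c by (simp add: field_simps)
    qed
    then show ?thesis using c by (simp add: field_simps)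
  qed
  ultimately have "sublinear r" by (simp add: sublinear_def)
  moreover have "r x \<le> q x" for x using low[of 0 x] by (simp add: h_def)
  moreover have "r (- y) \<le> - q y" using low[of 1 "- y"] by (simp add: h_def sublinear_zero[OF q])
  ultimately show ?thesis using that by blast
qed

text \<open>Zorn's lemma in the reversed order. The pointwise infimum of a chain stays above - q (-
  x); it is subadditive because two members of a chain have a common lower one.\<close>

lemma exists_minimal_sublinear:
  assumes q: "sublinear q"
  obtains r where "sublinear r" "r \<le> q" "\<And>s. sublinear s \<Longrightarrow> s \<le> r \<Longrightarrow> s = r"
proof -
  define A where "A = {r. sublinear r \<and> r \<le> q}"
  have "\<exists>m\<in>A. \<forall>a\<in>A. m \<ge> a \<longrightarrow> a = m"
  proof (rule predicate_Zorn)
    show "partial_order_on A (relation_of (\<ge>) A)"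
      by (rule partial_order_on_relation_ofI) auto
  next
    fix C assume C: "C \<in> Chains (relation_of (\<ge>) A)"
    then have CA: "C \<subseteq> A" and chain: "\<And>r s. r \<in> C \<Longrightarrow> s \<in> C \<Longrightarrow> r \<le> s \<or> s \<le> r"
      by (auto simp: Chains_def relation_of_def)
    show "\<exists>u\<in>A. \<forall>a\<in>C. u \<le> a"
    proof (cases "C = {}")
      case True
      then show ?thesis using q by (auto simp: A_def)
    next
      case False
      define u where "u x = (INF r\<in>C. r x)" for x
      have bd: "bdd_below ((\<lambda>r. r x) ` C)" for x
      proof (rule bdd_belowI2)
        fix r assume "r \<in> C"
        then have r: "sublinear r" "r \<le> q" using CA by (auto simp: A_def)
        have "- q (- x) \<le> - r (- x)" using r(2) by (simp add: le_fun_def)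
        also have "\<dots> \<le> r x" by (rule sublinear_minus[OF r(1)])
        finally show "- q (- x) \<le> r x" .
      qed
      have low: "u x \<le> r x" if "r \<in> C" for r x
        unfolding u_def using that by (intro cINF_lower bd)
      have great: "c \<le> u x" if "\<And>r. r \<in> C \<Longrightarrow> c \<le> r x" for c x
        unfolding u_def using that False by (intro cINF_greatest)
      have "u (x + y) \<le> u x + u y" for x y
      proof -
        have "u (x + y) - r x \<le> u y" if r: "r \<in> C" for r
        proof (rule great)
          fix s assume s: "s \<in> C"
          obtain w where w: "w \<in> C" "w \<le> r" "w \<le> s" using chain[OF r s] r s by blast
          have "u (x + y) \<le> w (x + y)" by (rule low[OF w(1)])
          also have "\<dots> \<le> w x + w y" using w CA by (intro sublinear_add) (auto simp: A_def)
          also have "\<dots> \<le> r x + s y" using w by (intro add_mono) (auto simp: le_fun_def)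
          finally show "u (x + y) - r x \<le> s y" by simp
        qed
        then have "u (x + y) - u y \<le> u x" by (intro great) (simp add: algebra_simps)
        then show ?thesis by simp
      qed
      moreover have "u (t *\<^sub>R x) \<le> t * u x" if t: "t > 0" for t x
      proof -
        have "u (t *\<^sub>R x) / t \<le> u x"
        proof (rule great)
          fix r assume r: "r \<in> C"
          have "u (t *\<^sub>R x) \<le> r (t *\<^sub>R x)" by (rule low[OF r])
          also have "\<dots> \<le> t * r x" using r CA t by (intro sublinear_scaleR_le) (auto simp: A_def)
          finally show "u (t *\<^sub>R x) / t \<le> r x" using t by (simp add: field_simps)
        qed
        then show ?thesis using t by (simp add: field_simps)
      qed
      ultimately have "sublinear u" by (simp add: sublinear_def)
      moreover obtain r where "r \<in> C" using False by blast
      then have "r \<le> q" "\<And>x. u x \<le> r x" using low CA by (auto simp: A_def)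
      then have "u \<le> q" unfolding le_fun_def by (meson order_trans)
      ultimately show ?thesis using low by (auto simp: A_def le_fun_def)
    qed
  qed
  then obtain m where m: "sublinear m" "m \<le> q" "\<And>a. a \<in> A \<Longrightarrow> a \<le> m \<Longrightarrow> a = m" by (auto simp: A_def)
  show ?thesis
  proof (rule that[OF m(1,2)])
    fix s assume "sublinear s" "s \<le> m"
    then show "s = m" using m by (auto simp: A_def)
  qed
qed

text \<open>A minimal sublinear functional is linear: tilting it towards \<open>y\<close> cannot decrease it,
  which forces \<open>r (- y) = - r y\<close>.\<close>

lemma exists_norming_functional:
  fixes y :: "'a::real_normed_vector"
  shows "\<exists>\<psi> :: 'a \<Rightarrow>\<^sub>L real. norm \<psi> \<le> 1 \<and> blinfun_apply \<psi> y = norm y"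
proof -
  have "sublinear (norm :: 'a \<Rightarrow> real)" by (simp add: sublinear_def norm_triangle_ineq)
  \<comment> \<open>Tilting before minimising fixes the value at \<open>y\<close>: any linear
    functional below \<open>q\<close> is at least \<open>norm y\<close> there.\<close>
  then obtain q where q: "sublinear q" "\<And>x. q x \<le> norm x" "q (- y) \<le> - norm y"
    using sublinear_tilt[of norm y] by metis
  obtain r where r: "sublinear r" "r \<le> q" and min: "\<And>s. sublinear s \<Longrightarrow> s \<le> r \<Longrightarrow> s = r"
    using exists_minimal_sublinear[OF q(1)] by metis
  have odd: "r (- x) = - r x" for x
  proof -
    obtain s where s: "sublinear s" "\<And>z. s z \<le> r z" "s (- x) \<le> - r x"
      using sublinear_tilt[OF r(1), of x] by metis
    then have "s = r" using min by (simp add: le_fun_def)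
    then show ?thesis using s(3) sublinear_minus[OF r(1), of x] by simp
  qed
  have rn: "r x \<le> norm x" for x using r(2) q(2)[of x] by (auto simp: le_fun_def intro: order_trans)
  have bnd: "norm (r x) \<le> 1 * norm x" for x using rn[of x] rn[of "- x"] odd[of x] by auto
  have add: "r (x + z) = r x + r z" for x z
    using sublinear_add[OF r(1), of x z] sublinear_add[OF r(1), of "- x" "- z"] odd[of "x + z"] odd[of x] odd[of z]
    by simp
  have scale: "r (c *\<^sub>R x) = c *\<^sub>R r x" for c x
  proof (cases "c \<ge> 0")
    case False
    then have "r ((- c) *\<^sub>R x) = (- c) * r x" by (intro sublinear_scaleR[OF r(1)]) auto
    then show ?thesis using odd[of "c *\<^sub>R x"] by simp
  qed (simp add: sublinear_scaleR[OF r(1)])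
  have bl: "bounded_linear r"
    using add scale bnd by (intro bounded_linear_intro[of r 1]) auto
  have "norm y \<le> r y" using r(2) q(3) odd[of y] by (auto simp: le_fun_def dest: spec[of _ "- y"])
  then have "r y = norm y" using rn[of y] by simp
  moreover have "norm (Blinfun r) \<le> 1"
    using bnd by (intro norm_blinfun_bound) (auto simp: bounded_linear_Blinfun_apply[OF bl])
  ultimately show ?thesis by (intro exI[of _ "Blinfun r"]) (simp add: bounded_linear_Blinfun_apply[OF bl])
qed

section \<open>Local structure of the spaces\<close>

text \<open>The laws for \<open>T\<close> hold only on the carrier, so the expansion adds one
  coordinate at a time without leaving it.\<close>

lemma lp_linear_eq_sum:
  fixes T :: "(nat \<Rightarrow> real) \<Rightarrow> 'a::real_vector"
  assumes add: "\<forall>a\<in>lp_carrier n. \<forall>b\<in>lp_carrier n. T (\<lambda>i. a i + b i) = T a + T b"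
    and scale: "\<forall>a\<in>lp_carrier n. \<forall>c. T (\<lambda>i. c * a i) = c *\<^sub>R T a"
    and a: "a \<in> lp_carrier n"
  shows "T a = (\<Sum>j<n. a j *\<^sub>R T (\<lambda>i. if i = j then 1 else 0))"
proof -
  have *: "T (\<lambda>i. if i < m then a i else 0) = (\<Sum>j<m. a j *\<^sub>R T (\<lambda>i. if i = j then 1 else 0))" if "m \<le> n" for m
    using that
  proof (induction m)
    case 0
    have "T (\<lambda>i. 0 * 0) = 0 *\<^sub>R T (\<lambda>_. 0)"
      using scale[rule_format, of "\<lambda>_. 0" 0] by (simp add: lp_carrier_def)
    then show ?case by simp
  next
    case (Suc m)
    define b where "b = (\<lambda>i. if i = m then (1::real) else 0)"
    have c: "(\<lambda>i. if i < m then a i else 0) \<in> lp_carrier n" "b \<in> lp_carrier n" "(\<lambda>i. a m * b i) \<in> lp_carrier n"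
      using Suc.prems by (auto simp: lp_carrier_def b_def)
    have "(\<lambda>i. if i < Suc m then a i else 0) = (\<lambda>i. (if i < m then a i else 0) + a m * b i)"
      by (auto simp: b_def fun_eq_iff less_Suc_eq)
    then have "T (\<lambda>i. if i < Suc m then a i else 0) = T (\<lambda>i. if i < m then a i else 0) + a m *\<^sub>R T b"
      using c add scale by simp
    then show ?case using Suc by (simp add: b_def)
  qed
  have a_eq: "(\<lambda>i. if i < n then a i else 0) = a" using a by (auto simp: lp_carrier_def)
  show ?thesis using *[OF order_refl] unfolding a_eq .
qed

lemma lp_linear_sum:
  fixes T :: "(nat \<Rightarrow> real) \<Rightarrow> 'a::real_vector"
  assumes add: "\<forall>a\<in>lp_carrier n. \<forall>b\<in>lp_carrier n. T (\<lambda>i. a i + b i) = T a + T b"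
    and scale: "\<forall>a\<in>lp_carrier n. \<forall>c. T (\<lambda>i. c * a i) = c *\<^sub>R T a"
    and a: "\<And>j. j < k \<Longrightarrow> a j \<in> lp_carrier n"
  shows "(\<lambda>i. \<Sum>j<k. c j * a j i) \<in> lp_carrier n"
    and "T (\<lambda>i. \<Sum>j<k. c j * a j i) = (\<Sum>j<k. c j *\<^sub>R T (a j))"
proof -
  show mem: "(\<lambda>i. \<Sum>j<k. c j * a j i) \<in> lp_carrier n"
    using a by (auto simp: lp_carrier_def)
  have "T (\<lambda>i. \<Sum>j<k. c j * a j i) = (\<Sum>t<n. (\<Sum>j<k. c j * a j t) *\<^sub>R T (\<lambda>i. if i = t then 1 else 0))"
    by (rule lp_linear_eq_sum[OF add scale mem])
  also have "\<dots> = (\<Sum>j<k. c j *\<^sub>R (\<Sum>t<n. a j t *\<^sub>R T (\<lambda>i. if i = t then 1 else 0)))"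
    unfolding scaleR_sum_left scaleR_sum_right by (subst sum.swap) simp
  also have "\<dots> = (\<Sum>j<k. c j *\<^sub>R T (a j))"
    using lp_linear_eq_sum[OF add scale a] by simp
  finally show "T (\<lambda>i. \<Sum>j<k. c j * a j i) = (\<Sum>j<k. c j *\<^sub>R T (a j))" .
qed

lemma lp_norm_2: "lp_norm 2 n a = sqrt (\<Sum>i<n. (a i)\<^sup>2)"
proof -
  have "enn2real 2 = 2" by (metis enn2real_ennreal ennreal_numeral zero_le_numeral)
  then show ?thesis by (simp add: lp_norm_def powr_numeral powr_half_sqrt sum_nonneg)
qed

lemma lp_norm_1: "lp_norm 1 n a = (\<Sum>i<n. \<bar>a i\<bar>)"
  by (simp add: lp_norm_def sum_nonneg)

lemma lp_norm_infinity_le_iff: "0 \<le> h \<Longrightarrow> lp_norm \<infinity> n a \<le> h \<longleftrightarrow> (\<forall>i<n. \<bar>a i\<bar> \<le> h)"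
  by (auto simp: lp_norm_def)

lemma abs_le_lp_norm_infinity: "i < n \<Longrightarrow> \<bar>a i\<bar> \<le> lp_norm \<infinity> n a"
  by (simp add: lp_norm_def)

text \<open>Dividing the images of the unit vectors by the bound A makes the upper l2 estimate
  contractive. The functionals, A times the coordinates of the projected vector, then carry all
  constants: A B \<le> C and the norm of the projection give C * C.\<close>

lemma l2_basis_obtain:
  assumes "contains_l2n_uniformly_complementably TYPE('a::banach)"
  obtains C where "0 \<le> C" and "\<And>n. \<exists>(e :: nat \<Rightarrow> 'a) (\<phi> :: nat \<Rightarrow> 'a \<Rightarrow>\<^sub>L real).
      (\<forall>c. norm (\<Sum>j<n. c j *\<^sub>R e j) \<le> sqrt (\<Sum>j<n. (c j)\<^sup>2)) \<and>
      (\<forall>x. (\<Sum>j<n. (\<phi> j x)\<^sup>2) \<le> (C * norm x)\<^sup>2) \<and>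
      (\<forall>j<n. \<forall>k<n. \<phi> j (e k) = (if j = k then 1 else 0))"
proof -
  obtain C where C: "\<And>n. \<exists>(E :: 'a set) (P :: 'a \<Rightarrow>\<^sub>L 'a).
        isomorphic_to_lp C 2 n E \<and> P o\<^sub>L P = P \<and> range (blinfun_apply P) = E \<and> norm P \<le> C"
    using assms unfolding contains_l2n_uniformly_complementably_def by blast
  have C0: "0 \<le> C" using C[of 0] norm_ge_zero order_trans by blast
  have "\<exists>(e :: nat \<Rightarrow> 'a) (\<phi> :: nat \<Rightarrow> 'a \<Rightarrow>\<^sub>L real).
      (\<forall>c. norm (\<Sum>j<n. c j *\<^sub>R e j) \<le> sqrt (\<Sum>j<n. (c j)\<^sup>2)) \<and>
      (\<forall>x. (\<Sum>j<n. (\<phi> j x)\<^sup>2) \<le> (C * C * norm x)\<^sup>2) \<and>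
      (\<forall>j<n. \<forall>k<n. \<phi> j (e k) = (if j = k then 1 else 0))" for n
  proof -
    obtain E and P :: "'a \<Rightarrow>\<^sub>L 'a" where iso: "isomorphic_to_lp C 2 n E"
      and P: "P o\<^sub>L P = P" "range (blinfun_apply P) = E" "norm P \<le> C"
      using C by blast
    obtain T A B where add: "\<forall>a\<in>lp_carrier n. \<forall>b\<in>lp_carrier n. T (\<lambda>i. a i + b i) = T a + T b"
      and scale: "\<forall>a\<in>lp_carrier n. \<forall>c. T (\<lambda>i. c * a i) = c *\<^sub>R T a"
      and img: "T ` lp_carrier n = E" and AB: "0 \<le> A" "0 \<le> B" "A * B \<le> C"
      and bounds: "\<And>a. a \<in> lp_carrier n \<Longrightarrow> norm (T a) \<le> A * lp_norm 2 n a"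
        "\<And>a. a \<in> lp_carrier n \<Longrightarrow> lp_norm 2 n a \<le> B * norm (T a)"
      using iso unfolding isomorphic_to_lp_def by blast
    show ?thesis
    proof (cases "n = 0")
      case False
      define unit :: "nat \<Rightarrow> nat \<Rightarrow> real" where "unit j = (\<lambda>i. if i = j then 1 else 0)" for j
      have unit: "unit j \<in> lp_carrier n" if "j < n" for j using that by (auto simp: unit_def lp_carrier_def)
      have A0: "A > 0"
      proof (rule ccontr)
        assume "\<not> A > 0"
        then have "A = 0" using AB by simp
        then have "T (unit 0) = 0" using bounds(1)[OF unit[of 0]] False by simp
        then have "lp_norm 2 n (unit 0) \<le> 0" using bounds(2)[OF unit[of 0]] False by simp
        moreover have "(\<Sum>i<n. (unit 0 i)\<^sup>2) = 1" using False by (simp add: unit_def if_distrib[of "\<lambda>x. x\<^sup>2"] cong: if_cong)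
        ultimately show False by (simp add: lp_norm_2)
      qed
      have inj: "a = b" if ab: "a \<in> lp_carrier n" "b \<in> lp_carrier n" "T a = T b" for a b
      proof -
        define d where "d = (\<lambda>i. a i + (- 1) * b i)"
        have b': "(\<lambda>i. (- 1) * b i) \<in> lp_carrier n" and d: "d \<in> lp_carrier n"
          using ab by (auto simp: lp_carrier_def d_def)
        have "T d = T a + (- 1) *\<^sub>R T b"
          unfolding d_def using add[rule_format, OF ab(1) b'] scale[rule_format, OF ab(2), of "- 1"] by simp
        then have "lp_norm 2 n d \<le> 0" using bounds(2)[OF d] ab(3) by simp
        then have z: "(\<Sum>i<n. (d i)\<^sup>2) = 0"
          by (simp add: lp_norm_2 sum_nonneg order.antisym)
        have "d i = 0" if "i < n" for i
        proof -
          have "(d i)\<^sup>2 \<le> (\<Sum>i<n. (d i)\<^sup>2)" using that by (intro member_le_sum) auto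
          then show ?thesis using z by simp
        qed
        then have "a i = b i" for i
          using ab(1,2) by (cases "i < n") (auto simp: d_def lp_carrier_def)
        then show ?thesis by blast
      qed
      have "\<exists>a\<in>lp_carrier n. T a = P x" for x using img P(2) by (metis imageE rangeI)
      \<comment> \<open>Coordinates of the projection of x; they are linear in x because the lower
        estimate makes \<open>T\<close> injective on the carrier.\<close>
      then obtain co where co: "\<And>x. co x \<in> lp_carrier n" "\<And>x. T (co x) = P x" by metis
      define e where "e j = (1 / A) *\<^sub>R T (unit j)" for j
      have co_add: "co (x + y) = (\<lambda>i. co x i + co y i)" for x y
      proof (rule inj)
        show "(\<lambda>i. co x i + co y i) \<in> lp_carrier n" using co(1) by (auto simp: lp_carrier_def)
        show "T (co (x + y)) = T (\<lambda>i. co x i + co y i)"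
          using add co by (simp add: blinfun.add_right)
      qed (rule co)
      have co_scale: "co (c *\<^sub>R x) = (\<lambda>i. c * co x i)" for c x
      proof (rule inj)
        show "(\<lambda>i. c * co x i) \<in> lp_carrier n" using co(1) by (auto simp: lp_carrier_def)
        show "T (co (c *\<^sub>R x)) = T (\<lambda>i. c * co x i)"
          using scale co by (simp add: blinfun.scaleR_right)
      qed (rule co)
      have sq: "(\<Sum>j<n. (A * co x j)\<^sup>2) \<le> (C * C * norm x)\<^sup>2" for x
      proof -
        have "sqrt (\<Sum>j<n. (A * co x j)\<^sup>2) = A * lp_norm 2 n (co x)"
          using AB by (simp add: lp_norm_2 power_mult_distrib real_sqrt_mult flip: sum_distrib_left)
        also have "\<dots> \<le> A * (B * norm (P x))"
          using bounds(2)[OF co(1)[of x]] AB by (intro mult_left_mono) (auto simp: co)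
        also have "\<dots> \<le> C * (C * norm x)"
        proof -
          have "norm (P x) \<le> C * norm x"
            using norm_blinfun[of P x] mult_right_mono[OF P(3) norm_ge_zero[of x]] by linarith
          then show ?thesis
            using AB C0 unfolding mult.assoc[symmetric, of A] by (intro mult_mono) auto
        qed
        finally have "(\<Sum>j<n. (A * co x j)\<^sup>2) \<le> (C * (C * norm x))\<^sup>2"
          by (rule sqrt_le_D)
        then show ?thesis by (simp add: mult.assoc)
      qed
      define \<phi> where "\<phi> j = Blinfun (\<lambda>x. A * co x j)" for j
      have \<phi>: "\<phi> j x = A * co x j" if "j < n" for j x
      proof -
        have "bounded_linear (\<lambda>x. A * co x j)"
        proof (rule bounded_linear_intro)
          fix x
          have "(A * co x j)\<^sup>2 \<le> (\<Sum>j<n. (A * co x j)\<^sup>2)" using that by (intro member_le_sum) auto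
          also note sq
          finally have "\<bar>A * co x j\<bar> \<le> \<bar>C * C * norm x\<bar>" by (rule power2_le_iff_abs_le[THEN iffD1, rotated, THEN order_trans]) auto
          then show "norm (A * co x j) \<le> norm x * (C * C)" using C0 by (simp add: mult_ac abs_mult)
        qed (simp_all add: co_add co_scale algebra_simps)
        then show ?thesis by (simp add: \<phi>_def bounded_linear_Blinfun_apply)
      qed
      have "norm (\<Sum>j<n. c j *\<^sub>R e j) \<le> sqrt (\<Sum>j<n. (c j)\<^sup>2)" for c
      proof -
        define a where "a = (\<lambda>i. if i < n then c i else 0)"
        have a: "a \<in> lp_carrier n" by (simp add: a_def lp_carrier_def)
        have "(\<Sum>j<n. c j *\<^sub>R e j) = (1 / A) *\<^sub>R T a"
          unfolding lp_linear_eq_sum[OF add scale a] by (simp add: a_def e_def unit_def scaleR_sum_right mult.commute)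
        then have "norm (\<Sum>j<n. c j *\<^sub>R e j) = norm (T a) / A" using A0 by simp
        also have "\<dots> \<le> lp_norm 2 n a" using bounds(1)[OF a] A0 by (simp add: field_simps)
        also have "\<dots> = sqrt (\<Sum>j<n. (c j)\<^sup>2)" by (simp add: lp_norm_2 a_def)
        finally show ?thesis .
      qed
      moreover have "(\<Sum>j<n. (\<phi> j x)\<^sup>2) \<le> (C * C * norm x)\<^sup>2" for x using sq[of x] by (simp add: \<phi>)
      moreover have "\<phi> j (e k) = (if j = k then 1 else 0)" if "j < n" "k < n" for j k
      proof -
        have "T (unit k) \<in> E" using img unit that by blast
        then obtain y where "T (unit k) = P y" using P(2) by blast
        then have "P (T (unit k)) = T (unit k)"
          using P(1) by (metis blinfun_apply_blinfun_compose)
        then have "co (T (unit k)) = unit k" using co unit that by (intro inj) auto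
        then show ?thesis using that A0 by (simp add: \<phi> e_def co_scale unit_def)
      qed
      ultimately show ?thesis by blast
    qed auto
  qed
  then show ?thesis using that[of "C * C"] C0 by simp
qed

text \<open>This closes the estimates in which a square sum is obtained by testing a family against
  its own coefficients.\<close>

lemma le_square_of_le_sqrt:
  fixes s b :: real
  assumes "0 \<le> s" "0 \<le> b" "s \<le> b * sqrt s"
  shows "s \<le> b\<^sup>2"
proof (cases "s = 0")
  case False
  then have "sqrt s > 0" using assms by simp
  have "sqrt s * sqrt s \<le> b * sqrt s" using assms by simp
  then have "sqrt s \<le> b" using \<open>sqrt s > 0\<close> mult_le_cancel_right_pos by blast
  then have "(sqrt s)\<^sup>2 \<le> b\<^sup>2" using assms by (intro power_mono) auto
  then show ?thesis using assms by simp
qed simp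

text \<open>Inside a finite dimensional subspace close to an l_r space the vectors get coordinates
  \<open>a j t\<close>. The l2 estimate for the \<open>e j\<close> turns into the hypotheses of the
  coordinate lemmas, with \<open>R\<close> for the inverse isomorphism and \<open>W * A\<close> for
  the evaluations, and A * R is bounded by the constant of the space alone.\<close>

lemma basis_sum_p_dominated:
  assumes "(script_L_space \<infinity> TYPE('b::banach) \<and> 1 \<le> p) \<or> (script_L_space 1 TYPE('b) \<and> 2 \<le> p)"
  shows "\<exists>\<kappa>\<ge>0. \<forall>m (e :: nat \<Rightarrow> 'b). 0 < m \<and> (\<forall>c. norm (\<Sum>j<m^4. c j *\<^sub>R e j) \<le> sqrt (\<Sum>j<m^4. (c j)\<^sup>2)) \<longrightarrow>
      p_dominated p (\<kappa> * real m ^ 3) (\<lambda>\<psi>. \<Sum>j<m^4. \<bar>blinfun_apply \<psi> (e j)\<bar>)"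
proof -
  have p: "1 \<le> p" using assms by auto
  obtain r where r: "(r = \<infinity> \<and> 1 \<le> p) \<or> (r = 1 \<and> 2 \<le> p)" and L: "script_L_space r TYPE('b)"
    using assms by blast
  obtain C where C: "\<forall>S :: 'b set. finite S \<longrightarrow>
      (\<exists>G. (\<exists>D. finite D \<and> G = span D) \<and> span S \<subseteq> G \<and> isomorphic_to_lp C r (dim G) G)"
    using L unfolding script_L_space_def ..
  show ?thesis
  proof (intro exI[of _ "8 * (\<bar>C\<bar> + 1)"] conjI allI impI; (elim conjE)?)
    fix m :: nat and e :: "nat \<Rightarrow> 'b"
    assume m: "0 < m" and e: "\<forall>c. norm (\<Sum>j<m^4. c j *\<^sub>R e j) \<le> sqrt (\<Sum>j<m^4. (c j)\<^sup>2)"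
    define n where "n = m ^ 4"
    obtain G where G: "span (e ` {..<n}) \<subseteq> G" "isomorphic_to_lp C r (dim G) G"
      using C[rule_format, of "e ` {..<n}"] by auto
    define M where "M = dim G"
    obtain T A B where add: "\<forall>a\<in>lp_carrier M. \<forall>b\<in>lp_carrier M. T (\<lambda>i. a i + b i) = T a + T b"
      and scale: "\<forall>a\<in>lp_carrier M. \<forall>c. T (\<lambda>i. c * a i) = c *\<^sub>R T a"
      and img: "T ` lp_carrier M = G" and AB: "0 \<le> A" "0 \<le> B" "A * B \<le> C"
      and bnd: "\<And>a. a \<in> lp_carrier M \<Longrightarrow> norm (T a) \<le> A * lp_norm r M a"
        "\<And>a. a \<in> lp_carrier M \<Longrightarrow> lp_norm r M a \<le> B * norm (T a)"
      using G(2) unfolding isomorphic_to_lp_def M_def[symmetric] by blast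
    define unit :: "nat \<Rightarrow> nat \<Rightarrow> real" where "unit t = (\<lambda>i. if i = t then 1 else 0)" for t
    have unit: "unit t \<in> lp_carrier M" if "t < M" for t using that by (auto simp: unit_def lp_carrier_def)
    \<comment> \<open>Slightly larger than \<open>B\<close>, so that \<open>R\<close> is positive,
      yet A * R exceeds A * B by at most 1.\<close>
    define R where "R = B + 1 / (A + 1)"
    have R: "R > 0" using AB by (simp add: R_def add_nonneg_pos)
    have "A * (1 / (A + 1)) \<le> 1" using AB by simp
    moreover have "A * R = A * B + A * (1 / (A + 1))" unfolding R_def by (rule distrib_left)
    ultimately have AR: "A * R \<le> \<bar>C\<bar> + 1" using AB by linarith
    have bR: "lp_norm r M a \<le> R * norm (T a)" if "a \<in> lp_carrier M" for a
    proof -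
      have "B * norm (T a) \<le> R * norm (T a)" using AB by (intro mult_right_mono) (auto simp: R_def)
      then show ?thesis using bnd(2)[OF that] by simp
    qed
    have "\<exists>a\<in>lp_carrier M. T a = e j" if "j < n" for j
    proof -
      have "e j \<in> G" using G(1) that by (auto intro: span_base)
      then obtain a where "a \<in> lp_carrier M" "e j = T a" using img by auto
      then show ?thesis by auto
    qed
    then obtain a where a: "\<And>j. j < n \<Longrightarrow> a j \<in> lp_carrier M" "\<And>j. j < n \<Longrightarrow> T (a j) = e j" by metis
    have comb: "lp_norm r M (\<lambda>t. \<Sum>j<n. c j * a j t) \<le> R * sqrt (\<Sum>j<n. (c j)\<^sup>2)" for c
    proof -
      have "T (\<lambda>t. \<Sum>j<n. c j * a j t) = (\<Sum>j<n. c j *\<^sub>R e j)"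
        using lp_linear_sum(2)[OF add scale a(1), where k = n and c = c] a(2) by simp
      then have "lp_norm r M (\<lambda>t. \<Sum>j<n. c j * a j t) \<le> R * norm (\<Sum>j<n. c j *\<^sub>R e j)"
        using bR[OF lp_linear_sum(1)[OF add scale, where k = n and c = c and a = a, OF a(1)]] by simp
      also have "\<dots> \<le> R * sqrt (\<Sum>j<n. (c j)\<^sup>2)" using R e by (intro mult_left_mono) (auto simp: n_def)
      finally show ?thesis .
    qed
    show "p_dominated p (8 * (\<bar>C\<bar> + 1) * real m ^ 3) (\<lambda>\<psi>. \<Sum>j<m^4. \<bar>blinfun_apply \<psi> (e j)\<bar>)"
      unfolding p_dominated_def
    proof (intro allI)
      fix N and \<psi> :: "nat \<Rightarrow> 'b \<Rightarrow>\<^sub>L real"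
      define W where "W = weak_norm p N \<psi>"
      have W: "W \<ge> 0" unfolding W_def by (rule weak_norm_nonneg[OF p])
      define u where "u l t = \<psi> l (T (unit t))" for l t
      have app: "\<psi> l (T x) = (\<Sum>t<M. u l t * x t)" if "x \<in> lp_carrier M" for l x
        unfolding lp_linear_eq_sum[OF add scale that]
        by (simp add: blinfun.sum_right blinfun.scaleR_right u_def unit_def mult.commute)
      have uT: "(\<Sum>l<N. \<bar>\<psi> l (T x)\<bar> powr p) \<le> (W * A * h) powr p"
        if "x \<in> lp_carrier M" "lp_norm r M x \<le> h" for x h
      proof -
        have "(\<Sum>l<N. \<bar>\<psi> l (T x)\<bar> powr p) \<le> (W * norm (T x)) powr p"
          unfolding W_def by (rule sum_powr_le_weak_norm[OF p])
        also have "norm (T x) \<le> A * h"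
          using bnd(1)[OF that(1)] that(2) AB(1) by (meson mult_left_mono order_trans)
        then have "(W * norm (T x)) powr p \<le> (W * A * h) powr p"
          using W p by (intro powr_mono2) (auto simp: mult.assoc intro!: mult_left_mono)
        finally show ?thesis .
      qed
      have "(\<Sum>l<N. (\<Sum>j<m^4. \<bar>\<Sum>t<M. u l t * a j t\<bar>) powr p) \<le> (8 * real m ^ 3 * (W * A) * R) powr p"
        using r
      proof (elim disjE conjE)
        assume r: "r = \<infinity>"
        show ?thesis
        proof (rule sum_coordinate_powr_le_Linf[OF p m less_imp_le[OF R]])
          fix t assume t: "t < M"
          define s where "s = (\<Sum>j<n. (a j t)\<^sup>2)"
          \<comment> \<open>With coefficients \<open>a j t\<close> for this fixed \<open>t\<close>,
            coordinate \<open>t\<close> of the combination is the square sum itself.\<close>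
          have "s = (\<Sum>j<n. a j t * a j t)" by (simp add: s_def power2_eq_square)
          also have "\<dots> \<le> lp_norm r M (\<lambda>t'. \<Sum>j<n. a j t * a j t')"
            using abs_le_lp_norm_infinity[OF t, of "\<lambda>t'. \<Sum>j<n. a j t * a j t'"] r by simp
          also have "\<dots> \<le> R * sqrt s" using comb[of "\<lambda>j. a j t"] by (simp add: s_def)
          finally show "(\<Sum>j<m^4. (a j t)\<^sup>2) \<le> R\<^sup>2"
            using R le_square_of_le_sqrt[of s R] by (simp add: s_def n_def sum_nonneg)
        next
          fix x :: "nat \<Rightarrow> real" and h :: real
          assume h: "0 \<le> h" and x: "\<And>t. t < M \<Longrightarrow> \<bar>x t\<bar> \<le> h"
          define x' where "x' = (\<lambda>t. if t < M then x t else 0)"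
          have x': "x' \<in> lp_carrier M" by (simp add: x'_def lp_carrier_def)
          have "lp_norm r M x' \<le> h"
            unfolding r lp_norm_infinity_le_iff[OF h] using x by (simp add: x'_def)
          from uT[OF x' this] show "(\<Sum>l<N. \<bar>\<Sum>t<M. u l t * x t\<bar> powr p) \<le> (W * A * h) powr p"
            unfolding app[OF x'] by (simp add: x'_def)
        qed (use W AB in auto)
      next
        assume r: "r = 1" and p2: "2 \<le> p"
        show ?thesis
        proof (rule sum_coordinate_powr_le_L1[OF p2 m R])
          fix j assume j: "j < m ^ 4"
          have "(\<Sum>i<n. unit j i * a i t) = a j t" for t
          proof -
            have "(\<Sum>i<n. unit j i * a i t) = (\<Sum>i<n. if i = j then a j t else 0)"
              by (intro sum.cong) (auto simp: unit_def)
            then show ?thesis using j by (simp add: n_def)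
          qed
          moreover have "(\<Sum>i<n. (unit j i)\<^sup>2) = 1"
          proof -
            have "(\<Sum>i<n. (unit j i)\<^sup>2) = (\<Sum>i<n. if i = j then 1 else 0)"
              by (intro sum.cong) (auto simp: unit_def)
            then show ?thesis using j by (simp add: n_def)
          qed
          ultimately show "(\<Sum>t<M. \<bar>a j t\<bar>) \<le> R"
            using comb[of "unit j"] by (simp add: r lp_norm_1)
        next
          fix x :: "nat \<Rightarrow> real" and h :: real
          assume h: "0 \<le> h" and x: "\<And>t. t < M \<Longrightarrow> \<bar>x t\<bar> \<le> h"
          define d where "d j = (\<Sum>t<M. a j t * x t)" for j
          define s where "s = (\<Sum>j<n. (d j)\<^sup>2)"
          \<comment> \<open>The dual argument: with coefficients \<open>d j\<close>, pair the
            combination, bounded in l1, with the bounded vector \<open>x\<close>.\<close>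
          have "s = (\<Sum>j<n. \<Sum>t<M. d j * a j t * x t)"
            by (simp add: s_def power2_eq_square sum_distrib_left mult.assoc flip: d_def) (simp add: d_def sum_distrib_left mult_ac)
          also have "\<dots> = (\<Sum>t<M. (\<Sum>j<n. d j * a j t) * x t)"
            unfolding sum_distrib_right by (rule sum.swap)
          also have "\<dots> \<le> (\<Sum>t<M. \<bar>\<Sum>j<n. d j * a j t\<bar> * h)"
          proof (intro sum_mono)
            fix t assume "t \<in> {..<M}"
            then have "\<bar>\<Sum>j<n. d j * a j t\<bar> * \<bar>x t\<bar> \<le> \<bar>\<Sum>j<n. d j * a j t\<bar> * h"
              using x by (intro mult_left_mono) auto
            then show "(\<Sum>j<n. d j * a j t) * x t \<le> \<bar>\<Sum>j<n. d j * a j t\<bar> * h"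
              using abs_ge_self[of "(\<Sum>j<n. d j * a j t) * x t"] by (simp add: abs_mult)
          qed
          also have "\<dots> = h * lp_norm r M (\<lambda>t. \<Sum>j<n. d j * a j t)"
            by (simp add: r lp_norm_1 sum_distrib_left mult.commute)
          also have "\<dots> \<le> h * (R * sqrt s)"
            unfolding s_def by (intro mult_left_mono comb h)
          finally have "s \<le> (R * h) * sqrt s" by (simp add: mult_ac)
          then have "s \<le> (R * h)\<^sup>2"
            using R h by (intro le_square_of_le_sqrt) (auto simp: s_def sum_nonneg)
          then show "(\<Sum>j<m^4. (\<Sum>t<M. a j t * x t)\<^sup>2) \<le> (R * h)\<^sup>2" by (simp add: s_def d_def n_def)
        next
          fix t assume t: "t < M"
          have "(\<Sum>i<M. \<bar>unit t i\<bar>) = (\<Sum>i<M. if i = t then 1 else 0)"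
            by (intro sum.cong) (auto simp: unit_def)
          then have "lp_norm r M (unit t) \<le> 1" using t by (simp add: r lp_norm_1)
          from uT[OF unit[OF t] this] show "(\<Sum>l<N. \<bar>u l t\<bar> powr p) \<le> (W * A) powr p"
            by (simp add: u_def)
        qed (use W AB in auto)
      qed
      also have "\<dots> \<le> (8 * (\<bar>C\<bar> + 1) * real m ^ 3 * W) powr p"
      proof (intro powr_mono2)
        have "(8 * real m ^ 3 * W) * (A * R) \<le> (8 * real m ^ 3 * W) * (\<bar>C\<bar> + 1)"
          using AR W by (intro mult_left_mono) auto
        then show "8 * real m ^ 3 * (W * A) * R \<le> 8 * (\<bar>C\<bar> + 1) * real m ^ 3 * W"
          by (simp only: mult_ac)
      qed (use p W AB R in auto)
      finally have "(\<Sum>l<N. (\<Sum>j<m^4. \<bar>\<Sum>t<M. u l t * a j t\<bar>) powr p) \<le> (8 * (\<bar>C\<bar> + 1) * real m ^ 3 * W) powr p" .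
      moreover have "(\<Sum>t<M. u l t * a j t) = \<psi> l (e j)" if "j < m ^ 4" for l j
        using app[OF a(1)] a(2) that by (simp add: n_def)
      ultimately show "(\<Sum>i<N. \<bar>\<Sum>j<m ^ 4. \<bar>blinfun_apply (\<psi> i) (e j)\<bar>\<bar> powr p)
          \<le> (8 * (\<bar>C\<bar> + 1) * real m ^ 3 * weak_norm p N \<psi>) powr p"
        by (simp add: W_def sum_nonneg)
    qed
  qed simp
qed

section \<open>Failure of regularity\<close>

lemma FVL_abs_eval: "(\<lambda>\<psi>. \<bar>blinfun_apply \<psi> y\<bar>) \<in> FVL"
  using FVL_abs[OF point_eval_in_FVL[of y]] by (simp add: point_eval_def)

lemma sum_quarter_powers_le:
  assumes "n \<le> m"
  shows "(\<Sum>k\<in>{n<..m}. (1 / 4) ^ k) \<le> (1 / 4 :: real) ^ n"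
proof -
  have "(\<Sum>k\<in>{n<..n + d}. (1 / 4) ^ k) \<le> (1 / 4 :: real) ^ n - (1 / 4) ^ (n + d)" for d
  proof (induction d)
    case (Suc d)
    have "{n<..n + Suc d} = insert (n + Suc d) {n<..n + d}" by auto
    then have "(\<Sum>k\<in>{n<..n + Suc d}. (1 / 4 :: real) ^ k) = (1 / 4) ^ (n + d) / 4 + (\<Sum>k\<in>{n<..n + d}. (1 / 4) ^ k)"
      by simp
    moreover have "(1 / 4 :: real) ^ (n + Suc d) = (1 / 4) ^ (n + d) / 4" by simp
    moreover have "0 \<le> (1 / 4 :: real) ^ (n + d)" by simp
    ultimately show ?case using Suc by linarith
  qed simp
  from this[of "m - n"] have "(\<Sum>k\<in>{n<..m}. (1 / 4) ^ k) \<le> (1 / 4 :: real) ^ n - (1 / 4) ^ m"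
    using assms by simp
  moreover have "0 \<le> (1 / 4 :: real) ^ m" by simp
  ultimately show ?thesis by linarith
qed

section \<open>Suprema of geometrically small sequences\<close>

lemma p_dominated_scale:
  assumes "p_dominated p C f" "0 \<le> c"
  shows "p_dominated p (c * C) (\<lambda>\<phi>. c * f \<phi>)"
  unfolding p_dominated_def
proof (intro allI)
  fix n and \<phi> :: "nat \<Rightarrow> 'a \<Rightarrow>\<^sub>L real"
  have "(\<Sum>i<n. \<bar>c * f (\<phi> i)\<bar> powr p) = c powr p * (\<Sum>i<n. \<bar>f (\<phi> i)\<bar> powr p)"
    using assms(2) by (simp add: abs_mult powr_mult sum_distrib_left)
  also have "\<dots> \<le> c powr p * (C * weak_norm p n \<phi>) powr p"
    using assms(1) by (intro mult_left_mono) (auto simp: p_dominated_def)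
  also have "\<dots> = (c * C * weak_norm p n \<phi>) powr p" by (simp only: powr_mult mult_ac)
  finally show "(\<Sum>i<n. \<bar>c * f (\<phi> i)\<bar> powr p) \<le> (c * C * weak_norm p n \<phi>) powr p" .
qed

lemma p_dominated_SUP:
  fixes a :: "nat \<Rightarrow> ('a::banach \<Rightarrow>\<^sub>L real) \<Rightarrow> real"
  assumes p: "1 \<le> p" and \<kappa>: "0 \<le> \<kappa>" and dom: "\<And>k. p_dominated p (\<kappa> / 4 ^ k) (a k)"
  shows "bdd_above (range (\<lambda>k. a k \<phi>))"
    and "(SUP k. a k \<phi>) \<le> \<kappa> * norm \<phi>"
proof -
  have *: "a k \<phi> \<le> \<kappa> * norm \<phi>" for k
  proof -
    have "a k \<phi> \<le> \<kappa> / 4 ^ k * norm \<phi>"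
      using p_dominated_abs_le_norm[OF p dom, of k \<phi>] \<kappa> by simp
    also have "\<dots> \<le> \<kappa> * norm \<phi>"
      using \<kappa> by (intro mult_right_mono) (auto simp: divide_le_eq mult_le_cancel_left1)
    finally show ?thesis .
  qed
  then show "bdd_above (range (\<lambda>k. a k \<phi>))" "(SUP k. a k \<phi>) \<le> \<kappa> * norm \<phi>"
    by (auto intro!: bdd_aboveI2 cSUP_least)
qed

text \<open>Finite maxima approximate the supremum: from n to m the maximum grows by at most a
  single \<open>a k\<close> with n < k \<le> m. Its p-th power is at most the sum of all of them,
  and these sums decay geometrically.\<close>

lemma SUP_FVL_approx:
  fixes a :: "nat \<Rightarrow> ('a::banach \<Rightarrow>\<^sub>L real) \<Rightarrow> real"
  assumes p: "1 \<le> p" and \<kappa>: "0 \<le> \<kappa>" and dom: "\<And>k. p_dominated p (\<kappa> / 4 ^ k) (a k)"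
    and a: "\<And>k. a k \<in> FVL" and nonneg: "\<And>k \<phi>. 0 \<le> a k \<phi>" and \<epsilon>: "0 < \<epsilon>"
  shows "\<exists>g\<in>FVL. p_dominated p \<epsilon> (\<lambda>\<phi>. (SUP k. a k \<phi>) - g \<phi>)"
proof -
  define S where "S \<phi> = (SUP k. a k \<phi>)" for \<phi>
  define M where "M n \<phi> = Max ((\<lambda>k. a k \<phi>) ` {..n})" for n :: nat and \<phi>
  have aM: "a k \<phi> \<le> M n \<phi>" if "k \<le> n" for k n \<phi>
    unfolding M_def using that by (intro Max_ge) auto
  have M0: "0 \<le> M n \<phi>" for n \<phi> using nonneg aM[of n n \<phi>] order_trans by blast
  have mono: "M n \<phi> \<le> M m \<phi>" if "n \<le> m" for n m \<phi>
    unfolding M_def using that by (intro Max_mono) auto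
  have lim: "(\<lambda>m. M m \<phi>) \<longlonglongrightarrow> S \<phi>" for \<phi>
  proof (rule increasing_LIMSEQ)
    show "M n \<phi> \<le> M (Suc n) \<phi>" for n by (intro mono) simp
    show "M n \<phi> \<le> S \<phi>" for n
      unfolding M_def S_def
      by (intro Max.boundedI) (auto intro: cSUP_upper p_dominated_SUP(1)[OF p \<kappa> dom])
    fix e :: real assume "0 < e"
    then have "S \<phi> - e < (SUP k. a k \<phi>)" by (simp add: S_def)
    then obtain k where "S \<phi> - e < a k \<phi>"
      by (subst (asm) less_cSUP_iff) (auto intro: p_dominated_SUP(1)[OF p \<kappa> dom])
    then show "\<exists>n. S \<phi> \<le> M n \<phi> + e" using aM[of k k \<phi>] by (intro exI[of _ k]) simp
  qed
  have gap: "\<bar>M m \<phi> - M n \<phi>\<bar> powr p \<le> (\<Sum>k\<in>{n<..m}. \<bar>a k \<phi>\<bar> powr p)" if "n \<le> m" for n m \<phi>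
  proof -
    have "M m \<phi> \<in> (\<lambda>k. a k \<phi>) ` {..m}" unfolding M_def by (intro Max_in) auto
    then obtain k where k: "k \<le> m" "M m \<phi> = a k \<phi>" by auto
    show ?thesis
    proof (cases "k \<le> n")
      case True
      then have "M m \<phi> - M n \<phi> = 0" using k aM[of k n \<phi>] mono[OF that, of \<phi>] by simp
      then show ?thesis by (simp add: sum_nonneg)
    next
      case False
      have "\<bar>M m \<phi> - M n \<phi>\<bar> powr p \<le> \<bar>a k \<phi>\<bar> powr p"
        using k M0[of n \<phi>] mono[OF that, of \<phi>] p by (intro powr_mono2) auto
      also have "\<dots> \<le> (\<Sum>k\<in>{n<..m}. \<bar>a k \<phi>\<bar> powr p)"
        using False k by (intro member_le_sum) auto
      finally show ?thesis .
    qed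
  qed
  \<comment> \<open>Here (1/4)^n bounds the tail of the series of p-th powers, so this index brings
    the error below \<epsilon>^p.\<close>
  obtain n where "(\<kappa> / \<epsilon>) powr p < 4 ^ n" using real_arch_pow[of 4 "(\<kappa> / \<epsilon>) powr p"] by auto
  then have n: "\<kappa> powr p * (1 / 4) ^ n \<le> \<epsilon> powr p"
    using \<epsilon> \<kappa> by (simp add: powr_divide field_simps)
  have "p_dominated p \<epsilon> (\<lambda>\<phi>. S \<phi> - M n \<phi>)"
    unfolding p_dominated_def
  proof (intro allI)
    fix N and \<phi> :: "nat \<Rightarrow> 'a \<Rightarrow>\<^sub>L real"
    define W where "W = weak_norm p N \<phi>"
    have W: "W \<ge> 0" unfolding W_def by (rule weak_norm_nonneg[OF p])
    have le: "(\<Sum>l<N. \<bar>M m (\<phi> l) - M n (\<phi> l)\<bar> powr p) \<le> (\<epsilon> * W) powr p" if "n \<le> m" for m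
    proof -
      have "(\<Sum>l<N. \<bar>M m (\<phi> l) - M n (\<phi> l)\<bar> powr p) \<le> (\<Sum>l<N. \<Sum>k\<in>{n<..m}. \<bar>a k (\<phi> l)\<bar> powr p)"
        by (intro sum_mono gap that)
      also have "\<dots> = (\<Sum>k\<in>{n<..m}. \<Sum>l<N. \<bar>a k (\<phi> l)\<bar> powr p)" by (rule sum.swap)
      also have "\<dots> \<le> (\<Sum>k\<in>{n<..m}. (\<kappa> * W) powr p * (1 / 4) ^ k)"
      proof (intro sum_mono)
        fix k
        have "(\<Sum>l<N. \<bar>a k (\<phi> l)\<bar> powr p) \<le> (\<kappa> / 4 ^ k * W) powr p"
          using dom[of k] by (simp add: p_dominated_def W_def)
        also have "\<dots> = (\<kappa> * W) powr p * ((1 / 4) ^ k) powr p"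
          by (simp add: power_divide flip: powr_mult)
        also have "((1 / 4) ^ k) powr p \<le> ((1 / 4) ^ k) powr (1::real)"
          using p by (intro powr_mono') (auto simp: power_le_one)
        then have "(\<kappa> * W) powr p * ((1 / 4) ^ k) powr p \<le> (\<kappa> * W) powr p * (1 / 4) ^ k"
          by (intro mult_left_mono) auto
        finally show "(\<Sum>l<N. \<bar>a k (\<phi> l)\<bar> powr p) \<le> (\<kappa> * W) powr p * (1 / 4) ^ k" .
      qed
      also have "\<dots> = (\<kappa> * W) powr p * (\<Sum>k\<in>{n<..m}. (1 / 4) ^ k)" by (rule sum_distrib_left[symmetric])
      also have "\<dots> \<le> (\<kappa> * W) powr p * (1 / 4) ^ n"
        by (intro mult_left_mono sum_quarter_powers_le that) auto
      also have "\<dots> = (\<kappa> powr p * (1 / 4) ^ n) * W powr p" by (simp only: powr_mult mult_ac)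
      also have "\<dots> \<le> \<epsilon> powr p * W powr p" by (intro mult_right_mono n) auto
      also have "\<dots> = (\<epsilon> * W) powr p" by (rule powr_mult[symmetric])
      finally show ?thesis .
    qed
    \<comment> \<open>For a fixed finite family the bound, uniform in \<open>m\<close>, survives the
      pointwise limit.\<close>
    have "(\<lambda>m. \<Sum>l<N. \<bar>M m (\<phi> l) - M n (\<phi> l)\<bar> powr p) \<longlonglongrightarrow> (\<Sum>l<N. \<bar>S (\<phi> l) - M n (\<phi> l)\<bar> powr p)"
      using p by (intro tendsto_sum tendsto_powr' tendsto_rabs tendsto_diff lim tendsto_const) auto
    then show "(\<Sum>l<N. \<bar>S (\<phi> l) - M n (\<phi> l)\<bar> powr p) \<le> (\<epsilon> * weak_norm p N \<phi>) powr p"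
      unfolding W_def[symmetric] by (rule LIMSEQ_le_const2) (use le in blast)
  qed
  moreover have "M n \<in> FVL" unfolding M_def using FVL_Max[OF a] .
  ultimately show ?thesis unfolding S_def by blast
qed

text \<open>By \<open>weak_norm_le\<close> only values at a point matter, and there the upper
  Khintchine inequality bounds the p-th moments. Apart from the p-th root of the number of sign
  vectors, the bound is free of \<open>n\<close>.\<close>

lemma random_perturbation_weak_norm_le:
  fixes \<psi> :: "'a::banach \<Rightarrow>\<^sub>L real" and \<phi> :: "nat \<Rightarrow> 'a \<Rightarrow>\<^sub>L real"
  assumes p: "1 \<le> p" and C: "0 \<le> C" and t: "0 \<le> t" "t \<le> 1"
    and \<phi>: "\<And>x. (\<Sum>j<n. (\<phi> j x)\<^sup>2) \<le> (C * norm x)\<^sup>2"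
  shows "weak_norm p (2 ^ n) (\<lambda>l. \<psi> + t *\<^sub>R (\<Sum>j<n. rad l j *\<^sub>R \<phi> j))
    \<le> (2 ^ n) powr (1 / p) * (4 * (norm \<psi> + Khintchine_const p * C))"
proof (rule weak_norm_le[OF p])
  \<comment> \<open>Being at least 1, the constant is below its own p-th power and can be moved
    inside the power.\<close>
  have K1: "1 \<le> Khintchine_const p"
  proof -
    have "1 \<le> p powr p" using p by (intro ge_one_powr_ge_zero) auto
    moreover have "1 \<le> exp (1::real)" by simp
    ultimately have "1 * 1 \<le> p powr p * exp (1::real)" by (intro mult_mono) auto
    then show ?thesis unfolding Khintchine_const_def by linarith
  qed
  define K where "K = Khintchine_const p"
  define D where "D = norm \<psi> + K * C"
  have D: "norm \<psi> \<le> D" "K * C \<le> D" "0 \<le> D" using K1 C by (auto simp: D_def K_def)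
  show "0 \<le> (2 ^ n) powr (1 / p) * (4 * (norm \<psi> + Khintchine_const p * C))"
    using D(3) by (simp add: D_def K_def)
  fix x
  define S where "S l = (\<Sum>j<n. rad l j * \<phi> j x)" for l
  have S: "(\<psi> + t *\<^sub>R (\<Sum>j<n. rad l j *\<^sub>R \<phi> j)) x = \<psi> x + t * S l" for l
    by (simp add: blinfun.add_left blinfun.scaleR_left blinfun.sum_left S_def)
  have "(\<Sum>l<2^n. \<bar>\<psi> x + t * S l\<bar> powr p) \<le> (\<Sum>l<2^n. 2 powr p * (\<bar>\<psi> x\<bar> powr p + \<bar>S l\<bar> powr p))"
  proof (intro sum_mono)
    fix l
    have "t * \<bar>S l\<bar> \<le> \<bar>S l\<bar>" using t by (intro mult_left_le_one_le) auto
    then have "\<bar>\<psi> x + t * S l\<bar> \<le> \<bar>\<psi> x\<bar> + \<bar>S l\<bar>"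
      using abs_triangle_ineq[of "\<psi> x" "t * S l"] t by (simp add: abs_mult)
    then have "\<bar>\<psi> x + t * S l\<bar> powr p \<le> (\<bar>\<psi> x\<bar> + \<bar>S l\<bar>) powr p"
      using p by (intro powr_mono2) auto
    also have "\<dots> \<le> 2 powr p * (\<bar>\<psi> x\<bar> powr p + \<bar>S l\<bar> powr p)"
      using p by (intro add_powr_le) auto
    finally show "\<bar>\<psi> x + t * S l\<bar> powr p \<le> \<dots>" .
  qed
  also have "\<dots> = 2 powr p * (2 ^ n * \<bar>\<psi> x\<bar> powr p + (\<Sum>l<2^n. \<bar>S l\<bar> powr p))"
    unfolding sum_distrib_left[symmetric] sum.distrib by simp
  also have "\<dots> \<le> 2 powr p * (2 ^ n * (D * norm x) powr p + 2 ^ n * (D * norm x) powr p)"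
  proof (intro mult_left_mono add_mono)
    have "\<bar>\<psi> x\<bar> \<le> D * norm x"
      using norm_blinfun[of \<psi> x] mult_right_mono[OF D(1) norm_ge_zero[of x]] by simp
    then show "\<bar>\<psi> x\<bar> powr p \<le> (D * norm x) powr p" using p by (intro powr_mono2) auto
    have "(\<Sum>l<2^n. \<bar>S l\<bar> powr p) \<le> 2 ^ n * K * (C * norm x) powr p"
      unfolding S_def K_def using p C \<phi> by (intro Khintchine_upper) auto
    also have "\<dots> \<le> 2 ^ n * K powr p * (C * norm x) powr p"
      using K1 p powr_mono[of 1 p K] by (intro mult_right_mono mult_left_mono) (auto simp: K_def)
    also have "\<dots> = 2 ^ n * (K * C * norm x) powr p" by (simp only: powr_mult mult_ac)
    also have "\<dots> \<le> 2 ^ n * (D * norm x) powr p"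
      using p D(2) K1 C by (intro mult_left_mono powr_mono2 mult_right_mono) (auto simp: K_def)
    finally show "(\<Sum>l<2^n. \<bar>S l\<bar> powr p) \<le> 2 ^ n * (D * norm x) powr p" .
  qed auto
  also have "\<dots> = 2 powr p * (2 * (2 ^ n * (D * norm x) powr p))" by simp
  also have "\<dots> \<le> 2 powr p * (2 powr p * (2 ^ n * (D * norm x) powr p))"
    using p powr_mono[of 1 p 2] by (intro mult_left_mono mult_right_mono) auto
  also have "(2::real) ^ n = ((2 ^ n) powr (1 / p)) powr p" using p by (simp add: powr_powr)
  also have "2 powr p * (2 powr p * (((2 ^ n) powr (1 / p)) powr p * (D * norm x) powr p))
      = ((2 * 2) * (((2 ^ n) powr (1 / p)) * (D * norm x))) powr p"
    unfolding powr_mult by (simp only: mult_ac)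
  also have "(2 * 2) * (((2 ^ n) powr (1 / p)) * (D * norm x)) = (2 ^ n) powr (1 / p) * (4 * D) * norm x"
    by simp
  finally show "(\<Sum>l<2^n. \<bar>(\<psi> + t *\<^sub>R (\<Sum>j<n. rad l j *\<^sub>R \<phi> j)) x\<bar> powr p)
      \<le> ((2 ^ n) powr (1 / p) * (4 * (norm \<psi> + Khintchine_const p * C)) * norm x) powr p"
    unfolding S D_def K_def .
qed

text \<open>At \<open>\<psi>\<close> itself the hypothesis \<open>upper\<close> may allow negative
  values. Along random perturbations the averaged absolute values become so large that
  \<open>v\<close> is nearly nonnegative, and \<open>v \<psi>\<close> is close to the mean of
  \<open>v\<close> over the perturbations.\<close>

lemma FBL_upper_bound_nonneg:
  fixes e :: "nat \<Rightarrow> nat \<Rightarrow> 'a::banach" and \<phi> :: "nat \<Rightarrow> nat \<Rightarrow> 'a \<Rightarrow>\<^sub>L real"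
  assumes p: "1 \<le> p" and C: "0 \<le> C" and v: "v \<in> FBL p"
    and e: "\<And>k c. norm (\<Sum>j<2^(16*k). c j *\<^sub>R e k j) \<le> sqrt (\<Sum>j<2^(16*k). (c j)\<^sup>2)"
    and \<phi>: "\<And>k x. (\<Sum>j<2^(16*k). (\<phi> k j x)\<^sup>2) \<le> (C * norm x)\<^sup>2"
    and biorth: "\<And>k i j. i < 2^(16*k) \<Longrightarrow> j < 2^(16*k) \<Longrightarrow> \<phi> k i (e k j) = (if i = j then 1 else 0)"
    and upper: "\<And>k \<psi>. min ((1 / 2^(14*k)) * (\<Sum>j<2^(16*k). \<bar>blinfun_apply \<psi> (e k j)\<bar>) - \<bar>\<psi> x\<bar>) 0 \<le> v \<psi>"
  shows "0 \<le> v \<psi>"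
proof -
  define K where "K = Khintchine_const 1"
  define D where "D = 4 * (norm \<psi> + Khintchine_const p * C)"
  have K0: "0 \<le> K" by (simp add: K_def Khintchine_const_def)
  have D0: "0 \<le> D" using C by (simp add: D_def Khintchine_const_def)
  have "- v \<psi> \<le> 0 + \<delta>" if \<delta>: "0 < \<delta>" for \<delta>
  proof -
    \<comment> \<open>The approximation error enters twice: at \<open>\<psi>\<close>, weighted by
      its norm, and on average over the perturbations, weighted by \<open>D\<close>.\<close>
    define \<epsilon> where "\<epsilon> = \<delta> / (2 * (norm \<psi> + D + 1))"
    have pos: "0 < norm \<psi> + D + 1" using D0 by (simp add: add_nonneg_pos)
    then have \<epsilon>: "0 < \<epsilon>" using \<delta> by (simp add: \<epsilon>_def)
    obtain g where g: "g \<in> FVL" "p_dominated p \<epsilon> (\<lambda>\<phi>. v \<phi> - g \<phi>)"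
      using FBL_D[OF p v \<epsilon>] by blast
    obtain Z L where Z: "finite Z" "0 \<le> L"
      "\<And>\<phi> \<psi>. \<bar>g \<phi> - g \<psi>\<bar> \<le> L * (\<Sum>z\<in>Z. \<bar>blinfun_apply \<phi> z - blinfun_apply \<psi> z\<bar>)"
      using FVL_Lipschitz[OF g(1)] by blast
    define Q where "Q = (\<Sum>z\<in>Z. K * (C * norm z))"
    define H where "H = L * Q + K * (C * norm x)"
    have H0: "0 \<le> H"
      using Z K0 C by (auto simp: H_def Q_def intro!: add_nonneg_nonneg mult_nonneg_nonneg sum_nonneg)
    \<comment> \<open>\<open>H\<close> bounds the mean change of \<open>g\<close> and of the
      evaluation at \<open>x\<close> per unit of \<open>t\<close>; the cap at 1 is for the weak norm
      estimate.\<close>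
    define t where "t = min 1 (\<delta> / (2 * (H + 1)))"
    have t: "0 < t" "t \<le> 1" using \<delta> H0 by (auto simp: t_def)
    \<comment> \<open>Large enough that, after the perturbation, the scaled sum is at least 4^k t -
      \<open>norm \<psi>\<close> and hence at least \<bar>\<psi> x\<bar>.\<close>
    obtain k where "(norm \<psi> + \<bar>\<psi> x\<bar>) / t < 4 ^ k" using real_arch_pow[of 4 "(norm \<psi> + \<bar>\<psi> x\<bar>) / t"] by auto
    then have k: "norm \<psi> + \<bar>\<psi> x\<bar> \<le> 4 ^ k * t" using t by (simp add: field_simps)
    define n :: nat where "n = 2 ^ (16 * k)"
    define S where "S l y = (\<Sum>j<n. rad l j * \<phi> k j y)" for l y
    define \<Psi> where "\<Psi> l = \<psi> + t *\<^sub>R (\<Sum>j<n. rad l j *\<^sub>R \<phi> k j)" for l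
    have \<Psi>: "\<Psi> l y = \<psi> y + t * S l y" for l y
      by (simp add: \<Psi>_def blinfun.add_left blinfun.scaleR_left blinfun.sum_left S_def)
    have avg: "(\<Sum>l<2^n. \<bar>S l y\<bar>) \<le> 2 ^ n * (K * (C * norm y))" for y
      using Khintchine_upper[of 1 "C * norm y" "\<lambda>j. \<phi> k j y" n] C \<phi>[where k = k and x = y]
      by (simp add: S_def K_def n_def mult.assoc)
    \<comment> \<open>Once the scaled sum at \<open>\<Psi> l\<close> reaches \<bar>\<psi> x\<bar>,
      only the change of the evaluation at \<open>x\<close> can make the bound negative.\<close>
    have v_low: "- v (\<Psi> l) \<le> t * \<bar>S l x\<bar>" for l
    proof -
      have *: "\<Psi> l (e k j) = \<psi> (e k j) + t * rad l j" if "j < n" for j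
      proof -
        have "S l (e k j) = (\<Sum>i<n. if i = j then rad l j else 0)"
          unfolding S_def using that biorth by (intro sum.cong) (auto simp: n_def)
        then show ?thesis using that by (simp add: \<Psi>)
      qed
      \<comment> \<open>Testing \<open>\<psi>\<close> on a sign combination: its own contribution is
        of order sqrt n, against n * t from the biorthogonal perturbation.\<close>
      have sg: "(\<Sum>j<n. \<bar>\<psi> (e k j)\<bar>) \<le> norm \<psi> * 2 ^ (8 * k)"
      proof -
        have "(\<Sum>j<n. \<bar>\<psi> (e k j)\<bar>) = \<psi> (\<Sum>j<n. sgn (\<psi> (e k j)) *\<^sub>R e k j)"
          by (simp add: blinfun.sum_right blinfun.scaleR_right abs_sgn mult.commute)
        also have "\<dots> \<le> norm \<psi> * norm (\<Sum>j<n. sgn (\<psi> (e k j)) *\<^sub>R e k j)"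
          by (rule order_trans[OF abs_ge_self]) (use norm_blinfun[of \<psi>] in simp)
        also have "\<dots> \<le> norm \<psi> * sqrt (\<Sum>j<n. (sgn (\<psi> (e k j)))\<^sup>2)"
          unfolding n_def by (intro mult_left_mono e) auto
        also have "\<dots> \<le> norm \<psi> * sqrt (\<Sum>j<n. 1)"
          by (intro mult_left_mono real_sqrt_le_mono sum_mono) (auto simp: sgn_if)
        also have "sqrt (\<Sum>j<n. 1) = 2 ^ (8 * k)"
          by (rule real_sqrt_unique) (auto simp: n_def simp flip: power_mult)
        finally show ?thesis .
      qed
      have "real n * t - norm \<psi> * 2 ^ (8 * k) \<le> (\<Sum>j<n. t - \<bar>\<psi> (e k j)\<bar>)"
        using sg by (simp add: sum_subtractf)
      also have "\<dots> \<le> (\<Sum>j<n. \<bar>\<Psi> l (e k j)\<bar>)"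
      proof (intro sum_mono)
        fix j assume "j \<in> {..<n}"
        then have "\<Psi> l (e k j) = \<psi> (e k j) + t * rad l j" using * by simp
        moreover have "\<bar>t * rad l j\<bar> = t" using t by (simp add: abs_mult)
        ultimately show "t - \<bar>\<psi> (e k j)\<bar> \<le> \<bar>\<Psi> l (e k j)\<bar>" by linarith
      qed
      finally have "(1 / 2^(14*k)) * (real n * t - norm \<psi> * 2 ^ (8 * k)) \<le> (1 / 2^(14*k)) * (\<Sum>j<n. \<bar>\<Psi> l (e k j)\<bar>)"
        by (intro mult_left_mono) auto
      moreover have "4 ^ k * t - norm \<psi> \<le> (1 / 2^(14*k)) * (real n * t - norm \<psi> * 2 ^ (8 * k))"
      proof -
        have n_eq: "real n = 2 ^ (14 * k) * 4 ^ k"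
        proof -
          have "(4::real) ^ k = 2 ^ (2 * k)" by (simp add: power_mult)
          then show ?thesis by (simp add: n_def flip: power_add)
        qed
        have "(2::real) ^ (8 * k) \<le> 2 ^ (14 * k)" by (intro power_increasing) auto
        then have "norm \<psi> * (2 ^ (8 * k) / 2 ^ (14 * k)) \<le> norm \<psi> * 1" by (intro mult_left_mono) auto
        then show ?thesis unfolding n_eq by (simp add: field_simps)
      qed
      ultimately have "\<bar>\<psi> x\<bar> \<le> (1 / 2^(14*k)) * (\<Sum>j<n. \<bar>\<Psi> l (e k j)\<bar>)" using k by linarith
      moreover have "\<bar>\<Psi> l x\<bar> \<le> \<bar>\<psi> x\<bar> + t * \<bar>S l x\<bar>"
        using abs_triangle_ineq[of "\<psi> x" "t * S l x"] t by (simp add: \<Psi> abs_mult)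
      moreover have "0 \<le> t * \<bar>S l x\<bar>" using t by simp
      ultimately show ?thesis using upper[of k "\<Psi> l"] unfolding n_def[symmetric] by linarith
    qed
    have "- v \<psi> \<le> \<epsilon> * norm \<psi> + t * (L * (\<Sum>z\<in>Z. \<bar>S l z\<bar>)) + \<bar>v (\<Psi> l) - g (\<Psi> l)\<bar> + t * \<bar>S l x\<bar>" for l
    proof -
      have "\<bar>v \<psi> - g \<psi>\<bar> \<le> \<epsilon> * norm \<psi>"
        using p_dominated_abs_le_norm[OF p g(2)] \<epsilon> by simp
      moreover have "\<bar>g (\<Psi> l) - g \<psi>\<bar> \<le> t * (L * (\<Sum>z\<in>Z. \<bar>S l z\<bar>))"
      proof -
        have "(\<Sum>z\<in>Z. \<bar>\<Psi> l z - \<psi> z\<bar>) = t * (\<Sum>z\<in>Z. \<bar>S l z\<bar>)"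
          using t by (simp add: \<Psi> abs_mult sum_distrib_left)
        then show ?thesis using Z(3)[of "\<Psi> l" \<psi>] by (simp add: mult.left_commute)
      qed
      ultimately show ?thesis using v_low[of l] by linarith
    qed
    then have "(\<Sum>l<(2::nat)^n. - v \<psi>) \<le> (\<Sum>l<2^n. \<epsilon> * norm \<psi> + t * (L * (\<Sum>z\<in>Z. \<bar>S l z\<bar>)) + \<bar>v (\<Psi> l) - g (\<Psi> l)\<bar> + t * \<bar>S l x\<bar>)"
      by (intro sum_mono)
    also have "\<dots> = 2 ^ n * (\<epsilon> * norm \<psi>) + t * (L * (\<Sum>z\<in>Z. \<Sum>l<2^n. \<bar>S l z\<bar>))
        + (\<Sum>l<2^n. \<bar>v (\<Psi> l) - g (\<Psi> l)\<bar>) + t * (\<Sum>l<2^n. \<bar>S l x\<bar>)"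
      by (simp add: sum.distrib sum_distrib_left) (rule sum.swap)
    also have "\<dots> \<le> 2 ^ n * (\<epsilon> * norm \<psi>) + t * (L * (\<Sum>z\<in>Z. 2 ^ n * (K * (C * norm z))))
        + 2 ^ n * (\<epsilon> * D) + t * (2 ^ n * (K * (C * norm x)))"
    proof (intro add_mono mult_left_mono sum_mono avg order_refl)
      show "(\<Sum>l<2^n. \<bar>v (\<Psi> l) - g (\<Psi> l)\<bar>) \<le> 2 ^ n * (\<epsilon> * D)"
      proof -
        define q where "q l = \<bar>v (\<Psi> l) - g (\<Psi> l)\<bar>" for l
        \<comment> \<open>Jensen gives the power p - 1 of the number of sign vectors and the weak
          norm supplies the remaining one, so the mean error is at most \<epsilon> D.\<close>
        have "(\<Sum>l<2^n. q l) powr p \<le> (2 ^ n) powr (p - 1) * (\<Sum>l<2^n. q l powr p)"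
          using sum_powr_le_card_sum_powr[of "{..<2^n::nat}" p q] p by (simp add: q_def)
        also have "\<dots> \<le> (2 ^ n) powr (p - 1) * (\<epsilon> * weak_norm p (2 ^ n) \<Psi>) powr p"
          using g(2) unfolding p_dominated_def q_def by (intro mult_left_mono) auto
        also have "\<dots> \<le> (2 ^ n) powr (p - 1) * (\<epsilon> * ((2 ^ n) powr (1 / p) * D)) powr p"
        proof (intro mult_left_mono powr_mono2)
          show "weak_norm p (2 ^ n) \<Psi> \<le> (2 ^ n) powr (1 / p) * D"
            unfolding \<Psi>_def D_def using p C t \<phi>[of k] 
            by (intro random_perturbation_weak_norm_le) (auto simp: n_def)
        qed (use \<epsilon> p weak_norm_nonneg[OF p, of "2 ^ n" \<Psi>] in auto)
        also have "\<dots> = ((2 ^ n) powr (p - 1) * ((2 ^ n) powr (1 / p)) powr p) * (\<epsilon> * D) powr p"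
          by (simp only: powr_mult mult_ac)
        also have "(2 ^ n) powr (p - 1) * ((2 ^ n) powr (1 / p)) powr p = ((2::real) ^ n) powr p"
          using p by (simp add: powr_powr powr_diff)
        also have "((2::real) ^ n) powr p * (\<epsilon> * D) powr p = (2 ^ n * (\<epsilon> * D)) powr p"
          by (rule powr_mult[symmetric])
        finally have "(\<Sum>l<2^n. q l) powr p \<le> (2 ^ n * (\<epsilon> * D)) powr p" .
        then have "(\<Sum>l<2^n. q l) \<le> 2 ^ n * (\<epsilon> * D)"
          using p \<epsilon> D0 powr_less_mono2[of p "2 ^ n * (\<epsilon> * D)" "\<Sum>l<2^n. q l"] by force
        then show ?thesis by (simp add: q_def)
      qed
    qed (use t Z \<epsilon> in auto)
    also have "(\<Sum>z\<in>Z. 2 ^ n * (K * (C * norm z))) = 2 ^ n * Q"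
      unfolding Q_def by (rule sum_distrib_left[symmetric])
    also have "2 ^ n * (\<epsilon> * norm \<psi>) + t * (L * (2 ^ n * Q)) + 2 ^ n * (\<epsilon> * D) + t * (2 ^ n * (K * (C * norm x)))
        = 2 ^ n * (\<epsilon> * (norm \<psi> + D) + t * H)"
      by (simp add: H_def algebra_simps)
    also have "(\<Sum>l<(2::nat)^n. - v \<psi>) = 2 ^ n * (- v \<psi>)" by simp
    finally have "- v \<psi> \<le> \<epsilon> * (norm \<psi> + D) + t * H" by (rule mult_left_le_imp_le) simp
    also have "\<dots> \<le> \<delta> / 2 + \<delta> / 2"
    proof (intro add_mono)
      have "\<epsilon> * (norm \<psi> + D) \<le> \<epsilon> * (norm \<psi> + D + 1)" using \<epsilon> by (intro mult_left_mono) auto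
      also have "\<dots> = \<delta> / 2" using pos by (simp add: \<epsilon>_def field_simps)
      finally show "\<epsilon> * (norm \<psi> + D) \<le> \<delta> / 2" .
      have "t * H \<le> \<delta> / (2 * (H + 1)) * (H + 1)"
        using H0 \<delta> by (intro mult_mono) (auto simp: t_def)
      also have "\<dots> = \<delta> / 2" using H0 by (simp add: field_simps)
      finally show "t * H \<le> \<delta> / 2" .
    qed
    finally show ?thesis by simp
  qed
  then have "- v \<psi> \<le> 0" by (rule field_le_epsilon)
  then show ?thesis by simp
qed

theorem corollary10p5:
  fixes i :: "'a::banach \<Rightarrow>\<^sub>L 'b::banach" and p :: real
  assumes "contains_l2n_uniformly_complementably TYPE('a)"
    and "\<forall>x. norm (blinfun_apply i x) = norm x"
    and "(script_L_space \<infinity> TYPE('b) \<and> 1 \<le> p) \<or> (script_L_space 1 TYPE('b) \<and> 2 \<le> p)"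
  shows "\<not> regular_image
             (FBL p :: (('a \<Rightarrow>\<^sub>L real) \<Rightarrow> real) set)
             (FBL p :: (('b \<Rightarrow>\<^sub>L real) \<Rightarrow> real) set)
             (ibar i)"
proof
  assume regular: "regular_image
             (FBL p :: (('a \<Rightarrow>\<^sub>L real) \<Rightarrow> real) set)
             (FBL p :: (('b \<Rightarrow>\<^sub>L real) \<Rightarrow> real) set)
             (ibar i)"
  have p: "1 \<le> p" using assms(3) by auto
  obtain C where C: "0 \<le> C" and basis: "\<And>n. \<exists>(e :: nat \<Rightarrow> 'a) (\<phi> :: nat \<Rightarrow> 'a \<Rightarrow>\<^sub>L real).
      (\<forall>c. norm (\<Sum>j<n. c j *\<^sub>R e j) \<le> sqrt (\<Sum>j<n. (c j)\<^sup>2)) \<and>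
      (\<forall>x. (\<Sum>j<n. (\<phi> j x)\<^sup>2) \<le> (C * norm x)\<^sup>2) \<and>
      (\<forall>j<n. \<forall>k<n. \<phi> j (e k) = (if j = k then 1 else 0))"
    using l2_basis_obtain[OF assms(1)] by blast
  have "\<exists>(e :: nat \<Rightarrow> nat \<Rightarrow> 'a). \<forall>k. \<exists>\<phi> :: nat \<Rightarrow> 'a \<Rightarrow>\<^sub>L real.
      (\<forall>c. norm (\<Sum>j<2^(16*k). c j *\<^sub>R e k j) \<le> sqrt (\<Sum>j<2^(16*k). (c j)\<^sup>2)) \<and>
      (\<forall>x. (\<Sum>j<2^(16*k). (\<phi> j x)\<^sup>2) \<le> (C * norm x)\<^sup>2) \<and>
      (\<forall>j<2^(16*k). \<forall>l<2^(16*k). \<phi> j (e k l) = (if j = l then 1 else 0))"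
    by (rule choice) (intro allI basis)
  then have "\<exists>(e :: nat \<Rightarrow> nat \<Rightarrow> 'a) (\<phi> :: nat \<Rightarrow> nat \<Rightarrow> 'a \<Rightarrow>\<^sub>L real). \<forall>k.
      (\<forall>c. norm (\<Sum>j<2^(16*k). c j *\<^sub>R e k j) \<le> sqrt (\<Sum>j<2^(16*k). (c j)\<^sup>2)) \<and>
      (\<forall>x. (\<Sum>j<2^(16*k). (\<phi> k j x)\<^sup>2) \<le> (C * norm x)\<^sup>2) \<and>
      (\<forall>j<2^(16*k). \<forall>l<2^(16*k). \<phi> k j (e k l) = (if j = l then 1 else 0))"
    by (elim exE) (rule exI, erule choice)
  then obtain e :: "nat \<Rightarrow> nat \<Rightarrow> 'a" and \<phi> :: "nat \<Rightarrow> nat \<Rightarrow> 'a \<Rightarrow>\<^sub>L real" where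
    e: "\<And>k c. norm (\<Sum>j<2^(16*k). c j *\<^sub>R e k j) \<le> sqrt (\<Sum>j<2^(16*k). (c j)\<^sup>2)"
    and \<phi>: "\<And>k x. (\<Sum>j<2^(16*k). (\<phi> k j x)\<^sup>2) \<le> (C * norm x)\<^sup>2"
    and biorth: "\<And>k i j. i < 2^(16*k) \<Longrightarrow> j < 2^(16*k) \<Longrightarrow> \<phi> k i (e k j) = (if i = j then 1 else 0)"
    by blast
  obtain \<kappa> where \<kappa>: "0 \<le> \<kappa>"
    and dom: "\<forall>m (e :: nat \<Rightarrow> 'b). 0 < m \<and> (\<forall>c. norm (\<Sum>j<m^4. c j *\<^sub>R e j) \<le> sqrt (\<Sum>j<m^4. (c j)\<^sup>2)) \<longrightarrow>
      p_dominated p (\<kappa> * real m ^ 3) (\<lambda>\<psi>. \<Sum>j<m^4. \<bar>blinfun_apply \<psi> (e j)\<bar>)"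
    using basis_sum_p_dominated[OF assms(3)] by (elim exE conjE)

  define a where "a k \<psi> = (1 / 2^(14*k)) * (\<Sum>j<2^(16*k). \<bar>blinfun_apply \<psi> (e k j)\<bar>)"
    for k and \<psi> :: "'a \<Rightarrow>\<^sub>L real"
  define b where "b k \<psi> = (1 / 2^(14*k)) * (\<Sum>j<2^(16*k). \<bar>blinfun_apply \<psi> (i (e k j))\<bar>)"
    for k and \<psi> :: "'b \<Rightarrow>\<^sub>L real"
  have a_FVL: "a k \<in> FVL" and b_FVL: "b k \<in> FVL" for k
    unfolding a_def b_def by (intro FVL_scale FVL_sum FVL_abs_eval)+
  have b_nonneg: "0 \<le> b k \<psi>" for k \<psi> by (simp add: b_def sum_nonneg)
  have b_dom: "p_dominated p (\<kappa> / 4 ^ k) (b k)" for k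
  proof -
    have pow: "(2::nat) ^ (16 * k) = (2 ^ (4 * k)) ^ 4" by (simp flip: power_mult)
    have "norm (\<Sum>j<2^(16*k). c j *\<^sub>R i (e k j)) \<le> sqrt (\<Sum>j<2^(16*k). (c j)\<^sup>2)" for c
    proof -
      have "(\<Sum>j<2^(16*k). c j *\<^sub>R i (e k j)) = i (\<Sum>j<2^(16*k). c j *\<^sub>R e k j)"
        by (simp add: blinfun.sum_right blinfun.scaleR_right)
      then show ?thesis using assms(2) e by simp
    qed
    then have "p_dominated p (\<kappa> * real (2 ^ (4 * k)) ^ 3) (\<lambda>\<psi>. \<Sum>j<2^(16*k). \<bar>blinfun_apply \<psi> (i (e k j))\<bar>)"
      unfolding pow by (intro dom[rule_format] conjI) auto
    then have "p_dominated p ((1 / 2^(14*k)) * (\<kappa> * real (2 ^ (4 * k)) ^ 3)) (b k)"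
      unfolding b_def by (intro p_dominated_scale) auto
    moreover have "(1 / 2^(14*k)) * (\<kappa> * real (2 ^ (4 * k)) ^ 3) = \<kappa> / 4 ^ k"
    proof -
      have "real (2 ^ (4 * k)) ^ 3 = 2 ^ (12 * k)" by (simp flip: power_mult)
      moreover have "(4::real) ^ k = 2 ^ (2 * k)" by (simp add: power_mult)
      ultimately have "real (2 ^ (4 * k)) ^ 3 * 4 ^ k = 2 ^ (14 * k)" by (simp flip: power_add)
      then have "2 ^ (14 * k) = real (2 ^ (4 * k)) ^ 3 * 4 ^ k" by (rule sym)
      then show ?thesis by (simp only:) simp
    qed
    ultimately show ?thesis by simp
  qed

  \<comment> \<open>For k = 0 the basis consists of a single vector, nonzero by
    biorthogonality.\<close>
  define z where "z = e 0 0"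
  have "\<phi> 0 0 z = 1" using biorth[of 0 0 0] by (simp add: z_def)
  then have z: "z \<noteq> 0" by auto
  obtain \<psi> :: "'b \<Rightarrow>\<^sub>L real" where \<psi>: "norm \<psi> \<le> 1" "\<psi> (i z) = norm (i z)"
    using exists_norming_functional by blast
  \<comment> \<open>Scaled so that the evaluation at \<psi> exceeds by 1 the bound \<kappa> for the
    supremum of the \<open>b k\<close> on the unit ball; this makes \<open>u\<close> at most -1
    there.\<close>
  define x where "x = ((\<kappa> + 1) / norm z) *\<^sub>R z"
  have \<psi>x: "\<psi> (i x) = \<kappa> + 1"
    using z \<psi>(2) assms(2) by (simp add: x_def blinfun.scaleR_right)

  define f where "f k = (\<lambda>\<psi>. min (a k \<psi> - \<bar>blinfun_apply \<psi> x\<bar>) 0)" for k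
  have f_FBL: "range f \<subseteq> FBL p"
  proof -
    have "f k \<in> FVL" for k
      unfolding f_def by (intro FVL_min FVL_diff a_FVL FVL_abs_eval FVL_zero)
    then show ?thesis using FVL_subset_FBL[OF p] by blast
  qed
  have "isLub (FBL p) (range f) (\<lambda>_. 0)"
  proof (rule isLubI2)
    show "isUb (FBL p) (range f) (\<lambda>_. 0)"
      using FVL_zero FVL_subset_FBL[OF p] by (intro isUbI setleI) (auto simp: f_def le_fun_def)
    show "(\<lambda>_. 0) <=* Collect (isUb (FBL p) (range f))"
    proof (rule setgeI, clarify)
      fix v assume v: "isUb (FBL p) (range f) v"
      have "f k \<le> v" for k using v by (rule isUbD) simp
      then have "min (a k \<psi> - \<bar>blinfun_apply \<psi> x\<bar>) 0 \<le> v \<psi>" for k \<psi>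
        unfolding f_def le_fun_def by blast
      then show "(\<lambda>_. 0) \<le> v"
        unfolding a_def le_fun_def
        using FBL_upper_bound_nonneg[OF p C isUbD2a[OF v] e \<phi> biorth] by blast
    qed
  qed
  then have lub: "isLub (FBL p) (ibar i ` range f) (ibar i (\<lambda>_. 0))"
    using regular f_FBL unfolding regular_image_def by blast

  \<comment> \<open>The candidate that contradicts regularity: \<open>b k\<close> is
    \<open>ibar i (a k)\<close>, and the supremum exists in the completion over Y by the geometric
    bound. Truncation at 0 is a contraction, so approximants of the supremum yield approximants of
    \<open>u\<close>.\<close>
  define u where "u = (\<lambda>\<psi>. min ((SUP k. b k \<psi>) - \<bar>blinfun_apply \<psi> (i x)\<bar>) 0)"
  have "u \<in> FBL p"
  proof (rule FBL_I[OF p])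
    fix \<epsilon> :: real assume \<epsilon>: "0 < \<epsilon>"
    obtain g where g: "g \<in> FVL" "p_dominated p \<epsilon> (\<lambda>\<psi>. (SUP k. b k \<psi>) - g \<psi>)"
      using SUP_FVL_approx[OF p \<kappa> b_dom b_FVL b_nonneg \<epsilon>] by blast
    show "\<exists>g\<in>FVL. p_dominated p \<epsilon> (\<lambda>\<psi>. u \<psi> - g \<psi>)"
    proof (rule bexI)
      show "p_dominated p \<epsilon> (\<lambda>\<psi>. u \<psi> - min (g \<psi> - \<bar>blinfun_apply \<psi> (i x)\<bar>) 0)"
        using \<epsilon> by (intro p_dominated_mono[OF p g(2)]) (auto simp: u_def)
      show "(\<lambda>\<psi>. min (g \<psi> - \<bar>blinfun_apply \<psi> (i x)\<bar>) 0) \<in> FVL"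
        by (intro FVL_min FVL_diff g FVL_abs_eval FVL_zero)
    qed
  qed
  moreover have "ibar i (f k) \<psi> \<le> u \<psi>" for k \<psi>
  proof -
    have "b k \<psi> \<le> (SUP k. b k \<psi>)"
      by (intro cSUP_upper p_dominated_SUP(1)[OF p \<kappa> b_dom]) simp
    then show ?thesis by (simp add: ibar_def f_def u_def a_def b_def min_le_iff_disj)
  qed
  ultimately have "isUb (FBL p) (ibar i ` range f) u"
    by (intro isUbI setleI) (auto simp: le_fun_def)
  then have "ibar i (\<lambda>_. 0) \<le> u" by (rule isLub_le_isUb[OF lub])
  then have "0 \<le> u \<psi>" by (simp add: ibar_def le_fun_def)
  moreover have "(SUP k. b k \<psi>) \<le> \<kappa>"
    using p_dominated_SUP(2)[OF p \<kappa> b_dom, of \<psi>] \<psi>(1) \<kappa> mult_left_mono[OF \<psi>(1) \<kappa>] by simp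
  ultimately show False using \<psi>x \<kappa> by (simp add: u_def)
qed

end
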